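(* Let $d\ge1$, $d<s<2d$, let $q\ge 1$, and let $\{P_k\}_{k\in\mathbb{Z}^d}$ be nonnegative numbers with $P_k=P_{-k}$ for every $k$ and $P_k\sim\|k\|_1^{-s}$. For each inverse temperature $\beta>0$ consider the infinite volume limit of the free random cluster model on $\mathbb{Z}^d$ with bond probabilities $1-e^{-\beta P_k}$ and with $q$ states. Let $$\beta_c=\inf\{\beta:\ \text{almost surely there exists an infinite cluster}\}.$$ Then at inverse temperature $\beta=\beta_c$, almost surely there is no infinite cluster.
   Context: $P_k\sim f(k)$ means $\lim_{\|k\|\to\infty}P_k/f(k)=1$. For a finite $\Lambda\subset\mathbb{Z}^d$, let $E_\Lambda$ be the set of all unordered pairs of distinct vertices of $\Lambda$. The free random cluster measure on $\Lambda$ with bond probabilities $p_k=1-e^{-\beta P_k}$ and $q\ge1$ states is the probability measure on $\{0,1\}^{E_\Lambda}$ assigning to $\omega$ a weight proportional to $q^{c(\omega)}\prod_{\{u,v\}\in E_\Lambda}p_{u-v}^{\omega(\{u,v\})}(1-p_{u-v})^{1-\omega(\{u,v\})}$, where $c(\omega)$ is the number of connected components of the graph $(\Lambda,\{e:\omega(e)=1\})$. Its infinite volume limit is the weak limit of these measures as $\Lambda\uparrow\mathbb{Z}^d$ (e.g. along increasing cubes); it is a probability measure on configurations of open/closed bonds between pairs of vertices of $\mathbb{Z}^d$. A cluster is a connected component of the graph of open bonds. *)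

theory Defs
  imports "HOL-Probability.Probability"
begin

definition l1_norm :: "int ^ 'd::finite \<Rightarrow> real" where
  "l1_norm k = (\<Sum>i\<in>UNIV. real_of_int \<bar>k $ i\<bar>)"

definition pairs :: "'v set \<Rightarrow> 'v set set" where
  "pairs V = {{u, v} |u v. u \<in> V \<and> v \<in> V \<and> u \<noteq> v}"

text \<open>A configuration maps each unordered pair of distinct vertices to True (open) or
  False (closed). Only its values on \<^term>\<open>pairs V\<close> are used for the graph on \<^term>\<open>V\<close>.\<close>

definition open_bonds :: "'v set \<Rightarrow> ('v set \<Rightarrow> bool) \<Rightarrow> 'v rel" where
  "open_bonds V \<omega> = {(u, v). u \<in> V \<and> v \<in> V \<and> u \<noteq> v \<and> \<omega> {u, v}}"

definition clusters :: "'v set \<Rightarrow> ('v set \<Rightarrow> bool) \<Rightarrow> 'v set set" where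
  "clusters V \<omega> = V // Restr ((open_bonds V \<omega>)\<^sup>*) V"

definition has_infinite_cluster :: "('v set \<Rightarrow> bool) \<Rightarrow> bool" where
  "has_infinite_cluster \<omega> \<longleftrightarrow> (\<exists>C\<in>clusters UNIV \<omega>. infinite C)"

text \<open>The description is proper for \<^term>\<open>e \<in> pairs UNIV\<close> as soon as
  \<^prop>\<open>\<forall>k. P (- k) = P k\<close>.\<close>

definition bond_prob :: "(int ^ 'd::finite \<Rightarrow> real) \<Rightarrow> real \<Rightarrow> (int ^ 'd) set \<Rightarrow> real" where
  "bond_prob P \<beta> e = (THE p. \<exists>u v. e = {u, v} \<and> p = 1 - exp (- \<beta> * P (u - v)))"

definition rc_weight ::
  "(int ^ 'd::finite \<Rightarrow> real) \<Rightarrow> real \<Rightarrow> real \<Rightarrow> (int ^ 'd) set \<Rightarrow> ((int ^ 'd) set \<Rightarrow> bool) \<Rightarrow> real"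
  where
  "rc_weight P q \<beta> \<Lambda> \<omega> = q ^ card (clusters \<Lambda> \<omega>) *
     (\<Prod>e\<in>pairs \<Lambda>. if \<omega> e then bond_prob P \<beta> e else 1 - bond_prob P \<beta> e)"

definition configs :: "'v set \<Rightarrow> ('v set \<Rightarrow> bool) set" where
  "configs \<Lambda> = (pairs \<Lambda> \<rightarrow>\<^sub>E UNIV)"

definition free_rc ::
  "(int ^ 'd::finite \<Rightarrow> real) \<Rightarrow> real \<Rightarrow> real \<Rightarrow> (int ^ 'd) set \<Rightarrow> ((int ^ 'd) set \<Rightarrow> bool) measure"
  where
  "free_rc P q \<beta> \<Lambda> = point_measure (configs \<Lambda>)
     (\<lambda>\<omega>. ennreal (rc_weight P q \<beta> \<Lambda> \<omega> / (\<Sum>\<eta>\<in>configs \<Lambda>. rc_weight P q \<beta> \<Lambda> \<eta>)))"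

definition config_topology :: "('v set \<Rightarrow> bool) topology" where
  "config_topology = product_topology (\<lambda>_. discrete_topology UNIV) (pairs UNIV)"

definition config_space :: "('v set \<Rightarrow> bool) measure" where
  "config_space = (\<Pi>\<^sub>M e\<in>pairs UNIV. count_space UNIV)"

text \<open>To compare measures on different \<^term>\<open>configs \<Lambda>\<close>, a configuration on \<^term>\<open>\<Lambda>\<close> is regarded
  as one on the whole lattice with every pair not contained in \<^term>\<open>\<Lambda>\<close> closed. This choice does
  not affect the weak limit, which only depends on finitely many pairs at a time.\<close>

definition extend_closed :: "'v set \<Rightarrow> ('v set \<Rightarrow> bool) \<Rightarrow> ('v set \<Rightarrow> bool)" where
  "extend_closed \<Lambda> \<omega> = (\<lambda>e\<in>pairs UNIV. e \<in> pairs \<Lambda> \<and> \<omega> e)"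

definition weak_limit ::
  "'c topology \<Rightarrow> ('i \<Rightarrow> 'c measure) \<Rightarrow> 'c measure \<Rightarrow> 'i filter \<Rightarrow> bool" where
  "weak_limit X \<mu> M F \<longleftrightarrow>
     (\<forall>f :: 'c \<Rightarrow> real. continuous_map X euclideanreal f \<and> bounded (f ` topspace X) \<longrightarrow>
        ((\<lambda>i. \<integral>\<omega>. f \<omega> \<partial>\<mu> i) \<longlongrightarrow> (\<integral>\<omega>. f \<omega> \<partial>M)) F)"

definition is_infinite_volume_limit ::
  "(int ^ 'd::finite \<Rightarrow> real) \<Rightarrow> real \<Rightarrow> real \<Rightarrow> ((int ^ 'd) set \<Rightarrow> bool) measure \<Rightarrow> bool" where
  "is_infinite_volume_limit P q \<beta> M \<longleftrightarrow> prob_space M \<and> sets M = sets config_space \<and>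
     weak_limit config_topology (\<lambda>\<Lambda>. distr (free_rc P q \<beta> \<Lambda>) config_space (extend_closed \<Lambda>)) M
       (finite_subsets_at_top UNIV)"

definition free_rc_infinite ::
  "(int ^ 'd::finite \<Rightarrow> real) \<Rightarrow> real \<Rightarrow> real \<Rightarrow> ((int ^ 'd) set \<Rightarrow> bool) measure" where
  "free_rc_infinite P q \<beta> = (THE M. is_infinite_volume_limit P q \<beta> M)"

definition critical_beta :: "(int ^ 'd::finite \<Rightarrow> real) \<Rightarrow> real \<Rightarrow> real" where
  "critical_beta P q =
     Inf {\<beta>. \<beta> > 0 \<and> (AE \<omega> in free_rc_infinite P q \<beta>. has_infinite_cluster \<omega>)}"

end

theory Submission
  imports Defs
begin

text \<open>
  The random cluster weight is supermodular, so by the four functions theorem the free measures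
  increase with the volume and dominate products of free measures over disjoint tiles; moreover,
  single edges have finite energy. Say that the criterion holds at \<open>\<beta>\<close> if, for some large \<open>N\<close>, a
  cube of side \<open>N\<close> contains with probability close to 1 a cluster with at least a suitable multiple
  of \<open>N\<^sup>s\<^sup>/\<^sup>2\<close> vertices. As \<open>s < 2d\<close>, the large clusters of the subcubes of a bigger cube are likely to
  be linked to each other by direct edges, so the criterion propagates to all larger scales and
  yields an infinite cluster. It concerns a finite volume, hence is an open condition on \<open>\<beta>\<close>.

  It remains to derive the criterion from percolation. Fix a vertex of an infinite cluster and
  consider edges of length less than \<open>r\<close> only. A short cluster of size much less than \<open>r\<^sup>s\<^sup>-\<^sup>d\<close> has no
  long edge with probability bounded below, so a positive density of vertices lies in short
  clusters of size at least of that order. Since these clusters are large, there are few ways to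
  two-colour them compared with the cost of closing all the edges of a tile between two colour
  classes; a union bound over colourings then shows that they merge, and iterating this over
  growing scales gives one cluster containing a positive fraction of a large cube. Thus percolation
  at the critical point would persist for slightly smaller \<open>\<beta>\<close>.
\<close>

section \<open>Clusters of finite graphs\<close>

text \<open>Two sets of m vertices within distance of order N share a total coupling of order m^2
  N^(-s), so N^(s/2) is the size at which direct links become likely. The exponent s - d appears
  because a vertex has total coupling of order r^(d-s) to everything beyond distance r. The same
  exponent balances the colouring argument: clusters of size K in a volume V have at most 2^(V/K)
  two-colourings, while cutting a positive fraction of the pairs inside tiles of side r costs of
  order V r^(d-s) in the exponent, so K has to exceed a large multiple of r^(s-d). Any such multiple
  is available for short clusters, at the price of a smaller but positive probability of having no
  long edge. After one merging K is of order r^d, which is far above r^(s-d) since s < 2d, and this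
  surplus pays for the next, larger scale. The obstacle for q > 1 is dependence. The closing of
  edges is therefore bounded conditionally on all other edges, and each stage exposes one set of
  edges and then uses only edges outside it.\<close>

definition joined :: "'v set set \<Rightarrow> 'v rel" where
  "joined S = {(u, v). u \<noteq> v \<and> {u, v} \<in> S}\<^sup>*"

text \<open>A configuration is represented by its set of open edges, so that sums over
  configurations are sums over \<open>Pow E\<close> and the lattice operations are union and
  intersection. A vertex that no edge of \<open>S\<close> meets has a singleton cluster, so no
  vertex set has to be carried along.\<close>

definition cl :: "'v set set \<Rightarrow> 'v \<Rightarrow> 'v set" where
  "cl S x = {y. (x, y) \<in> joined S}"

lemma joined_refl [simp]: "(x, x) \<in> joined S"
  by (simp add: joined_def)

lemma joined_trans: "(x, y) \<in> joined S \<Longrightarrow> (y, z) \<in> joined S \<Longrightarrow> (x, z) \<in> joined S"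
  unfolding joined_def by (rule rtrancl_trans)

lemma joined_sym: "(x, y) \<in> joined S \<Longrightarrow> (y, x) \<in> joined S"
proof -
  have "sym {(u, v). u \<noteq> v \<and> {u, v} \<in> S}"
    by (auto simp: sym_def insert_commute)
  then have "sym (joined S)" unfolding joined_def by (rule sym_rtrancl)
  then show "(x, y) \<in> joined S \<Longrightarrow> (y, x) \<in> joined S" by (rule symD)
qed

lemma joined_mono: "S \<subseteq> S' \<Longrightarrow> joined S \<subseteq> joined S'"
  unfolding joined_def by (rule rtrancl_mono) auto

lemma joined_edge: "{u, v} \<in> S \<Longrightarrow> (u, v) \<in> joined S"
  unfolding joined_def by (cases "u = v") auto

lemma cl_edge: "{u, v} \<in> S \<Longrightarrow> v \<in> cl S u"
  by (simp add: cl_def joined_edge)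

lemma cl_self [simp]: "x \<in> cl S x"
  by (simp add: cl_def)

lemma cl_mono: "S \<subseteq> S' \<Longrightarrow> cl S x \<subseteq> cl S' x"
  using joined_mono by (auto simp: cl_def)

lemma cl_eq: "y \<in> cl S x \<Longrightarrow> cl S y = cl S x"
  unfolding cl_def using joined_trans joined_sym by fast

lemma cl_sym: "y \<in> cl S x \<longleftrightarrow> x \<in> cl S y"
  unfolding cl_def using joined_sym by fast

text \<open>Induction along an open path in closure form: upper bounds on clusters are obtained by
  exhibiting a set that contains the starting vertex and that open edges do not leave.\<close>

lemma cl_closed:
  assumes "x \<in> U" "\<And>u v. {u, v} \<in> S \<Longrightarrow> u \<in> U \<Longrightarrow> v \<in> U"
  shows "cl S x \<subseteq> U"
proof
  fix y assume "y \<in> cl S x"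
  then have "(x, y) \<in> {(u, v). u \<noteq> v \<and> {u, v} \<in> S}\<^sup>*" by (simp add: cl_def joined_def)
  then show "y \<in> U" by (induct rule: rtrancl_induct) (use assms in auto)
qed

lemma cl_subset_Un: "cl S x \<subseteq> insert x (\<Union>S)"
  by (rule cl_closed) auto

lemma cl_subset_pairs: "S \<subseteq> pairs V \<Longrightarrow> x \<in> V \<Longrightarrow> cl S x \<subseteq> V"
  using cl_subset_Un[of S x] by (fastforce simp: pairs_def)

text \<open>A new edge can only glue the clusters of its endpoints. The formula also covers an edge
  inside one cluster, where the union is that cluster.\<close>

lemma cl_insert:
  "cl (insert {u, v} S) x =
     (if u \<in> cl S x \<or> v \<in> cl S x then cl S u \<union> cl S v else cl S x)"
proof -
  let ?S = "insert {u, v} S"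
  have uv: "(u, v) \<in> joined ?S" by (rule joined_edge) simp
  have m: "cl S y \<subseteq> cl ?S y" for y by (rule cl_mono) auto
  show ?thesis
  proof (cases "u \<in> cl S x \<or> v \<in> cl S x")
    case True
    have "cl ?S x \<subseteq> cl S u \<union> cl S v"
    proof (rule cl_closed)
      show "x \<in> cl S u \<union> cl S v" using True cl_sym by fast
    next
      fix a b assume ab: "{a, b} \<in> ?S" and a: "a \<in> cl S u \<union> cl S v"
      show "b \<in> cl S u \<union> cl S v"
      proof (cases "{a, b} \<in> S")
        case True
        then have "b \<in> cl S a" using joined_edge by (auto simp: cl_def)
        then show ?thesis using a cl_eq[of a S u] cl_eq[of a S v] by auto
      next
        case False
        then show ?thesis using ab by (auto simp: doubleton_eq_iff)
      qed
    qed
    moreover have "cl ?S u = cl ?S x" "cl ?S v = cl ?S x"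
    proof -
      have "cl ?S u = cl ?S v" using uv cl_eq[of v ?S u] by (auto simp: cl_def)
      moreover have "cl ?S u = cl ?S x \<or> cl ?S v = cl ?S x"
        using True m[of x] cl_eq[of u ?S x] cl_eq[of v ?S x] by auto
      ultimately show "cl ?S u = cl ?S x" "cl ?S v = cl ?S x" by auto
    qed
    ultimately show ?thesis using True m[of u] m[of v] by auto
  next
    case False
    have "cl ?S x \<subseteq> cl S x"
    proof (rule cl_closed)
      fix a b assume ab: "{a, b} \<in> ?S" and a: "a \<in> cl S x"
      have "{a, b} \<in> S" using ab a False by (auto simp: doubleton_eq_iff)
      then have "b \<in> cl S a" using joined_edge by (auto simp: cl_def)
      then show "b \<in> cl S x" using cl_eq[OF a] by simp
    qed auto
    then show ?thesis using False m[of x] by auto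
  qed
qed

text \<open>A path that starts outside the vertices of \<open>S\<close> never reaches an edge of
  \<open>S\<close>. This is what makes the weights of vertex-disjoint edge sets multiply.\<close>

lemma cl_vertex_disjoint:
  assumes "\<Union>S \<inter> \<Union>S' = {}" "x \<notin> \<Union>S"
  shows "cl (S \<union> S') x = cl S' x"
proof
  have "cl (S \<union> S') x \<subseteq> cl S' x"
  proof (rule cl_closed)
    fix u v assume uv: "{u, v} \<in> S \<union> S'" "u \<in> cl S' x"
    have "u = x \<or> u \<in> \<Union>S'" using uv(2) cl_subset_Un[of S' x] by blast
    then have "u \<notin> \<Union>S" using assms by blast
    then have "{u, v} \<in> S'" using uv by auto
    then have "v \<in> cl S' u" using joined_edge by (auto simp: cl_def)
    then show "v \<in> cl S' x" using cl_eq[OF uv(2)] by simp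
  qed simp
  then show "cl (S \<union> S') x \<subseteq> cl S' x" .
qed (rule cl_mono, simp)

lemma cl_image:
  assumes "inj f"
  shows "cl ((`) f ` S) (f x) = f ` cl S x"
proof
  show "cl ((`) f ` S) (f x) \<subseteq> f ` cl S x"
  proof (rule cl_closed)
    fix u v assume "{u, v} \<in> (`) f ` S" "u \<in> f ` cl S x"
    then obtain e a where e: "e \<in> S" "{u, v} = f ` e" "u = f a" "a \<in> cl S x" by (elim imageE) auto
    have "v \<in> f ` e" unfolding e(2)[symmetric] by simp
    then obtain b where b: "v = f b" "b \<in> e" by (rule imageE)
    have "f ` e = f ` {a, b}" using e b by simp
    then have "e = {a, b}" unfolding inj_image_eq_iff[OF assms] .
    then have "b \<in> cl S a" using e joined_edge by (auto simp: cl_def)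
    then have "b \<in> cl S x" using cl_eq[OF e(4)] by simp
    then show "v \<in> f ` cl S x" using b by simp
  qed auto
  have "cl S x \<subseteq> {y. f y \<in> cl ((`) f ` S) (f x)}"
  proof (rule cl_closed)
    fix u v assume uv: "{u, v} \<in> S" "u \<in> {y. f y \<in> cl ((`) f ` S) (f x)}"
    then have "f ` {u, v} \<in> (`) f ` S" by blast
    then have "{f u, f v} \<in> (`) f ` S" by simp
    then have "f v \<in> cl ((`) f ` S) (f u)" by (rule cl_edge)
    then show "v \<in> {y. f y \<in> cl ((`) f ` S) (f x)}"
      using uv cl_eq[of "f u" "(`) f ` S" "f x"] by simp
  qed auto
  then show "f ` cl S x \<subseteq> cl ((`) f ` S) (f x)" by auto
qed

definition nc :: "'v set \<Rightarrow> 'v set set \<Rightarrow> nat" where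
  "nc V S = card (cl S ` V)"

lemma nc_empty: "nc V {} = card V"
proof -
  have "cl {} x = {x}" for x :: 'a by (auto simp: cl_def joined_def)
  then show ?thesis unfolding nc_def by (simp add: card_image)
qed

text \<open>Turns the global power of \<open>q\<close> into a local quantity: whether the endpoints
  of an added edge are already joined decides a single factor \<open>q\<close> in
  \<open>w_insert\<close>.\<close>

lemma nc_insert:
  assumes "finite V" "u \<in> V" "v \<in> V"
  shows "nc V S = nc V (insert {u, v} S) + (if v \<in> cl S u then 0 else 1)"
proof (cases "v \<in> cl S u")
  case True
  then have "cl S v = cl S u" by (rule cl_eq)
  then have "cl (insert {u, v} S) x = cl S x" for x
    unfolding cl_insert using cl_eq[of u S x] cl_eq[of v S x] by auto
  then show ?thesis using True by (simp add: nc_def)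
next
  case False
  let ?A = "cl S ` V"
  let ?R = "?A - {cl S u, cl S v}"
  have ne: "cl S u \<noteq> cl S v" using False cl_self[of v S] by metis
  have "cl (insert {u, v} S) ` V = insert (cl S u \<union> cl S v) ?R"
  proof (intro set_eqI iffI)
    fix C assume "C \<in> cl (insert {u, v} S) ` V"
    then obtain x where x: "x \<in> V" "C = cl (insert {u, v} S) x" by auto
    show "C \<in> insert (cl S u \<union> cl S v) ?R"
    proof (cases "u \<in> cl S x \<or> v \<in> cl S x")
      case True then show ?thesis using x by (simp add: cl_insert)
    next
      case F: False
      then have "C = cl S x" using x by (simp add: cl_insert)
      moreover have "cl S x \<noteq> cl S u" "cl S x \<noteq> cl S v" using F cl_self by metis+
      ultimately show ?thesis using x by auto
    qed
  next
    fix C assume "C \<in> insert (cl S u \<union> cl S v) ?R"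
    then show "C \<in> cl (insert {u, v} S) ` V"
    proof
      assume "C = cl S u \<union> cl S v"
      then have "C = cl (insert {u, v} S) u" by (simp add: cl_insert)
      then show ?thesis using assms by blast
    next
      assume C: "C \<in> ?R"
      then obtain x where x: "x \<in> V" "C = cl S x" by auto
      then have "u \<notin> cl S x" "v \<notin> cl S x" using C cl_eq[of u S x] cl_eq[of v S x] by auto
      then have "C = cl (insert {u, v} S) x" using x by (simp add: cl_insert)
      then show ?thesis using x by blast
    qed
  qed
  moreover have "cl S u \<union> cl S v \<notin> ?R"
  proof
    assume "cl S u \<union> cl S v \<in> ?R"
    then obtain x where x: "cl S u \<union> cl S v = cl S x" "cl S x \<noteq> cl S u" by auto
    have "u \<in> cl S x" by (metis UnI1 cl_self x(1))
    then show False using x(2) cl_eq[of u S x] by simp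
  qed
  moreover have "card ?R = card ?A - 2"
    using assms ne by (subst card_Diff_subset) auto
  moreover have "2 \<le> card ?A"
  proof -
    have "card {cl S u, cl S v} \<le> card ?A" using assms by (intro card_mono) auto
    then show ?thesis using ne by simp
  qed
  ultimately show ?thesis using False assms by (simp add: nc_def)
qed

text \<open>Each extra vertex is isolated and counts as one cluster. Hence
  \<open>q ^ nc V S / q ^ card V\<close> does not depend on \<open>V\<close>, and one weight serves
  all volumes.\<close>

lemma nc_superset:
  assumes "finite V" "\<Union>S \<subseteq> U" "U \<subseteq> V"
  shows "nc V S = nc U S + card (V - U)"
proof -
  have fU: "finite U" using assms(1,3) by (rule rev_finite_subset)
  have s: "cl S x = {x}" if "x \<in> V - U" for x
    using that assms(2) cl_closed[of x "{x}" S] cl_self[of x S] by (auto simp: insert_commute)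
  have V: "V = U \<union> (V - U)" using assms by auto
  have "cl S ` V = cl S ` U \<union> cl S ` (V - U)" using V by (metis image_Un)
  moreover have "cl S ` U \<inter> cl S ` (V - U) = {}"
  proof (rule ccontr)
    assume "cl S ` U \<inter> cl S ` (V - U) \<noteq> {}"
    then obtain x y where "x \<in> U" "y \<in> V - U" "cl S x = cl S y" by auto
    then show False using s[of y] cl_self[of x S] by auto
  qed
  moreover have "card (cl S ` (V - U)) = card (V - U)"
    using s by (intro card_image inj_onI) auto
  ultimately show ?thesis using assms fU by (simp add: nc_def card_Un_disjoint)
qed

lemma doubleton_pairs: "e \<in> pairs V \<Longrightarrow> \<exists>u v. e = {u, v} \<and> u \<noteq> v \<and> u \<in> V \<and> v \<in> V"
  by (auto simp: pairs_def)

lemma finite_pairs [simp]: "finite V \<Longrightarrow> finite (pairs V)"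
  by (rule finite_subset[of _ "Pow V"]) (auto simp: pairs_def)

lemma pairs_mono: "U \<subseteq> V \<Longrightarrow> pairs U \<subseteq> pairs V"
  by (auto simp: pairs_def)

lemma pairsI: "u \<noteq> v \<Longrightarrow> u \<in> V \<Longrightarrow> v \<in> V \<Longrightarrow> {u, v} \<in> pairs V"
  by (auto simp: pairs_def)

lemma pairs_UNIV [simp]: "pairs V \<subseteq> pairs UNIV"
  by (rule pairs_mono) simp

lemma pairs_image: "inj f \<Longrightarrow> (`) f ` pairs V = pairs (f ` V)"
proof -
  assume f: "inj f"
  have "f ` {u, v} \<in> pairs (f ` V)" if "u \<in> V" "v \<in> V" "u \<noteq> v" for u v
  proof -
    have "f u \<noteq> f v" using that f by (simp add: inj_eq)
    then show ?thesis using that unfolding pairs_def by auto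
  qed
  moreover have "{f u, f v} \<in> (`) f ` pairs V" if "u \<in> V" "v \<in> V" "u \<noteq> v" for u v
    using that by (intro image_eqI[where x = "{u, v}"]) (auto simp: pairs_def)
  ultimately show ?thesis using f unfolding pairs_def by (fastforce simp: inj_eq)
qed

section \<open>Random cluster weights\<close>

text \<open>The one-element case of the four functions theorem. Only the two mixed products are not
  dominated term by term.\<close>

lemma four_numbers:
  fixes a0 a1 b0 b1 c0 c1 d0 d1 :: real
  assumes nn: "a0 \<ge> 0" "a1 \<ge> 0" "b0 \<ge> 0" "b1 \<ge> 0" "c0 \<ge> 0" "c1 \<ge> 0" "d0 \<ge> 0" "d1 \<ge> 0"
    and h: "a0 * b0 \<le> c0 * d0" "a1 * b0 \<le> c1 * d0" "a0 * b1 \<le> c1 * d0" "a1 * b1 \<le> c1 * d1"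
  shows "(a0 + a1) * (b0 + b1) \<le> (c0 + c1) * (d0 + d1)"
proof (cases "c1 * d0 = 0")
  case True
  then have "a1 * b0 = 0" "a0 * b1 = 0"
    using h(2,3) nn by (metis mult_nonneg_nonneg antisym)+
  moreover have "0 \<le> c0 * d1" using nn by simp
  ultimately have "a0 * b0 + (a1 * b0 + a0 * b1) + a1 * b1 \<le> c0 * d0 + (c1 * d0 + c0 * d1) + c1 * d1"
    using h True by linarith
  then show ?thesis by (simp add: algebra_simps)
next
  case False
  let ?u = "c1 * d0"
  have u: "?u > 0" using False nn by (metis mult_nonneg_nonneg order_less_le)
  have "(a1 * b0) * (a0 * b1) \<le> (c0 * d0) * (c1 * d1)"
    using mult_mono[OF h(1) h(4)] nn by (simp add: mult_ac)
  then have k: "(a1 * b0) * (a0 * b1) \<le> ?u * (c0 * d1)" by (simp add: mult_ac)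
  \<comment> \<open>Both mixed products \<open>a1 * b0\<close> and \<open>a0 * b1\<close> lie below
    \<open>?u\<close>, and their product is at most \<open>?u * (c0 * d1)\<close>. Two numbers below
    u whose product is at most u v have sum at most u + v.\<close>
  have "0 \<le> (?u - a1 * b0) * (?u - a0 * b1)" using h by simp
  then have "?u * (a1 * b0 + a0 * b1) \<le> ?u * ?u + (a1 * b0) * (a0 * b1)"
    by (simp add: algebra_simps)
  also have "\<dots> \<le> ?u * (?u + c0 * d1)" using k by (simp add: algebra_simps)
  finally have "a1 * b0 + a0 * b1 \<le> ?u + c0 * d1" using u by (simp add: mult_le_cancel_left)
  then show ?thesis using h by (simp add: algebra_simps)
qed

lemma sum_Pow_insert:
  assumes "finite E" "e \<notin> E"
  shows "sum f (Pow (insert e E)) = (\<Sum>A\<in>Pow E. f A + f (insert e A))"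
proof -
  have "inj_on (insert e) (Pow E)" using assms by (auto simp: inj_on_def)
  moreover have "Pow E \<inter> insert e ` Pow E = {}" using assms by auto
  ultimately show ?thesis using assms
    by (simp add: Pow_insert sum.union_disjoint sum.reindex sum.distrib)
qed

text \<open>The four functions theorem of Ahlswede and Daykin\<close>

lemma four_functions:
  fixes \<alpha> \<beta> \<gamma> \<delta> :: "'e set \<Rightarrow> real"
  assumes "finite E"
    and "\<And>A. A \<subseteq> E \<Longrightarrow> 0 \<le> \<alpha> A \<and> 0 \<le> \<beta> A \<and> 0 \<le> \<gamma> A \<and> 0 \<le> \<delta> A"
    and "\<And>A B. A \<subseteq> E \<Longrightarrow> B \<subseteq> E \<Longrightarrow> \<alpha> A * \<beta> B \<le> \<gamma> (A \<union> B) * \<delta> (A \<inter> B)"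
  shows "sum \<alpha> (Pow E) * sum \<beta> (Pow E) \<le> sum \<gamma> (Pow E) * sum \<delta> (Pow E)"
  using assms
proof (induct E arbitrary: \<alpha> \<beta> \<gamma> \<delta> rule: finite_induct)
  case empty
  then show ?case using empty(2)[of "{}" "{}"] by simp
next
  case (insert e E)
  note nn = insert(4) and h = insert(5)
  \<comment> \<open>Summing out \<open>e\<close> leaves four functions on subsets of
    \<open>E\<close>; their hypothesis is exactly what \<open>four_numbers\<close> provides.\<close>
  have "(\<Sum>A\<in>Pow E. \<alpha> A + \<alpha> (insert e A)) * (\<Sum>A\<in>Pow E. \<beta> A + \<beta> (insert e A))
      \<le> (\<Sum>A\<in>Pow E. \<gamma> A + \<gamma> (insert e A)) * (\<Sum>A\<in>Pow E. \<delta> A + \<delta> (insert e A))"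
  proof (rule insert(3))
    fix A assume "A \<subseteq> E"
    then have "A \<subseteq> insert e E" "insert e A \<subseteq> insert e E" by auto
    from nn[OF this(1)] nn[OF this(2)]
    show "0 \<le> \<alpha> A + \<alpha> (insert e A) \<and> 0 \<le> \<beta> A + \<beta> (insert e A) \<and>
          0 \<le> \<gamma> A + \<gamma> (insert e A) \<and> 0 \<le> \<delta> A + \<delta> (insert e A)"
      by simp
  next
    fix A B assume AB: "A \<subseteq> E" "B \<subseteq> E"
    then have s: "A \<subseteq> insert e E" "insert e A \<subseteq> insert e E" "B \<subseteq> insert e E"
      "insert e B \<subseteq> insert e E" "A \<union> B \<subseteq> insert e E" "A \<inter> B \<subseteq> insert e E"
      "insert e (A \<union> B) \<subseteq> insert e E" "insert e (A \<inter> B) \<subseteq> insert e E" by auto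
    have e: "e \<notin> A" "e \<notin> B" using AB insert(2) by auto
    then have i: "insert e A \<inter> B = A \<inter> B" "A \<inter> insert e B = A \<inter> B" by auto
    show "(\<alpha> A + \<alpha> (insert e A)) * (\<beta> B + \<beta> (insert e B))
      \<le> (\<gamma> (A \<union> B) + \<gamma> (insert e (A \<union> B))) * (\<delta> (A \<inter> B) + \<delta> (insert e (A \<inter> B)))"
      apply (rule four_numbers)
      using s(1-4)[THEN nn] s(5-8)[THEN nn]
        h[OF s(1,3)] h[OF s(2,3)] h[OF s(1,4)] h[OF s(2,4)] i
      by (auto simp: Int_insert_left Int_insert_right)
  qed
  then show ?case using insert(1,2) by (simp add: sum_Pow_insert)
qed

lemma sum_Pow_Un:
  assumes "finite H" "finite F" "F \<inter> H = {}"
  shows "sum g (Pow (F \<union> H)) = (\<Sum>T\<in>Pow F. \<Sum>S\<in>Pow H. g (T \<union> S))"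
  using assms
proof (induct H arbitrary: g rule: finite_induct)
  case (insert e H)
  have "sum g (Pow (F \<union> insert e H)) = sum g (Pow (insert e (F \<union> H)))" by simp
  also have "\<dots> = (\<Sum>A\<in>Pow (F \<union> H). g A + g (insert e A))"
    using insert by (intro sum_Pow_insert) auto
  also have "\<dots> = (\<Sum>T\<in>Pow F. \<Sum>S\<in>Pow H. g (T \<union> S) + g (insert e (T \<union> S)))"
    using insert by (subst insert(3)) auto
  also have "\<dots> = (\<Sum>T\<in>Pow F. \<Sum>S\<in>Pow (insert e H). g (T \<union> S))"
    using insert by (simp add: sum_Pow_insert)
  finally show ?case .
qed simp

lemma finite_Union_pairs: "finite S \<Longrightarrow> S \<subseteq> pairs UNIV \<Longrightarrow> finite (\<Union>S)"
  by (rule finite_Union) (auto simp: pairs_def)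

text \<open>\<open>t e\<close> stands for the inverse temperature times the coupling. The condition
  \<open>q \<ge> 1\<close> makes an edge inside a cluster at least as favourable as one between
  clusters, the source of all correlation inequalities below.\<close>

locale rc =
  fixes q :: real and t :: "'v set \<Rightarrow> real"
  assumes q1: "q \<ge> 1" and t0: "t e \<ge> 0"
begin

text \<open>This is the random cluster weight up to a constant factor: \<open>exp (t e) - 1\<close> is the odds ratio
  \<open>p / (1 - p)\<close> of the bond probability, and dividing by \<open>q\<close> to the number of vertices makes the
  weight independent of the vertex set.\<close>

definition w :: "'v set set \<Rightarrow> real" where
  "w S = (\<Prod>e\<in>S. exp (t e) - 1) * (q ^ nc (\<Union>S) S / q ^ card (\<Union>S))"

lemma q_pos [simp]: "q > 0" using q1 by simp
lemma q_nonzero [simp]: "q \<noteq> 0" using q1 by simp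

lemma w_alt:
  assumes "finite V" "\<Union>S \<subseteq> V"
  shows "w S = (\<Prod>e\<in>S. exp (t e) - 1) * (q ^ nc V S / q ^ card V)"
proof -
  have "finite (\<Union>S)" using assms by (metis finite_subset)
  then have "card V = card (\<Union>S) + card (V - \<Union>S)"
    using assms by (metis card_Diff_subset card_mono le_add_diff_inverse)
  moreover have "nc V S = nc (\<Union>S) S + card (V - \<Union>S)"
    by (rule nc_superset) (use assms in auto)
  ultimately show ?thesis by (simp add: w_def power_add)
qed

lemma w_nonneg [simp]: "w S \<ge> 0"
  unfolding w_def using t0 q1 by (intro mult_nonneg_nonneg prod_nonneg) auto

lemma w_empty [simp]: "w {} = 1"
  by (simp add: w_def nc_empty)

lemma w_insert:
  assumes "finite S" "S \<subseteq> pairs UNIV" "u \<noteq> v" "{u, v} \<notin> S"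
  shows "w (insert {u, v} S) = w S * (exp (t {u, v}) - 1) * (if v \<in> cl S u then 1 else 1 / q)"
proof -
  let ?V = "insert u (insert v (\<Union>S))"
  have f: "finite ?V" using finite_Union_pairs[OF assms(1,2)] by simp
  have n: "nc ?V S = nc ?V (insert {u, v} S) + (if v \<in> cl S u then 0 else 1)"
    by (rule nc_insert) (use f in auto)
  have "w S = (\<Prod>e\<in>S. exp (t e) - 1) * (q ^ nc ?V S / q ^ card ?V)"
    by (rule w_alt) (use f in auto)
  moreover have "w (insert {u, v} S) =
      (\<Prod>e\<in>insert {u, v} S. exp (t e) - 1) * (q ^ nc ?V (insert {u, v} S) / q ^ card ?V)"
    by (rule w_alt) (use f in auto)
  ultimately show ?thesis using assms n by (simp add: power_add)
qed

text \<open>Conditional odds of \<open>e\<close> being open when \<open>S\<close> is the set of the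
  other open edges. As \<open>e\<close> is an unordered pair, connectedness of its ends is expressed
  by quantifying over its enumerations, so that no representative has to be chosen.\<close>

definition odds :: "'v set \<Rightarrow> 'v set set \<Rightarrow> real" where
  "odds e S = (exp (t e) - 1) * (if \<forall>u v. e = {u, v} \<longrightarrow> v \<in> cl S u then 1 else 1 / q)"

lemma odds_eq: "odds {u, v} S = (exp (t {u, v}) - 1) * (if v \<in> cl S u then 1 else 1 / q)"
proof -
  have "(\<forall>a b. {u, v} = {a, b} \<longrightarrow> b \<in> cl S a) \<longleftrightarrow> v \<in> cl S u"
    using cl_sym by (fastforce simp: doubleton_eq_iff)
  then show ?thesis by (simp add: odds_def)
qed

lemma w_insert_odds:
  assumes "finite S" "S \<subseteq> pairs UNIV" "e \<in> pairs UNIV" "e \<notin> S"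
  shows "w (insert e S) = w S * odds e S"
  using doubleton_pairs[OF assms(3)] assms w_insert odds_eq by (auto simp: mult.assoc)

text \<open>More open edges make larger clusters, so the factor can only change from 1/q to 1. This
  is the lattice condition in one-edge form.\<close>

lemma odds_mono: "S \<subseteq> S' \<Longrightarrow> odds e S \<le> odds e S'"
  unfolding odds_def using cl_mono[of S S'] q1 t0[of e]
  by (intro mult_left_mono) (auto simp: subset_iff)

lemma odds_le: "odds e S \<le> exp (t e) - 1"
  unfolding odds_def using q1 t0[of e] by (intro mult_left_le) auto

lemma odds_ge: "(exp (t e) - 1) / q \<le> odds e S"
  unfolding odds_def using q1 t0[of e] by (auto simp: divide_le_eq mult_le_cancel_left1)

lemma odds_nonneg: "0 \<le> odds e S"
  unfolding odds_def using q1 t0[of e] by auto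

text \<open>The edges of \<open>D\<close> are added one at a time. Each multiplies the right side by
  its odds given the larger set and the left side by its odds given the smaller one, so
  \<open>odds_mono\<close> applies.\<close>

lemma w_supermodular_aux:
  assumes "finite D" "finite A" "D \<subseteq> pairs UNIV" "A \<subseteq> pairs UNIV" "A \<inter> D = {}" "X \<subseteq> A"
  shows "w A * w (X \<union> D) \<le> w (A \<union> D) * w X"
  using assms
proof (induct D rule: finite_induct)
  case (insert e D)
  have X: "finite X" using insert finite_subset by blast
  have "w (X \<union> insert e D) = w (X \<union> D) * odds e (X \<union> D)"
    using insert X by (subst w_insert_odds[symmetric]) auto
  moreover have "w (A \<union> insert e D) = w (A \<union> D) * odds e (A \<union> D)"
    using insert X by (subst w_insert_odds[symmetric]) auto
  moreover have "(w A * w (X \<union> D)) * odds e (X \<union> D) \<le> (w (A \<union> D) * w X) * odds e (A \<union> D)"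
    using insert by (intro mult_mono[of "w A * w (X \<union> D)"] odds_mono odds_nonneg) auto
  ultimately show ?case by (simp only: mult_ac)
qed simp

lemma w_supermodular:
  assumes "finite A" "finite B" "A \<subseteq> pairs UNIV" "B \<subseteq> pairs UNIV"
  shows "w A * w B \<le> w (A \<union> B) * w (A \<inter> B)"
proof -
  have "w A * w ((A \<inter> B) \<union> (B - A)) \<le> w (A \<union> (B - A)) * w (A \<inter> B)"
    by (rule w_supermodular_aux) (use assms in auto)
  moreover have "(A \<inter> B) \<union> (B - A) = B" "A \<union> (B - A) = A \<union> B" by auto
  ultimately show ?thesis by simp
qed

text \<open>Convexity of \<open>exp\<close> between 0 and \<open>x\<close> with weights 1 - 1/q and
  1/q. In the worst case over the other edges the odds are (exp x - 1)/q, and this says that an edge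
  with such odds is closed with probability at most exp(-x/q).\<close>

lemma exp_div_q_le: "x \<ge> 0 \<Longrightarrow> exp (x / q) \<le> 1 + (exp x - 1) / q"
proof -
  assume "x \<ge> 0"
  have "convex_on UNIV (exp :: real \<Rightarrow> real)" by (rule exp_convex)
  then have "exp ((1 - 1/q) *\<^sub>R 0 + (1/q) *\<^sub>R x) \<le> (1 - 1/q) * exp 0 + (1/q) * exp x"
    by (rule convex_onD) (use q1 in auto)
  then show ?thesis by (simp add: diff_divide_distrib)
qed

text \<open>The edges of \<open>Q\<close> are released one at a time while \<open>T\<close> stays
  frozen. Each multiplies the total weight by one plus its odds, which is at least exp(t e /
  q).\<close>

lemma sum_w_ge:
  assumes "finite Q" "finite T" "Q \<subseteq> pairs UNIV" "T \<subseteq> pairs UNIV" "Q \<inter> T = {}"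
  shows "w T * exp ((\<Sum>e\<in>Q. t e) / q) \<le> (\<Sum>S\<in>Pow Q. w (T \<union> S))"
  using assms
proof (induct Q rule: finite_induct)
  case (insert e Q)
  have "w T * exp ((\<Sum>e\<in>insert e Q. t e) / q) = w T * exp ((\<Sum>e\<in>Q. t e) / q) * exp (t e / q)"
    using insert by (simp add: add_divide_distrib exp_add mult_ac)
  also have "\<dots> \<le> (\<Sum>S\<in>Pow Q. w (T \<union> S)) * (1 + (exp (t e) - 1) / q)"
    using insert t0[of e] by (intro mult_mono exp_div_q_le) (auto intro!: sum_nonneg)
  also have "\<dots> = (\<Sum>S\<in>Pow Q. w (T \<union> S) * (1 + (exp (t e) - 1) / q))"
    by (simp add: sum_distrib_right)
  also have "\<dots> \<le> (\<Sum>S\<in>Pow Q. w (T \<union> S) + w (T \<union> insert e S))"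
  proof (rule sum_mono)
    fix S assume "S \<in> Pow Q"
    then have "w (T \<union> insert e S) = w (T \<union> S) * odds e (T \<union> S)"
      using insert finite_subset[of S Q] by (subst w_insert_odds[symmetric]) auto
    then show "w (T \<union> S) * (1 + (exp (t e) - 1) / q) \<le> w (T \<union> S) + w (T \<union> insert e S)"
      using mult_left_mono[OF odds_ge[of e "T \<union> S"] w_nonneg[of "T \<union> S"]] by (simp add: algebra_simps)
  qed
  also have "\<dots> = (\<Sum>S\<in>Pow (insert e Q). w (T \<union> S))"
    using insert by (simp add: sum_Pow_insert)
  finally show ?case .
qed simp

text \<open>Same scheme as \<open>sum_w_ge\<close>: by \<open>odds_le\<close>, one plus the odds is
  at most exp(t e).\<close>

lemma sum_w_le:
  assumes "finite Q" "finite T" "Q \<subseteq> pairs UNIV" "T \<subseteq> pairs UNIV" "Q \<inter> T = {}"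
  shows "(\<Sum>S\<in>Pow Q. w (T \<union> S)) \<le> w T * exp (\<Sum>e\<in>Q. t e)"
  using assms
proof (induct Q rule: finite_induct)
  case (insert e Q)
  have "(\<Sum>S\<in>Pow (insert e Q). w (T \<union> S)) = (\<Sum>S\<in>Pow Q. w (T \<union> S) + w (T \<union> insert e S))"
    using insert by (simp add: sum_Pow_insert)
  also have "\<dots> \<le> (\<Sum>S\<in>Pow Q. w (T \<union> S) * exp (t e))"
  proof (rule sum_mono)
    fix S assume "S \<in> Pow Q"
    then have "w (T \<union> insert e S) = w (T \<union> S) * odds e (T \<union> S)"
      using insert finite_subset[of S Q] by (subst w_insert_odds[symmetric]) auto
    then show "w (T \<union> S) + w (T \<union> insert e S) \<le> w (T \<union> S) * exp (t e)"
      using mult_left_mono[OF odds_le[of e "T \<union> S"] w_nonneg[of "T \<union> S"]] by (simp add: algebra_simps)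
  qed
  also have "\<dots> = (\<Sum>S\<in>Pow Q. w (T \<union> S)) * exp (t e)" by (simp add: sum_distrib_right)
  also have "\<dots> \<le> w T * exp (\<Sum>e\<in>Q. t e) * exp (t e)"
    using insert by (intro mult_right_mono) auto
  also have "\<dots> = w T * exp (\<Sum>e\<in>insert e Q. t e)"
    using insert by (simp add: exp_add mult_ac)
  finally show ?case .
qed simp

section \<open>Finite-volume expectations and probabilities as normalised finite sums\<close>

definition Z :: "'v set set \<Rightarrow> real" where
  "Z E = (\<Sum>S\<in>Pow E. w S)"

definition ex :: "'v set set \<Rightarrow> ('v set set \<Rightarrow> real) \<Rightarrow> real" where
  "ex E f = (\<Sum>S\<in>Pow E. w S * f S) / Z E"

definition pr :: "'v set set \<Rightarrow> ('v set set \<Rightarrow> bool) \<Rightarrow> real" where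
  "pr E A = ex E (\<lambda>S. of_bool (A S))"

lemma Z_pos: "finite E \<Longrightarrow> Z E > 0"
  unfolding Z_def by (rule sum_pos2[of _ "{}"]) auto

lemma ex_mono:
  assumes "finite E" "\<And>S. S \<subseteq> E \<Longrightarrow> f S \<le> g S"
  shows "ex E f \<le> ex E g"
  unfolding ex_def using assms Z_pos[of E]
  by (intro divide_right_mono sum_mono mult_left_mono) auto

lemma ex_cong: "(\<And>S. S \<subseteq> E \<Longrightarrow> f S = g S) \<Longrightarrow> ex E f = ex E g"
  unfolding ex_def by (auto intro!: sum.cong arg_cong2[where f = "(/)"])

lemma ex_const: "finite E \<Longrightarrow> ex E (\<lambda>_. c) = c"
  using Z_pos[of E] by (simp add: ex_def sum_distrib_right[symmetric] Z_def)

lemma ex_add: "ex E (\<lambda>S. f S + g S) = ex E f + ex E g"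
  by (simp add: ex_def distrib_left sum.distrib add_divide_distrib)

lemma ex_cmult: "ex E (\<lambda>S. c * f S) = c * ex E f"
  by (simp add: ex_def sum_distrib_left mult_ac)

lemma ex_sum: "ex E (\<lambda>S. \<Sum>i\<in>I. f i S) = (\<Sum>i\<in>I. ex E (f i))"
proof -
  have "(\<Sum>S\<in>Pow E. w S * (\<Sum>i\<in>I. f i S)) = (\<Sum>i\<in>I. \<Sum>S\<in>Pow E. w S * f i S)"
    by (subst sum.swap) (simp add: sum_distrib_left)
  then show ?thesis by (simp add: ex_def sum_divide_distrib)
qed

lemma ex_0: "ex E (\<lambda>_. 0) = 0"
  by (simp add: ex_def)

lemma pr_mono:
  assumes "finite E" "\<And>S. S \<subseteq> E \<Longrightarrow> A S \<Longrightarrow> B S"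
  shows "pr E A \<le> pr E B"
  unfolding pr_def using assms by (intro ex_mono) (auto simp: of_bool_def)

lemma pr_cong: "(\<And>S. S \<subseteq> E \<Longrightarrow> A S = B S) \<Longrightarrow> pr E A = pr E B"
  unfolding pr_def by (intro ex_cong) auto

lemma pr_True: "finite E \<Longrightarrow> pr E (\<lambda>_. True) = 1"
  by (simp add: pr_def ex_const)

lemma pr_nonneg: "finite E \<Longrightarrow> 0 \<le> pr E A"
  using ex_mono[of E "\<lambda>_. 0" "\<lambda>S. of_bool (A S)"] by (simp add: pr_def ex_0)

lemma pr_le_1: "finite E \<Longrightarrow> pr E A \<le> 1"
  using pr_mono[of E A "\<lambda>_. True"] by (simp add: pr_True)

lemma pr_not: "finite E \<Longrightarrow> pr E (\<lambda>S. \<not> A S) = 1 - pr E A"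
proof -
  assume "finite E"
  moreover have "pr E (\<lambda>S. \<not> A S) + pr E A = ex E (\<lambda>_. 1)"
    unfolding pr_def by (subst ex_add[symmetric]) (rule ex_cong, auto)
  ultimately show ?thesis by (simp add: ex_const)
qed

lemma pr_disj: "finite E \<Longrightarrow> pr E (\<lambda>S. A S \<or> B S) \<le> pr E A + pr E B"
  unfolding pr_def by (subst ex_add[symmetric]) (rule ex_mono, auto)

lemma pr_and_not: "pr E A = pr E (\<lambda>S. A S \<and> B S) + pr E (\<lambda>S. A S \<and> \<not> B S)"
  unfolding pr_def by (subst ex_add[symmetric]) (rule ex_cong, auto)

lemma pr_bex: "finite E \<Longrightarrow> finite I \<Longrightarrow> pr E (\<lambda>S. \<exists>i\<in>I. A i S) \<le> (\<Sum>i\<in>I. pr E (A i))"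
proof -
  assume fin: "finite E" "finite I"
  have "of_bool (\<exists>i\<in>I. A i S) \<le> (\<Sum>i\<in>I. of_bool (A i S) :: real)" for S
  proof (cases "\<exists>i\<in>I. A i S")
    case True
    then obtain i where i: "i \<in> I" "A i S" by auto
    have "of_bool (A i S) \<le> (\<Sum>i\<in>I. of_bool (A i S) :: real)"
      using i fin by (intro member_le_sum) auto
    then show ?thesis using True i by simp
  qed (simp add: sum_nonneg)
  then show ?thesis unfolding pr_def
    by (subst ex_sum[symmetric]) (rule ex_mono[OF fin(1)])
qed

text \<open>The free measure on \<open>F\<close> is the one on \<open>E\<close> conditioned on all
  edges of \<open>E - F\<close> being closed, a decreasing event. The four functions theorem
  compares the event inside \<open>Pow F\<close> and no restriction with the event and
  \<open>Pow F\<close>. Arbitrary edge sets are allowed, since disjoint tiles need unions of pair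
  sets.\<close>

lemma pr_increasing:
  assumes "finite E" "E \<subseteq> pairs UNIV" "F \<subseteq> E"
    and "\<And>S S'. S \<subseteq> S' \<Longrightarrow> S' \<subseteq> E \<Longrightarrow> A S \<Longrightarrow> A S'"
  shows "pr F A \<le> pr E A"
proof -
  let ?\<alpha> = "\<lambda>S. w S * of_bool (S \<subseteq> F \<and> A S)" and ?\<gamma> = "\<lambda>S. w S * of_bool (A S)"
    and ?\<delta> = "\<lambda>S. w S * of_bool (S \<subseteq> F)"
  have fF: "finite F" using assms(3,1) by (rule finite_subset)
  have "sum ?\<alpha> (Pow E) * sum w (Pow E) \<le> sum ?\<gamma> (Pow E) * sum ?\<delta> (Pow E)"
  proof (rule four_functions)
    fix S S' assume s: "S \<subseteq> E" "S' \<subseteq> E"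
    show "?\<alpha> S * w S' \<le> ?\<gamma> (S \<union> S') * ?\<delta> (S \<inter> S')"
    proof (cases "S \<subseteq> F \<and> A S")
      case True
      then have "A (S \<union> S')" using assms(4)[of S "S \<union> S'"] s by auto
      moreover have "S \<inter> S' \<subseteq> F" using True by auto
      moreover have "w S * w S' \<le> w (S \<union> S') * w (S \<inter> S')"
        using s assms(1,2) finite_subset[OF s(1)] finite_subset[OF s(2)] by (intro w_supermodular) auto
      ultimately show ?thesis using True by simp
    qed auto
  qed (use assms in auto)
  moreover have "sum ?\<alpha> (Pow E) = (\<Sum>S\<in>Pow F. w S * of_bool (A S))"
    using assms by (intro sum.mono_neutral_cong_right) auto
  moreover have "sum ?\<delta> (Pow E) = Z F"
    unfolding Z_def using assms by (intro sum.mono_neutral_cong_right) auto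
  ultimately have "(\<Sum>S\<in>Pow F. w S * of_bool (A S)) * Z E \<le> (\<Sum>S\<in>Pow E. w S * of_bool (A S)) * Z F"
    by (simp add: Z_def)
  then show ?thesis unfolding pr_def ex_def using Z_pos[of E] Z_pos[of F] assms fF
    by (simp add: divide_le_eq pos_le_divide_eq mult_ac)
qed

lemma pr_split:
  assumes "finite E" "F \<subseteq> E"
  shows "pr E A * Z E = (\<Sum>T\<in>Pow F. \<Sum>S\<in>Pow (E - F). w (T \<union> S) * of_bool (A (T \<union> S)))"
proof -
  have fF: "finite F" using assms(2,1) by (rule finite_subset)
  moreover have "F \<union> (E - F) = E" using assms by auto
  moreover have "sum g (Pow (F \<union> (E - F))) = (\<Sum>T\<in>Pow F. \<Sum>S\<in>Pow (E - F). g (T \<union> S))" for g :: "_ \<Rightarrow> real"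
    by (rule sum_Pow_Un) (use assms fF in auto)
  ultimately show ?thesis using Z_pos[of E] assms by (simp add: pr_def ex_def)
qed

text \<open>Conditionally on all other edges, an edge is closed with probability at most
  \<open>exp (- t e / q)\<close> and at least \<open>exp (- t e)\<close>.\<close>

lemma pr_closed_le:
  assumes "finite E" "E \<subseteq> pairs UNIV" "F \<subseteq> E"
    and Q: "\<And>T. T \<subseteq> F \<Longrightarrow> A T \<Longrightarrow> Q T \<subseteq> E - F \<and> c \<le> (\<Sum>e\<in>Q T. t e)"
  shows "pr E (\<lambda>S. A (S \<inter> F) \<and> S \<inter> Q (S \<inter> F) = {}) \<le> exp (- c / q) * pr E (\<lambda>S. A (S \<inter> F))"
proof -
  let ?H = "E - F"
  have fin: "finite ?H" "finite F" using assms(1) finite_subset[OF assms(3,1)] by auto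
  have "(\<Sum>S\<in>Pow ?H. w (T \<union> S) * of_bool (A T \<and> S \<inter> Q T = {}))
      \<le> exp (- c / q) * (\<Sum>S\<in>Pow ?H. w (T \<union> S) * of_bool (A T))" if T: "T \<subseteq> F" for T
  proof (cases "A T")
    case True
    note QT = Q[OF T True]
    have fQ: "finite (Q T)" using QT fin finite_subset[of "Q T" ?H] by auto
    have H: "Q T \<union> (?H - Q T) = ?H" using QT by auto
    have fT: "finite T" using T fin(2) by (rule finite_subset)
    have "(\<Sum>S\<in>Pow ?H. w (T \<union> S) * of_bool (S \<inter> Q T = {})) =
        (\<Sum>R\<in>Pow (?H - Q T). w (T \<union> R))"
      using fin by (intro sum.mono_neutral_cong_right) auto
    \<comment> \<open>\<open>T\<close> is the exposed configuration and \<open>R\<close> the state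
      of all remaining edges outside \<open>Q T\<close>. With both fixed, closing \<open>Q T\<close>
      leaves the single weight \<open>w (T \<union> R)\<close>, to be compared with the sum over all
      states of \<open>Q T\<close>.\<close>
    also have "\<dots> \<le> (\<Sum>R\<in>Pow (?H - Q T). exp (- c / q) * (\<Sum>S\<in>Pow (Q T). w ((T \<union> R) \<union> S)))"
    proof (rule sum_mono)
      fix R assume R: "R \<in> Pow (?H - Q T)"
      have "w (T \<union> R) = exp (- c / q) * (w (T \<union> R) * exp (c / q))"
        by (simp add: exp_minus field_simps)
      also have "\<dots> \<le> exp (- c / q) * (w (T \<union> R) * exp ((\<Sum>e\<in>Q T. t e) / q))"
        using QT q1 by (intro mult_left_mono) (auto simp: divide_right_mono)
      also have "\<dots> \<le> exp (- c / q) * (\<Sum>S\<in>Pow (Q T). w ((T \<union> R) \<union> S))"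
        using R QT T fQ fT assms(2,3) finite_subset[of R ?H] fin
        by (intro mult_left_mono sum_w_ge) auto
      finally show "w (T \<union> R) \<le> exp (- c / q) * (\<Sum>S\<in>Pow (Q T). w ((T \<union> R) \<union> S))" .
    qed
    also have "\<dots> = exp (- c / q) * (\<Sum>S\<in>Pow (Q T \<union> (?H - Q T)). w (T \<union> S))"
      using fQ fin by (subst Un_commute, subst sum_Pow_Un) (auto simp: sum_distrib_left Un_assoc)
    finally show ?thesis using True H by simp
  qed simp
  then have "(\<Sum>T\<in>Pow F. \<Sum>S\<in>Pow ?H. w (T \<union> S) * of_bool (A T \<and> S \<inter> Q T = {}))
      \<le> (\<Sum>T\<in>Pow F. exp (- c / q) * (\<Sum>S\<in>Pow ?H. w (T \<union> S) * of_bool (A T)))"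
    by (intro sum_mono) auto
  moreover have "pr E (\<lambda>S. A (S \<inter> F) \<and> S \<inter> Q (S \<inter> F) = {}) * Z E =
      (\<Sum>T\<in>Pow F. \<Sum>S\<in>Pow ?H. w (T \<union> S) * of_bool (A T \<and> S \<inter> Q T = {}))"
  proof (subst pr_split[OF assms(1,3)], intro sum.cong refl)
    fix T S assume "T \<in> Pow F" "S \<in> Pow ?H"
    then have "(T \<union> S) \<inter> F = T" "T \<inter> Q T = {} \<or> \<not> A T" using Q by auto
    then show "w (T \<union> S) * of_bool (A ((T \<union> S) \<inter> F) \<and> (T \<union> S) \<inter> Q ((T \<union> S) \<inter> F) = {}) =
        w (T \<union> S) * of_bool (A T \<and> S \<inter> Q T = {})"
      by (auto simp: Int_Un_distrib2)
  qed
  moreover have "pr E (\<lambda>S. A (S \<inter> F)) * Z E =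
      (\<Sum>T\<in>Pow F. \<Sum>S\<in>Pow ?H. w (T \<union> S) * of_bool (A T))"
  proof (subst pr_split[OF assms(1,3)], intro sum.cong refl)
    fix T S assume "T \<in> Pow F" "S \<in> Pow ?H"
    then have "(T \<union> S) \<inter> F = T" by auto
    then show "w (T \<union> S) * of_bool (A ((T \<union> S) \<inter> F)) = w (T \<union> S) * of_bool (A T)" by simp
  qed
  ultimately have "pr E (\<lambda>S. A (S \<inter> F) \<and> S \<inter> Q (S \<inter> F) = {}) * Z E
      \<le> (exp (- c / q) * pr E (\<lambda>S. A (S \<inter> F))) * Z E"
    by (simp add: sum_distrib_left mult.assoc)
  then show ?thesis using Z_pos[OF assms(1)] by simp
qed

text \<open>The set \<open>Q\<close> may depend on the exposed part \<open>S \<inter> F\<close>,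
  because \<open>sum_w_le\<close> applies for each exposed \<open>T\<close> separately. It will
  consist of the long edges at an exposed cluster, which are to be closed without losing more than a
  constant factor.\<close>

lemma pr_closed_ge:
  assumes "finite E" "E \<subseteq> pairs UNIV" "F \<subseteq> E"
    and Q: "\<And>T. T \<subseteq> F \<Longrightarrow> A T \<Longrightarrow> Q T \<subseteq> E - F \<and> (\<Sum>e\<in>Q T. t e) \<le> c"
  shows "pr E (\<lambda>S. A (S \<inter> F)) \<le> exp c * pr E (\<lambda>S. A (S \<inter> F) \<and> S \<inter> Q (S \<inter> F) = {})"
proof -
  let ?H = "E - F"
  have fin: "finite ?H" "finite F" using assms(1) finite_subset[OF assms(3,1)] by auto
  have "(\<Sum>S\<in>Pow ?H. w (T \<union> S) * of_bool (A T))
      \<le> exp c * (\<Sum>S\<in>Pow ?H. w (T \<union> S) * of_bool (A T \<and> S \<inter> Q T = {}))" if T: "T \<subseteq> F" for T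
  proof (cases "A T")
    case True
    note QT = Q[OF T True]
    have fQ: "finite (Q T)" using QT fin finite_subset[of "Q T" ?H] by auto
    have H: "(?H - Q T) \<union> Q T = ?H" using QT by auto
    have fT: "finite T" using T fin(2) by (rule finite_subset)
    have "(\<Sum>S\<in>Pow ?H. w (T \<union> S)) = (\<Sum>S\<in>Pow ((?H - Q T) \<union> Q T). w (T \<union> S))"
      using H by simp
    also have "\<dots> = (\<Sum>R\<in>Pow (?H - Q T). \<Sum>S\<in>Pow (Q T). w ((T \<union> R) \<union> S))"
      using fQ fin by (subst sum_Pow_Un) (auto simp: Un_assoc)
    also have "\<dots> \<le> (\<Sum>R\<in>Pow (?H - Q T). exp c * w (T \<union> R))"
    proof (rule sum_mono)
      fix R assume R: "R \<in> Pow (?H - Q T)"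
      have "(\<Sum>S\<in>Pow (Q T). w ((T \<union> R) \<union> S)) \<le> w (T \<union> R) * exp (\<Sum>e\<in>Q T. t e)"
        using R QT T fQ fT assms(2,3) finite_subset[of R ?H] fin by (intro sum_w_le) auto
      also have "\<dots> \<le> w (T \<union> R) * exp c" using QT by (intro mult_left_mono) auto
      finally show "(\<Sum>S\<in>Pow (Q T). w ((T \<union> R) \<union> S)) \<le> exp c * w (T \<union> R)" by (simp add: mult_ac)
    qed
    also have "\<dots> = exp c * (\<Sum>S\<in>Pow ?H. w (T \<union> S) * of_bool (S \<inter> Q T = {}))"
      unfolding sum_distrib_left[symmetric] using fin
      by (intro arg_cong[where f = "\<lambda>x. exp c * x"] sum.mono_neutral_cong_left) auto
    finally show ?thesis using True by simp
  qed simp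
  then have "(\<Sum>T\<in>Pow F. \<Sum>S\<in>Pow ?H. w (T \<union> S) * of_bool (A T))
      \<le> (\<Sum>T\<in>Pow F. exp c * (\<Sum>S\<in>Pow ?H. w (T \<union> S) * of_bool (A T \<and> S \<inter> Q T = {})))"
    by (intro sum_mono) auto
  moreover have "pr E (\<lambda>S. A (S \<inter> F) \<and> S \<inter> Q (S \<inter> F) = {}) * Z E =
      (\<Sum>T\<in>Pow F. \<Sum>S\<in>Pow ?H. w (T \<union> S) * of_bool (A T \<and> S \<inter> Q T = {}))"
  proof (subst pr_split[OF assms(1,3)], intro sum.cong refl)
    fix T S assume "T \<in> Pow F" "S \<in> Pow ?H"
    then have "(T \<union> S) \<inter> F = T" "T \<inter> Q T = {} \<or> \<not> A T" using Q by auto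
    then show "w (T \<union> S) * of_bool (A ((T \<union> S) \<inter> F) \<and> (T \<union> S) \<inter> Q ((T \<union> S) \<inter> F) = {}) =
        w (T \<union> S) * of_bool (A T \<and> S \<inter> Q T = {})"
      by (auto simp: Int_Un_distrib2)
  qed
  moreover have "pr E (\<lambda>S. A (S \<inter> F)) * Z E =
      (\<Sum>T\<in>Pow F. \<Sum>S\<in>Pow ?H. w (T \<union> S) * of_bool (A T))"
  proof (subst pr_split[OF assms(1,3)], intro sum.cong refl)
    fix T S assume "T \<in> Pow F" "S \<in> Pow ?H"
    then have "(T \<union> S) \<inter> F = T" by auto
    then show "w (T \<union> S) * of_bool (A ((T \<union> S) \<inter> F)) = w (T \<union> S) * of_bool (A T)" by simp
  qed
  ultimately have "pr E (\<lambda>S. A (S \<inter> F)) * Z E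
      \<le> (exp c * pr E (\<lambda>S. A (S \<inter> F) \<and> S \<inter> Q (S \<inter> F) = {})) * Z E"
    by (simp add: sum_distrib_left mult.assoc)
  then show ?thesis using Z_pos[OF assms(1)] by simp
qed

text \<open>An edge of \<open>S'\<close> has the same odds with or without \<open>S\<close>, as no
  cluster runs through edges of both.\<close>

lemma w_Un_disjoint:
  assumes "finite S'" "finite S" "S \<subseteq> pairs UNIV" "S' \<subseteq> pairs UNIV" "\<Union>S \<inter> \<Union>S' = {}"
  shows "w (S \<union> S') = w S * w S'"
  using assms
proof (induct S' rule: finite_induct)
  case (insert e S')
  obtain u v where uv: "e = {u, v}" "u \<noteq> v" using insert(5) doubleton_pairs[of e UNIV] insert by auto
  have "e \<notin> S" using insert uv by auto
  then have "w (S \<union> insert e S') = w (S \<union> S') * odds e (S \<union> S')"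
    using insert by (subst w_insert_odds[symmetric]) auto
  moreover have "odds e (S \<union> S') = odds e S'"
    unfolding uv odds_eq using insert uv by (subst cl_vertex_disjoint) auto
  moreover have "w (insert e S') = w S' * odds e S'"
    using insert by (intro w_insert_odds) auto
  moreover have "w (S \<union> S') = w S * w S'" using insert by auto
  ultimately show ?case by (simp only: mult.assoc)
qed simp

lemma pr_vertex_disjoint:
  assumes "finite F" "finite F'" "F \<subseteq> pairs UNIV" "F' \<subseteq> pairs UNIV" "\<Union>F \<inter> \<Union>F' = {}"
  shows "pr (F \<union> F') (\<lambda>S. A (S \<inter> F) \<and> B (S \<inter> F')) = pr F A * pr F' B"
proof -
  have d: "F \<inter> F' = {}"
  proof (rule ccontr)
    assume "F \<inter> F' \<noteq> {}"
    then obtain e where e: "e \<in> F" "e \<in> F'" by auto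
    then obtain u v where "e = {u, v}" using assms doubleton_pairs[of e UNIV] by auto
    then show False using e assms(5) by auto
  qed
  have p: "(\<Sum>S\<in>Pow (F \<union> F'). w S * of_bool (A (S \<inter> F) \<and> B (S \<inter> F'))) =
     (\<Sum>T\<in>Pow F. w T * of_bool (A T)) * (\<Sum>T\<in>Pow F'. w T * of_bool (B T))" for A B
  proof -
    have "(\<Sum>S\<in>Pow (F \<union> F'). w S * of_bool (A (S \<inter> F) \<and> B (S \<inter> F'))) =
      (\<Sum>T\<in>Pow F. \<Sum>S\<in>Pow F'. w (T \<union> S) * of_bool (A ((T \<union> S) \<inter> F) \<and> B ((T \<union> S) \<inter> F')))"
      using assms d by (subst sum_Pow_Un) auto
    also have "\<dots> = (\<Sum>T\<in>Pow F. \<Sum>S\<in>Pow F'. (w T * of_bool (A T)) * (w S * of_bool (B S)))"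
    proof (intro sum.cong refl)
      fix T S assume ts: "T \<in> Pow F" "S \<in> Pow F'"
      then have "(T \<union> S) \<inter> F = T" "(T \<union> S) \<inter> F' = S" using d by auto
      moreover have "w (T \<union> S) = w T * w S"
        using ts assms finite_subset[of T F] finite_subset[of S F'] by (intro w_Un_disjoint) blast+
      ultimately show "w (T \<union> S) * of_bool (A ((T \<union> S) \<inter> F) \<and> B ((T \<union> S) \<inter> F')) =
          (w T * of_bool (A T)) * (w S * of_bool (B S))" by auto
    qed
    also have "\<dots> = (\<Sum>T\<in>Pow F. w T * of_bool (A T)) * (\<Sum>T\<in>Pow F'. w T * of_bool (B T))"
      by (simp add: sum_product)
    finally show ?thesis .
  qed
  have "Z (F \<union> F') = Z F * Z F'" using p[of "\<lambda>_. True" "\<lambda>_. True"] by (simp add: Z_def)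
  then show ?thesis using p[of A B] by (simp add: pr_def ex_def)
qed

text \<open>Substitute for independence. Closing all edges outside \<open>F \<union> F'\<close> only
  makes decreasing events likelier, and afterwards the two vertex-disjoint parts are genuinely
  independent.\<close>

lemma pr_decreasing_disjoint:
  assumes "finite E" "E \<subseteq> pairs UNIV" "F \<subseteq> E" "F' \<subseteq> E" "\<Union>F \<inter> \<Union>F' = {}"
    and A: "\<And>S S'. S \<subseteq> S' \<Longrightarrow> A S' \<Longrightarrow> A S" and B: "\<And>S S'. S \<subseteq> S' \<Longrightarrow> B S' \<Longrightarrow> B S"
  shows "pr E (\<lambda>S. A (S \<inter> F) \<and> B (S \<inter> F')) \<le> pr F A * pr F' B"
proof -
  let ?C = "\<lambda>S. A (S \<inter> F) \<and> B (S \<inter> F')"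
  have fin: "finite F" "finite F'"
    using finite_subset[OF assms(3,1)] finite_subset[OF assms(4,1)] by auto
  have "pr (F \<union> F') (\<lambda>S. \<not> ?C S) \<le> pr E (\<lambda>S. \<not> ?C S)"
  proof (rule pr_increasing)
    fix S S' assume "S \<subseteq> S'" "\<not> ?C S"
    moreover have "S \<inter> F \<subseteq> S' \<inter> F" "S \<inter> F' \<subseteq> S' \<inter> F'" using calculation by auto
    ultimately show "\<not> ?C S'" using A B by blast
  qed (use assms in auto)
  then have "pr E ?C \<le> pr (F \<union> F') ?C"
    using pr_not[of "F \<union> F'" ?C] pr_not[of E ?C] assms(1) fin by auto
  also have "\<dots> = pr F A * pr F' B" using assms fin by (intro pr_vertex_disjoint) auto
  finally show ?thesis .
qed

lemma w_image:
  assumes "inj f" "finite S" "S \<subseteq> pairs UNIV" "\<And>e. e \<in> pairs UNIV \<Longrightarrow> t (f ` e) = t e"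
  shows "w ((`) f ` S) = w S"
  using assms(2,3)
proof (induct S rule: finite_induct)
  case (insert e S)
  obtain u v where uv: "e = {u, v}" "u \<noteq> v" using doubleton_pairs[of e UNIV] insert by auto
  have ne: "f u \<noteq> f v" using uv assms(1) by (simp add: inj_eq)
  have sub: "(`) f ` S \<subseteq> pairs UNIV"
  proof
    fix e' assume "e' \<in> (`) f ` S"
    then obtain e'' where "e'' \<in> S" "e' = f ` e''" by auto
    moreover have "e'' \<in> pairs UNIV" using calculation insert by auto
    then obtain a b where "e'' = {a, b}" "a \<noteq> b" using doubleton_pairs[of e'' UNIV] by blast
    ultimately have "e' = {f a, f b}" "f a \<noteq> f b" using assms(1) by (auto simp: inj_eq)
    then show "e' \<in> pairs UNIV" unfolding pairs_def by blast
  qed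
  have nin: "f ` e \<notin> (`) f ` S" using insert assms(1) by (metis imageE inj_image_eq_iff)
  have "w ((`) f ` insert e S) = w (insert (f ` e) ((`) f ` S))" by simp
  also have "\<dots> = w ((`) f ` S) * odds (f ` e) ((`) f ` S)"
    by (rule w_insert_odds) (use insert sub nin ne uv in \<open>auto simp: pairs_def\<close>)
  also have "odds (f ` e) ((`) f ` S) = odds e S"
    using assms(1) assms(4)[of e] insert(4) uv
    by (simp add: odds_eq cl_image inj_image_mem_iff)
  also have "w ((`) f ` S) * odds e S = w (insert e S)"
    using insert by (subst w_insert_odds) auto
  finally show ?case .
qed simp

lemma pr_image:
  assumes "inj f" "finite E" "E \<subseteq> pairs UNIV" "\<And>e. e \<in> pairs UNIV \<Longrightarrow> t (f ` e) = t e"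
  shows "pr ((`) f ` E) A = pr E (\<lambda>S. A ((`) f ` S))"
proof -
  have inj: "inj_on (image (image f)) (Pow E)"
    using assms(1) by (auto intro!: inj_onI simp: inj_image_eq_iff inj_def) 
  have P: "Pow ((`) f ` E) = image (image f) ` Pow E" by (simp add: image_Pow_surj)
  have ww: "w ((`) f ` S) = w S" if "S \<in> Pow E" for S
    using that assms finite_subset[of S E] by (intro w_image) auto
  have "Z ((`) f ` E) = Z E"
    unfolding Z_def P by (subst sum.reindex[OF inj]) (use ww in \<open>auto intro!: sum.cong\<close>)
  then show ?thesis unfolding pr_def ex_def P
    by (subst sum.reindex[OF inj]) (use ww in \<open>auto intro!: sum.cong arg_cong2[where f = "(/)"]\<close>)
qed

end

section \<open>Cubes and tiles\<close>

definition cube :: "int ^ 'd::finite \<Rightarrow> nat \<Rightarrow> (int ^ 'd) set" where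
  "cube a N = {x. \<forall>i. a $ i \<le> x $ i \<and> x $ i < a $ i + int N}"

lemma card_vec_Pi:
  fixes A :: "'d::finite \<Rightarrow> 'a set"
  shows "card {x :: 'a ^ 'd. \<forall>i. x $ i \<in> A i} = (\<Prod>i\<in>UNIV. card (A i))"
proof -
  have "bij_betw (\<lambda>f. \<chi> i. f i) (\<Pi>\<^sub>E i\<in>UNIV. A i) {x :: 'a ^ 'd. \<forall>i. x $ i \<in> A i}"
    by (rule bij_betwI[where g = "\<lambda>x i. x $ i"]) auto
  then have "card (\<Pi>\<^sub>E i\<in>UNIV. A i) = card {x :: 'a ^ 'd. \<forall>i. x $ i \<in> A i}"
    by (rule bij_betw_same_card)
  then show ?thesis by (simp add: card_PiE)
qed

lemma card_cube [simp]: "card (cube (a :: int ^ 'd::finite) N) = N ^ CARD('d)"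
proof -
  have "cube a N = {x. \<forall>i. x $ i \<in> {a $ i..<a $ i + int N}}" by (auto simp: cube_def)
  then show ?thesis by (simp only: card_vec_Pi) simp
qed

lemma finite_cube [simp]: "finite (cube (a :: int ^ 'd::finite) N)"
proof (cases "N = 0")
  case True
  then show ?thesis by (simp add: cube_def not_less[symmetric] less_irrefl)
next
  case False
  then have "card (cube a N) > 0" by simp
  then show ?thesis using card_ge_0_finite by blast
qed

lemma cube_mono: "N \<le> M \<Longrightarrow> cube a N \<subseteq> cube a M"
  unfolding cube_def by (auto, smt (verit) of_nat_mono)

lemma cube_shift: "cube (a + b) N = (+) a ` cube b N"
proof -
  have "x \<in> (+) a ` cube b N" if "x \<in> cube (a + b) N" for x
    using that by (intro image_eqI[where x = "x - a"]) (auto simp: cube_def algebra_simps)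
  then show ?thesis by (auto simp: cube_def)
qed

lemma l1_norm_nonneg: "0 \<le> l1_norm k"
  by (simp add: l1_norm_def sum_nonneg)

lemma l1_norm_minus: "l1_norm (x - y) = l1_norm (y - x)"
  by (simp add: l1_norm_def abs_minus_commute)

lemma l1_norm_cube:
  assumes "x \<in> cube a N" "y \<in> cube (a :: int ^ 'd::finite) N"
  shows "l1_norm (x - y) \<le> real CARD('d) * N"
proof -
  have "real_of_int \<bar>(x - y) $ i\<bar> \<le> real N" for i
  proof -
    have "a $ i \<le> x $ i" "x $ i < a $ i + int N" "a $ i \<le> y $ i" "y $ i < a $ i + int N"
      using assms by (auto simp: cube_def)
    then have "\<bar>(x - y) $ i\<bar> \<le> int N" by auto
    then show ?thesis by linarith
  qed
  then have "l1_norm (x - y) \<le> (\<Sum>i\<in>(UNIV :: 'd set). real N)"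
    unfolding l1_norm_def by (intro sum_mono)
  then show ?thesis by simp
qed

lemma l1_ball_subset_cube:
  fixes x :: "int ^ 'd::finite"
  shows "{y. l1_norm (y - x) < real r} \<subseteq> cube (x - (\<chi> i. int r)) (2 * r)"
proof
  fix y assume y: "y \<in> {y. l1_norm (y - x) < real r}"
  have "\<bar>y $ i - x $ i\<bar> < int r" for i
  proof -
    have "real_of_int \<bar>(y - x) $ i\<bar> \<le> l1_norm (y - x)"
      unfolding l1_norm_def by (rule member_le_sum) auto
    then show ?thesis using y by simp
  qed
  then show "y \<in> cube (x - (\<chi> i. int r)) (2 * r)"
    by (auto simp: cube_def abs_less_iff) (smt (verit, best))+
qed

lemma card_l1_ball:
  fixes x :: "int ^ 'd::finite"
  shows "finite {y. l1_norm (y - x) < real r}" "card {y. l1_norm (y - x) < real r} \<le> (2 * r) ^ CARD('d)"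
proof -
  show "finite {y. l1_norm (y - x) < real r}"
    using l1_ball_subset_cube[of x r] by (rule finite_subset) simp
  have "card {y. l1_norm (y - x) < real r} \<le> card (cube (x - (\<chi> i. int r)) (2 * r))"
    by (intro card_mono l1_ball_subset_cube) simp
  then show "card {y. l1_norm (y - x) < real r} \<le> (2 * r) ^ CARD('d)" by simp
qed

text \<open>For positive \<open>N\<close> the tiles with a common corner \<open>a\<close> partition
  the lattice by integer division of coordinates, see \<open>tile_iff\<close>. Nesting of two such
  grids then reduces to divisibility of their sides.\<close>

definition tile :: "int ^ 'd::finite \<Rightarrow> nat \<Rightarrow> int ^ 'd \<Rightarrow> (int ^ 'd) set" where
  "tile a N z = cube (a + (\<chi> i. int N * z $ i)) N"

lemma card_tile [simp]: "card (tile (a :: int ^ 'd::finite) N z) = N ^ CARD('d)"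
  by (simp add: tile_def)

lemma finite_tile [simp]: "finite (tile a N z)"
  by (simp add: tile_def)

lemma tile_iff:
  assumes "N > 0"
  shows "x \<in> tile a N z \<longleftrightarrow> (\<forall>i. z $ i = (x $ i - a $ i) div int N)"
proof -
  have div: "(int N * k \<le> y \<and> y < int N * k + int N) \<longleftrightarrow> k = y div int N" for y k
  proof
    assume h: "int N * k \<le> y \<and> y < int N * k + int N"
    then have "y = int N * k + (y - int N * k)" "0 \<le> y - int N * k" "y - int N * k < int N" by auto
    then show "k = y div int N" by (metis assms div_pos_pos_trivial div_mult_self4 add.commute
        add.right_neutral of_nat_0_less_iff order_less_irrefl)
  next
    assume "k = y div int N"
    moreover have "y = int N * (y div int N) + y mod int N" by simp
    moreover have "0 \<le> y mod int N" "y mod int N < int N" using assms by auto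
    ultimately have "y = int N * k + y mod int N" by simp
    then show "int N * k \<le> y \<and> y < int N * k + int N"
      using \<open>0 \<le> y mod int N\<close> \<open>y mod int N < int N\<close> by linarith
  qed
  have *: "a $ i + int N * z $ i \<le> x $ i \<and> x $ i < a $ i + int N * z $ i + int N \<longleftrightarrow>
      z $ i = (x $ i - a $ i) div int N" for i
  proof -
    define m y where "m = int N * z $ i" and "y = x $ i - a $ i"
    have "(a $ i + m \<le> x $ i \<and> x $ i < a $ i + m + int N) \<longleftrightarrow> m \<le> y \<and> y < m + int N"
      unfolding y_def by auto
    then show ?thesis using div[of "z $ i" y] by (simp add: m_def y_def)
  qed
  show ?thesis
    unfolding tile_def cube_def by (simp add: *[symmetric])
qed

lemma tile_disjoint:
  assumes "z \<noteq> z'" shows "tile a N z \<inter> tile a N z' = {}"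
proof (cases "N = 0")
  case True then show ?thesis by (auto simp: tile_def cube_def)
next
  case False
  then show ?thesis using assms by (auto simp: tile_iff vec_eq_iff)
qed

lemma div_bounds: "N > 0 \<Longrightarrow> (0 \<le> y div int N \<and> y div int N < int C) \<longleftrightarrow> (0 \<le> y \<and> y < int C * int N)"
proof -
  assume N: "N > 0"
  have "y div int N < int C \<longleftrightarrow> y < int C * int N"
  proof
    assume "y div int N < int C"
    then have "int N * (y div int N + 1) \<le> int N * int C" by (intro mult_left_mono) auto
    then have "int N * (y div int N) + int N \<le> int N * int C" by (simp add: distrib_left)
    moreover have "y = int N * (y div int N) + y mod int N" by simp
    moreover have "y mod int N < int N" using N by simp
    ultimately have "y < int N * int C" by linarith
    then show "y < int C * int N" by (simp add: mult.commute)
  next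
    assume y: "y < int C * int N"
    show "y div int N < int C"
    proof (rule ccontr)
      assume "\<not> y div int N < int C"
      then have "int N * int C \<le> int N * (y div int N)" by (intro mult_left_mono) auto
      moreover have "y = int N * (y div int N) + y mod int N" by simp
      moreover have "0 \<le> y mod int N" using N by simp
      ultimately have "int N * int C \<le> y" by linarith
      then show False using y by (simp add: mult.commute)
    qed
  qed
  then show ?thesis using N by (simp add: pos_imp_zdiv_nonneg_iff)
qed

lemma UN_tiles:
  assumes "N > 0"
  shows "(\<Union>z\<in>cube 0 C. tile a N z) = cube a (C * N)"
proof (intro set_eqI iffI)
  fix x assume "x \<in> (\<Union>z\<in>cube 0 C. tile a N z)"
  then obtain z where z: "z \<in> cube 0 C" "x \<in> tile a N z" by auto
  have "0 \<le> x $ i - a $ i \<and> x $ i - a $ i < int C * int N" for i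
    using z assms div_bounds[OF assms, of "x $ i - a $ i" C] by (auto simp: tile_iff cube_def)
  then show "x \<in> cube a (C * N)" by (simp add: cube_def algebra_simps)
next
  fix x assume x: "x \<in> cube a (C * N)"
  have "0 \<le> x $ i - a $ i \<and> x $ i - a $ i < int C * int N" for i
    using x by (simp add: cube_def algebra_simps)
  then have "(\<chi> i. (x $ i - a $ i) div int N) \<in> cube 0 C"
    using div_bounds[OF assms, of "x $ i - a $ i" C for i] by (auto simp: cube_def)
  moreover have "x \<in> tile a N (\<chi> i. (x $ i - a $ i) div int N)"
    using assms by (simp add: tile_iff)
  ultimately show "x \<in> (\<Union>z\<in>cube 0 C. tile a N z)" by blast
qed

lemma tile_subset: "z \<in> cube 0 C \<Longrightarrow> tile a N z \<subseteq> cube a (C * N)"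
proof (cases "N = 0")
  case True then show ?thesis by (auto simp: tile_def cube_def)
next
  case False
  then show "z \<in> cube 0 C \<Longrightarrow> tile a N z \<subseteq> cube a (C * N)" using UN_tiles[where N = N and C = C and a = a] by auto
qed

lemma tile_0: "tile a N 0 = cube a N"
  by (simp add: tile_def cube_def)

lemma zero_in_cube: "C > 0 \<Longrightarrow> 0 \<in> cube 0 (C :: nat)"
  by (simp add: cube_def)

text \<open>\<open>P\<close> lives on differences while edges are unordered, so the value is picked
  by a description, as in \<open>bond_prob\<close>; symmetry of \<open>P\<close> makes it unique in
  \<open>coupling_eq\<close>. The default 0 off the edges keeps it nonnegative everywhere.\<close>

definition coupling :: "(int ^ 'd::finite \<Rightarrow> real) \<Rightarrow> (int ^ 'd) set \<Rightarrow> real" where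
  "coupling P e = (if e \<in> pairs UNIV then THE p. \<exists>u v. e = {u, v} \<and> p = P (u - v) else 0)"

text \<open>The asymptotics of \<open>P\<close> enter only through bounds with a factor 2 beyond
  distance \<open>R\<close>. Of closer pairs only nonnegativity is known, so lower bounds below
  discard them.\<close>

locale long_range =
  fixes P :: "int ^ 'd::finite \<Rightarrow> real" and q s :: real and R :: nat
  assumes dim_less: "real CARD('d) < s" and less_dim: "s < 2 * real CARD('d)"
    and q_ge_1: "q \<ge> 1" and P_nonneg: "P k \<ge> 0" and P_sym: "P (- k) = P k"
    and R_pos: "R \<ge> 1"
    and P_lower: "l1_norm k \<ge> real R \<Longrightarrow> P k \<ge> l1_norm k powr (- s) / 2"
    and P_upper: "l1_norm k \<ge> real R \<Longrightarrow> P k \<le> 2 * l1_norm k powr (- s)"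
begin

lemma s_pos: "s > 0" using dim_less by (smt (verit) of_nat_0_le_iff)

lemma coupling_eq: "u \<noteq> v \<Longrightarrow> coupling P {u, v} = P (u - v)"
proof -
  assume uv: "u \<noteq> v"
  have "(THE p. \<exists>a b. {u, v} = {a, b} \<and> p = P (a - b)) = P (u - v)"
  proof (rule the_equality)
    fix p assume "\<exists>a b. {u, v} = {a, b} \<and> p = P (a - b)"
    then show "p = P (u - v)" using P_sym[of "u - v"] by (auto simp: doubleton_eq_iff)
  qed auto
  moreover have "{u, v} \<in> pairs UNIV" using uv by (auto simp: pairs_def)
  ultimately show ?thesis by (simp add: coupling_def)
qed

lemma coupling_nonneg: "coupling P e \<ge> 0"
proof (cases "e \<in> pairs UNIV")
  case True
  then show ?thesis using coupling_eq P_nonneg doubleton_pairs[OF True] by auto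
qed (simp add: coupling_def)

lemma coupling_shift: "e \<in> pairs UNIV \<Longrightarrow> coupling P ((+) a ` e) = coupling P e"
  using doubleton_pairs[of e UNIV] coupling_eq by (auto simp: coupling_eq)

lemma rc_beta: "\<beta> \<ge> 0 \<Longrightarrow> rc q (\<lambda>e. \<beta> * coupling P e)"
  by unfold_locales (use q_ge_1 coupling_nonneg in auto)

end

locale long_range_beta = long_range P q s R
  for P :: "int ^ 'd::finite \<Rightarrow> real" and q s :: real and R :: nat +
  fixes \<beta> :: real
  assumes beta_nonneg: "\<beta> \<ge> 0"
begin

sublocale rc q "\<lambda>e. \<beta> * coupling P e"
  using beta_nonneg by (rule rc_beta)

lemma pr_shift:
  assumes "finite V"
  shows "pr (pairs ((+) a ` V)) A = pr (pairs V) (\<lambda>S. A ((`) ((+) a) ` S))"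
  using pr_image[of "(+) a" "pairs V" A] assms coupling_shift pairs_mono[of V UNIV]
  by (simp add: pairs_image)

end

section \<open>Renormalization\<close>

text \<open>Only edges inside \<open>V\<close> count, so the event is local. A starting set
  \<open>W\<close> smaller than \<open>V\<close> serves to pin the large clusters of all scales to
  one fixed box.\<close>

definition has_big :: "'v set \<Rightarrow> 'v set \<Rightarrow> real \<Rightarrow> 'v set set \<Rightarrow> bool" where
  "has_big W V m S \<longleftrightarrow> (\<exists>x\<in>W. m \<le> real (card (cl (S \<inter> pairs V) x)))"

definition cross :: "'v set \<Rightarrow> 'v set \<Rightarrow> 'v set set" where
  "cross A B = (\<lambda>(x, y). {x, y}) ` (A \<times> B)"

lemma finite_cl: "finite V \<Longrightarrow> finite (cl (S \<inter> pairs V) x)"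
proof -
  assume "finite V"
  moreover have "cl (S \<inter> pairs V) x \<subseteq> insert x V"
    using cl_subset_Un[of "S \<inter> pairs V" x] by (auto simp: pairs_def)
  ultimately show ?thesis by (metis finite.insertI finite_subset)
qed

lemma has_big_mono:
  assumes "finite V'" "W \<subseteq> W'" "V \<subseteq> V'" "S \<subseteq> S'" "m' \<le> m" "has_big W V m S"
  shows "has_big W' V' m' S'"
proof -
  obtain x where x: "x \<in> W" "m \<le> card (cl (S \<inter> pairs V) x)" using assms by (auto simp: has_big_def)
  have "card (cl (S \<inter> pairs V) x) \<le> card (cl (S' \<inter> pairs V') x)"
    using assms pairs_mono[of V V'] by (intro card_mono finite_cl cl_mono) auto
  then show ?thesis using x assms by (auto simp: has_big_def intro!: bexI[of _ x])
qed

lemma has_big_image: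
  assumes "inj f"
  shows "has_big (f ` W) (f ` V) m ((`) f ` S) \<longleftrightarrow> has_big W V m S"
proof -
  have "(`) f ` S \<inter> pairs (f ` V) = (`) f ` (S \<inter> pairs V)"
    using assms by (simp add: pairs_image[symmetric] image_Int[symmetric] inj_def inj_image_eq_iff)
  then show ?thesis using assms
    by (auto simp: has_big_def cl_image card_image inj_on_subset)
qed

context long_range_beta
begin

lemma pr_has_big_shift:
  assumes "finite V"
  shows "pr (pairs ((+) a ` V)) (has_big ((+) a ` W) ((+) a ` V) m) = pr (pairs V) (has_big W V m)"
  unfolding pr_shift[OF assms] by (simp add: has_big_image)

text \<open>Each vertex of \<open>A\<close> has at least m/2 vertices of \<open>B\<close> beyond
  distance \<open>R\<close>, since a ball of radius \<open>R\<close> has at most (2R)^d points, and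
  each such pair has coupling at least half of (dM)^(-s). Then m times m/2 times 1/2 is the factor
  m^2/4.\<close>

lemma sum_cross_ge:
  fixes m :: real
  assumes "A \<inter> B = {}" "A \<subseteq> cube a M" "B \<subseteq> cube a M" "M > 0"
    and "m \<le> card A" "m \<le> card B" "2 * real ((2 * R) ^ CARD('d)) \<le> m"
  shows "\<beta> * m\<^sup>2 / 4 * (real CARD('d) * M) powr (- s) \<le> (\<Sum>e\<in>cross A B. \<beta> * coupling P e)"
proof -
  have fin: "finite A" "finite B" using finite_subset[OF assms(2)] finite_subset[OF assms(3)] by auto
  have inj: "inj_on (\<lambda>(x, y). {x, y}) (A \<times> B)"
    using assms(1) by (auto simp: inj_on_def doubleton_eq_iff)
  let ?p = "(real CARD('d) * M) powr (- s)"
  have m0: "m \<ge> 0" using order_trans[OF _ assms(7)] by simp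
  have inner: "m / 4 * ?p \<le> (\<Sum>y\<in>B. P (x - y))" if x: "x \<in> A" for x
  proof -
    let ?N = "{y. l1_norm (y - x) < real R}"
    define \<kappa> where "\<kappa> = real ((2 * R) ^ CARD('d))"
    have "card B \<le> card (B - ?N) + (2 * R) ^ CARD('d)"
      using diff_card_le_card_Diff[OF card_l1_ball(1)[of x R], of B] card_l1_ball(2)[of x R] by linarith
    then have "real (card B) \<le> real (card (B - ?N) + (2 * R) ^ CARD('d))" unfolding of_nat_le_iff .
    then have c: "real (card B) - \<kappa> \<le> real (card (B - ?N))" by (simp add: \<kappa>_def)
    have "m / 4 * ?p \<le> (real (card B) - \<kappa>) * (?p / 2)"
    proof -
      have "m / 2 \<le> real (card B) - \<kappa>" using assms by (simp add: \<kappa>_def)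
      then have "m / 2 * (?p / 2) \<le> (real (card B) - \<kappa>) * (?p / 2)"
        by (rule mult_right_mono) simp
      then show ?thesis by simp
    qed
    also have "\<dots> \<le> real (card (B - ?N)) * (?p / 2)"
      using c by (intro mult_right_mono) auto
    also have "\<dots> = (\<Sum>y\<in>B - ?N. ?p / 2)" by simp
    also have "\<dots> \<le> (\<Sum>y\<in>B - ?N. P (x - y))"
    proof (rule sum_mono)
      fix y assume y: "y \<in> B - ?N"
      then have l: "l1_norm (x - y) \<ge> real R" using l1_norm_minus[of x y] by auto
      have "l1_norm (x - y) \<le> real CARD('d) * M"
        using x y assms by (intro l1_norm_cube[where a = a]) auto
      then have "?p \<le> l1_norm (x - y) powr (- s)"
        using l R_pos s_pos by (intro powr_mono2') auto
      then show "?p / 2 \<le> P (x - y)" using P_lower[OF l] by simp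
    qed
    also have "\<dots> \<le> (\<Sum>y\<in>B. P (x - y))"
      using fin P_nonneg by (intro sum_mono2) auto
    finally show ?thesis .
  qed
  have "\<beta> * m\<^sup>2 / 4 * ?p = \<beta> * (m * (m / 4 * ?p))" by (simp add: power2_eq_square)
  also have "\<dots> \<le> \<beta> * (real (card A) * (m / 4 * ?p))"
    using assms m0 beta_nonneg by (intro mult_left_mono mult_right_mono) auto
  also have "\<dots> = \<beta> * (\<Sum>x\<in>A. m / 4 * ?p)" by simp
  also have "\<dots> \<le> \<beta> * (\<Sum>x\<in>A. \<Sum>y\<in>B. P (x - y))"
    using inner beta_nonneg by (intro mult_left_mono sum_mono) auto
  also have "\<dots> = (\<Sum>e\<in>cross A B. \<beta> * coupling P e)"
  proof -
    have "(\<Sum>e\<in>cross A B. \<beta> * coupling P e) = (\<Sum>(x, y)\<in>A \<times> B. \<beta> * P (x - y))"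
      unfolding cross_def using assms(1)
      by (subst sum.reindex[OF inj]) (auto intro!: sum.cong coupling_eq)
    then show ?thesis by (simp add: sum.cartesian_product[symmetric] sum_distrib_left)
  qed
  finally show ?thesis .
qed

text \<open>Both clusters are found by looking at \<open>F\<close> only, and \<open>p\<close>,
  \<open>p'\<close> name a vertex of each as a function of what was seen. No edge of
  \<open>F\<close> runs between the tiles, so all edges between the two clusters are still unexposed
  and \<open>pr_closed_le\<close> applies to them.\<close>

lemma link_prob:
  fixes m :: real
  assumes "T \<inter> T' = {}" "T \<subseteq> cube a M" "T' \<subseteq> cube a M" "M > 0"
    and F: "pairs T \<subseteq> F" "pairs T' \<subseteq> F" "F \<subseteq> pairs (cube a M)"
      "\<And>e. e \<in> F \<Longrightarrow> e \<inter> T = {} \<or> e \<inter> T' = {}"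
    and m: "2 * real ((2 * R) ^ CARD('d)) \<le> m"
  shows "pr (pairs (cube a M)) (\<lambda>S. p (S \<inter> F) \<in> T \<and> p' (S \<inter> F) \<in> T' \<and>
      m \<le> card (cl (S \<inter> pairs T) (p (S \<inter> F))) \<and> m \<le> card (cl (S \<inter> pairs T') (p' (S \<inter> F))) \<and>
      S \<inter> cross (cl (S \<inter> pairs T) (p (S \<inter> F))) (cl (S \<inter> pairs T') (p' (S \<inter> F))) = {})
    \<le> exp (- (\<beta> * m\<^sup>2 / 4 * (real CARD('d) * M) powr (- s)) / q)"
proof -
  let ?E = "pairs (cube a M)"
  let ?A = "\<lambda>U. p U \<in> T \<and> p' U \<in> T' \<and>
      m \<le> card (cl (U \<inter> pairs T) (p U)) \<and> m \<le> card (cl (U \<inter> pairs T') (p' U))"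
  let ?Q = "\<lambda>U. cross (cl (U \<inter> pairs T) (p U)) (cl (U \<inter> pairs T') (p' U))"
  let ?c = "\<beta> * m\<^sup>2 / 4 * (real CARD('d) * M) powr (- s)"
  have i: "S \<inter> F \<inter> pairs T = S \<inter> pairs T" "S \<inter> F \<inter> pairs T' = S \<inter> pairs T'" for S
    using F by auto
  have "pr ?E (\<lambda>S. ?A (S \<inter> F) \<and> S \<inter> ?Q (S \<inter> F) = {}) \<le> exp (- ?c / q) * pr ?E (\<lambda>S. ?A (S \<inter> F))"
  proof (rule pr_closed_le)
    fix U assume U: "U \<subseteq> F" "?A U"
    have s: "cl (U \<inter> pairs T) (p U) \<subseteq> T" "cl (U \<inter> pairs T') (p' U) \<subseteq> T'"
      using cl_subset_pairs[of "U \<inter> pairs T" T "p U"] cl_subset_pairs[of "U \<inter> pairs T'" T' "p' U"] U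
      by blast+
    have "?Q U \<subseteq> ?E - F"
    proof
      fix e assume "e \<in> ?Q U"
      then obtain x y where xy: "e = {x, y}" "x \<in> T" "y \<in> T'" using s by (auto simp: cross_def)
      then have "x \<noteq> y" using assms(1) by auto
      then have "e \<in> ?E" using xy assms by (auto intro!: pairsI)
      then show "e \<in> ?E - F" using xy F(4)[of e] by auto
    qed
    moreover have "?c \<le> (\<Sum>e\<in>?Q U. \<beta> * coupling P e)"
    proof (rule sum_cross_ge[where a = a])
      show "cl (U \<inter> pairs T) (p U) \<inter> cl (U \<inter> pairs T') (p' U) = {}"
        using s assms(1) by blast
      show "cl (U \<inter> pairs T) (p U) \<subseteq> cube a M" "cl (U \<inter> pairs T') (p' U) \<subseteq> cube a M"
        using s assms(2,3) by blast+
    qed (use U assms(4) m in auto)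
    ultimately show "?Q U \<subseteq> ?E - F \<and> ?c \<le> (\<Sum>e\<in>?Q U. \<beta> * coupling P e)" ..
  qed (use F in auto)
  also have "\<dots> \<le> exp (- ?c / q) * 1"
    by (intro mult_left_mono pr_le_1) auto
  finally show ?thesis by (simp add: i conj_assoc)
qed

text \<open>Failure needs two tiles without a large cluster, or two chosen clusters without a direct
  link. Asking for two bad tiles squares \<epsilon>, which lets the error shrink from scale to
  scale; the price is the possible loss of one tile, hence \<open>C ^ CARD('d) - 1\<close>. The
  prefactor bounds the number of ordered pairs of tiles. The second alternative in the event carries
  a large cluster that meets \<open>W\<close> over to the next scale.\<close>

lemma renormalization_step:
  fixes m :: real
  assumes C: "C \<ge> 2" and N: "N \<ge> 1" and m: "2 * real ((2 * R) ^ CARD('d)) \<le> m"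
    and W: "W \<subseteq> cube 0 N"
    and good: "pr (pairs (cube 0 N)) (has_big (cube 0 N) (cube 0 N) m) \<ge> 1 - \<epsilon>"
  shows "pr (pairs (cube 0 (C * N))) (\<lambda>S.
      \<not> has_big (cube 0 (C * N)) (cube 0 (C * N)) (real (C ^ CARD('d) - 1) * m) S \<or>
      has_big W (cube 0 N) m S \<and> \<not> has_big W (cube 0 (C * N)) (real (C ^ CARD('d) - 1) * m) S)
    \<le> real (C ^ CARD('d)) ^ 2 * (\<epsilon>\<^sup>2 + exp (- (\<beta> * m\<^sup>2 / 4 * (real CARD('d) * (C * N)) powr (- s)) / q))"
proof -
  let ?M = "C * N"
  let ?V = "cube 0 ?M :: (int ^ 'd) set"
  let ?E = "pairs ?V"
  let ?m = "real (C ^ CARD('d) - 1) * m"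
  let ?I = "cube 0 C :: (int ^ 'd) set"
  define T where "T z = tile (0 :: int ^ 'd) N z" for z
  have N0: "N > 0" and C0: "C > 0" and M0: "?M > 0" using N C by auto
  have T_sub: "T z \<subseteq> ?V" if "z \<in> ?I" for z unfolding T_def by (rule tile_subset[OF that])
  have T_disj: "T z \<inter> T z' = {}" if "z \<noteq> z'" for z z' unfolding T_def by (rule tile_disjoint[OF that])
  have T0: "T 0 = cube 0 N" by (simp add: T_def tile_0)
  define F where "F = (\<Union>z\<in>?I. pairs (T z))"
  have F_sub: "F \<subseteq> ?E" unfolding F_def using T_sub pairs_mono by blast
  have F_cross: "e \<inter> T z = {} \<or> e \<inter> T z' = {}" if "e \<in> F" "z \<noteq> z'" for e z z'
  proof -
    obtain y where "e \<subseteq> T y" using \<open>e \<in> F\<close> by (auto simp: F_def pairs_def)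
    then show ?thesis using T_disj[of y z] T_disj[of y z'] that by (cases "y = z") auto
  qed
  \<comment> \<open>In tile 0 a vertex of \<open>W\<close> is preferred whenever one has a large
    cluster there, so that the merged cluster contains a vertex of \<open>W\<close>.\<close>
  define p where "p z U = (if z = 0 \<and> has_big W (T 0) m U
      then SOME x. x \<in> W \<and> m \<le> card (cl (U \<inter> pairs (T z)) x)
      else SOME x. x \<in> T z \<and> m \<le> card (cl (U \<inter> pairs (T z)) x))" for z and U :: "(int ^ 'd) set set"
  have p: "p z U \<in> T z \<and> m \<le> card (cl (U \<inter> pairs (T z)) (p z U))" if "has_big (T z) (T z) m U" for z U
  proof (cases "z = 0 \<and> has_big W (T 0) m U")
    case True
    then have "\<exists>x. x \<in> W \<and> m \<le> card (cl (U \<inter> pairs (T z)) x)" by (auto simp: has_big_def)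
    from someI_ex[OF this] show ?thesis using True W T0 by (auto simp: p_def)
  next
    case False
    have "\<exists>x. x \<in> T z \<and> m \<le> card (cl (U \<inter> pairs (T z)) x)" using that by (auto simp: has_big_def)
    from someI_ex[OF this] show ?thesis using False by (auto simp: p_def)
  qed
  have pW: "p 0 U \<in> W" if "has_big W (T 0) m U" for U
  proof -
    have "\<exists>x. x \<in> W \<and> m \<le> card (cl (U \<inter> pairs (T 0)) x)" using that by (auto simp: has_big_def)
    from someI_ex[OF this] show ?thesis using that by (auto simp: p_def)
  qed
  have FT: "has_big X (T z) m (S \<inter> F) = has_big X (T z) m S" "S \<inter> F \<inter> pairs (T z) = S \<inter> pairs (T z)"
    if "z \<in> ?I" for X z S
  proof -
    show "S \<inter> F \<inter> pairs (T z) = S \<inter> pairs (T z)" using that by (auto simp: F_def)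
    then show "has_big X (T z) m (S \<inter> F) = has_big X (T z) m S" by (simp add: has_big_def)
  qed
  let ?K = "\<lambda>z S. cl (S \<inter> pairs (T z)) (p z (S \<inter> F))"
  let ?B1 = "\<lambda>(z, z') S. \<not> has_big (T z) (T z) m S \<and> \<not> has_big (T z') (T z') m S"
  let ?B2 = "\<lambda>(z, z') S. p z (S \<inter> F) \<in> T z \<and> p z' (S \<inter> F) \<in> T z' \<and>
      m \<le> card (?K z S) \<and> m \<le> card (?K z' S) \<and> S \<inter> cross (?K z S) (?K z' S) = {}"
  let ?J = "{(z, z') \<in> ?I \<times> ?I. z \<noteq> z'}"
  let ?G = "\<lambda>S. \<not> has_big ?V ?V ?m S \<or> has_big W (cube 0 N) m S \<and> \<not> has_big W ?V ?m S"
  have fJ: "finite ?J" by (rule finite_subset[of _ "?I \<times> ?I"]) auto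
  have cJ: "real (card ?J) \<le> real (C ^ CARD('d)) ^ 2"
  proof -
    have "card ?J \<le> card (?I \<times> ?I)" by (intro card_mono) auto
    also have "\<dots> = (C ^ CARD('d))\<^sup>2" by (simp add: card_cartesian_product power2_eq_square)
    finally have "real (card ?J) \<le> real ((C ^ CARD('d))\<^sup>2)" unfolding of_nat_le_iff .
    then show ?thesis by simp
  qed
  \<comment> \<open>Outside the pair events at most one tile is bad, and the clusters chosen in the
    other tiles are pairwise linked, hence parts of one cluster.\<close>
  have det: "\<exists>j\<in>?J. ?B1 j S \<or> ?B2 j S" if S: "S \<subseteq> ?E" "?G S" for S
  proof (rule ccontr)
    assume "\<not> ?thesis"
    then have n1: "has_big (T z) (T z) m S \<or> has_big (T z') (T z') m S"
      and n2: "p z (S \<inter> F) \<in> T z \<Longrightarrow> p z' (S \<inter> F) \<in> T z' \<Longrightarrow> m \<le> card (?K z S) \<Longrightarrow> m \<le> card (?K z' S) \<Longrightarrow>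
        S \<inter> cross (?K z S) (?K z' S) \<noteq> {}"
      if "z \<in> ?I" "z' \<in> ?I" "z \<noteq> z'" for z z'
      using that by blast+
    define G where "G = {z \<in> ?I. has_big (T z) (T z) m S}"
    have fG: "finite G" by (simp add: G_def)
    have "card (?I - G) \<le> 1"
    proof (rule ccontr)
      assume "\<not> ?thesis"
      then obtain z z' where "z \<in> ?I - G" "z' \<in> ?I - G" "z \<noteq> z'"
        by (metis card_le_Suc0_iff_eq finite_Diff finite_cube One_nat_def)
      then show False using n1[of z z'] by (auto simp: G_def)
    qed
    then have cG: "C ^ CARD('d) - 1 \<le> card G"
      using fG by (subst (asm) card_Diff_subset) (auto simp: G_def)
    have "C \<le> C ^ CARD('d)" using C by (intro self_le_power) auto
    then have two: "C ^ CARD('d) \<ge> 2" using C by linarith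
    have K: "p z (S \<inter> F) \<in> T z" "m \<le> card (?K z S)" "?K z S \<subseteq> T z" if "z \<in> G" for z
    proof -
      have "has_big (T z) (T z) m (S \<inter> F)" "z \<in> ?I" using that FT(1) by (auto simp: G_def)
      from p[OF this(1)] FT(2)[OF this(2)]
      show "p z (S \<inter> F) \<in> T z" "m \<le> card (?K z S)" by auto
      then show "?K z S \<subseteq> T z" by (intro cl_subset_pairs) auto
    qed
    have link: "?K z' S \<subseteq> cl (S \<inter> ?E) (p z (S \<inter> F))" if z: "z \<in> G" "z' \<in> G" for z z'
    proof (cases "z = z'")
      case True
      have "z' \<in> ?I" using z by (simp add: G_def)
      then have "S \<inter> pairs (T z') \<subseteq> S \<inter> ?E" using pairs_mono[OF T_sub[of z']] by blast
      then show ?thesis unfolding True by (rule cl_mono)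
    next
      case False
      have "z \<in> ?I" "z' \<in> ?I" using z by (auto simp: G_def)
      from n2[OF this False K(1)[OF z(1)] K(1)[OF z(2)] K(2)[OF z(1)] K(2)[OF z(2)]]
      obtain x y where xy: "{x, y} \<in> S" "x \<in> ?K z S" "y \<in> ?K z' S" by (auto simp: cross_def)
      let ?S = "S \<inter> ?E"
      have sub: "S \<inter> pairs (T z) \<subseteq> ?S" "S \<inter> pairs (T z') \<subseteq> ?S"
        using z pairs_mono[OF T_sub[of z]] pairs_mono[OF T_sub[of z']] by (auto simp: G_def)
      have "x \<in> cl ?S (p z (S \<inter> F))" using xy cl_mono[OF sub(1)] by blast
      then have "cl ?S x = cl ?S (p z (S \<inter> F))" by (rule cl_eq)
      moreover have "y \<in> cl ?S x" using xy S by (intro cl_edge) auto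
      then have "cl ?S y = cl ?S x" by (rule cl_eq)
      moreover have "y \<in> cl ?S (p z' (S \<inter> F))" using xy cl_mono[OF sub(2)] by blast
      then have "cl ?S y = cl ?S (p z' (S \<inter> F))" by (rule cl_eq)
      ultimately show ?thesis using cl_mono[OF sub(2), of "p z' (S \<inter> F)"] by simp
    qed
    have big: "?m \<le> card (cl (S \<inter> ?E) (p z (S \<inter> F)))" if z: "z \<in> G" for z
    proof -
      have "?m \<le> real (card G) * m"
        using cG m by (intro mult_right_mono) (auto intro: order_trans[OF _ m])
      also have "\<dots> \<le> (\<Sum>z\<in>G. real (card (?K z S)))" using K(2) by (intro sum_bounded_below) auto
      also have "\<dots> = real (card (\<Union>z\<in>G. ?K z S))"
      proof (subst card_UN_disjoint)
        show "\<forall>i\<in>G. \<forall>j\<in>G. i \<noteq> j \<longrightarrow> ?K i S \<inter> ?K j S = {}" using K(3) T_disj by blast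
      qed (use fG in \<open>auto intro!: finite_cl simp: T_def\<close>)
      also have "\<dots> \<le> card (cl (S \<inter> ?E) (p z (S \<inter> F)))"
        using link[OF z] by (auto intro!: card_mono finite_cl)
      finally show ?thesis .
    qed
    have "G \<noteq> {}" using cG two by auto
    then obtain z where z: "z \<in> G" by auto
    have "has_big ?V ?V ?m S"
      using big[OF z] K(1)[OF z] T_sub[of z] z by (auto simp: has_big_def G_def)
    moreover have "has_big W ?V ?m S" if h: "has_big W (cube 0 N) m S"
    proof -
      have z0: "0 \<in> ?I" using C0 by (rule zero_in_cube)
      have "has_big (T 0) (T 0) m S" using W by (intro has_big_mono[OF _ _ _ _ _ h]) (auto simp: T0)
      then have G0: "0 \<in> G" using z0 by (simp add: G_def)
      have "has_big W (T 0) m (S \<inter> F)" using h FT(1)[OF z0, of W] by (simp add: T0)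
      then show ?thesis using big[OF G0] pW by (auto simp: has_big_def)
    qed
    ultimately show False using S(2) by auto
  qed
  have b1: "pr ?E (?B1 j) \<le> \<epsilon>\<^sup>2" if j: "j \<in> ?J" for j
  proof -
    obtain z z' where zz: "j = (z, z')" "z \<in> ?I" "z' \<in> ?I" "z \<noteq> z'" using j by auto
    have e: "pr (pairs (T y)) (\<lambda>S. \<not> has_big (T y) (T y) m S) \<le> \<epsilon>" for y
    proof -
      have "T y = (+) (\<chi> i. int N * y $ i) ` cube 0 N"
        unfolding T_def tile_def by (metis add.commute cube_shift)
      then have "pr (pairs (T y)) (has_big (T y) (T y) m) = pr (pairs (cube 0 N)) (has_big (cube 0 N) (cube 0 N) m)"
        using pr_has_big_shift[of "cube 0 N" "\<chi> i. int N * y $ i" "cube 0 N" m] by simp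
      then show ?thesis using good by (subst pr_not) (auto simp: T_def)
    qed
    have "pr ?E (?B1 j) = pr ?E (\<lambda>S. \<not> has_big (T z) (T z) m (S \<inter> pairs (T z)) \<and> \<not> has_big (T z') (T z') m (S \<inter> pairs (T z')))"
      using zz by (simp add: has_big_def)
    also have "\<dots> \<le> pr (pairs (T z)) (\<lambda>S. \<not> has_big (T z) (T z) m S) * pr (pairs (T z')) (\<lambda>S. \<not> has_big (T z') (T z') m S)"
    proof (rule pr_decreasing_disjoint)
      show "\<Union> (pairs (T z)) \<inter> \<Union> (pairs (T z')) = {}"
        using T_disj[OF zz(4)] by (auto simp: pairs_def)
      have dec: "\<not> has_big (T y) (T y) m S" if "S \<subseteq> S'" "\<not> has_big (T y) (T y) m S'" for y S S'
        using that has_big_mono[of "T y" "T y" "T y" "T y" S S' m m] by (auto simp: T_def)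
      show "\<not> has_big (T z) (T z) m S" if "S \<subseteq> S'" "\<not> has_big (T z) (T z) m S'" for S S'
        using dec that by blast
      show "\<not> has_big (T z') (T z') m S" if "S \<subseteq> S'" "\<not> has_big (T z') (T z') m S'" for S S'
        using dec that by blast
      show "pairs (T z) \<subseteq> ?E" "pairs (T z') \<subseteq> ?E" using zz T_sub pairs_mono by blast+
    qed auto
    also have "\<dots> \<le> \<epsilon> * \<epsilon>"
      using e[of z] e[of z'] by (intro mult_mono pr_nonneg order_trans[OF pr_nonneg e]) (auto simp: T_def)
    finally show ?thesis by (simp add: power2_eq_square)
  qed
  have b2: "pr ?E (?B2 j) \<le> exp (- (\<beta> * m\<^sup>2 / 4 * (real CARD('d) * ?M) powr (- s)) / q)" if j: "j \<in> ?J" for j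
  proof -
    obtain z z' where zz: "j = (z, z')" "z \<in> ?I" "z' \<in> ?I" "z \<noteq> z'" using j by auto
    show ?thesis unfolding zz(1) prod.case
    proof (rule link_prob)
      show "e \<inter> T z = {} \<or> e \<inter> T z' = {}" if "e \<in> F" for e using F_cross that zz by auto
      show "pairs (T z) \<subseteq> F" "pairs (T z') \<subseteq> F" using zz by (auto simp: F_def)
    qed (use zz T_disj T_sub M0 F_sub m in auto)
  qed
  have "pr ?E ?G \<le> pr ?E (\<lambda>S. \<exists>j\<in>?J. ?B1 j S \<or> ?B2 j S)"
    by (rule pr_mono[OF _ det]) auto
  also have "\<dots> \<le> (\<Sum>j\<in>?J. pr ?E (\<lambda>S. ?B1 j S \<or> ?B2 j S))"
    using fJ by (intro pr_bex) auto
  also have "\<dots> \<le> (\<Sum>j\<in>?J. \<epsilon>\<^sup>2 + exp (- (\<beta> * m\<^sup>2 / 4 * (real CARD('d) * ?M) powr (- s)) / q))"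
    by (intro sum_mono order_trans[OF pr_disj] add_mono b1 b2) auto
  also have "\<dots> = real (card ?J) * (\<epsilon>\<^sup>2 + exp (- (\<beta> * m\<^sup>2 / 4 * (real CARD('d) * ?M) powr (- s)) / q))"
    by simp
  also have "\<dots> \<le> real (C ^ CARD('d)) ^ 2 * (\<epsilon>\<^sup>2 + exp (- (\<beta> * m\<^sup>2 / 4 * (real CARD('d) * ?M) powr (- s)) / q))"
    using cJ by (intro mult_right_mono) auto
  finally show ?thesis by simp
qed

end

context long_range
begin

abbreviation \<phi> :: "real \<Rightarrow> (int ^ 'd) set \<Rightarrow> ((int ^ 'd) set set \<Rightarrow> bool) \<Rightarrow> real" where
  "\<phi> \<beta> V A \<equiv> rc.pr q (\<lambda>e. \<beta> * coupling P e) (pairs V) A"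

text \<open>A merging multiplies the cluster size by \<open>C ^ CARD('d) - 1\<close> and the
  threshold N^(s/2) by C^(s/2). As s/2 < d, a large block factor makes the former at least twice the
  latter, so that m^2 N^(-s) gains a factor 4 per scale.\<close>

lemma block_factor: "\<exists>C\<ge>2. 2 * real C powr (s / 2) \<le> real (C ^ CARD('d) - 1)"
proof -
  define d where "d = real CARD('d) - s / 2"
  have d: "d > 0" using less_dim by (simp add: d_def)
  define C where "C = nat \<lceil>4 powr (1 / d)\<rceil> + 2"
  have C2: "C \<ge> 2" by (simp add: C_def)
  have "4 powr (1 / d) \<le> real C" unfolding C_def by linarith
  then have "(4 powr (1 / d)) powr d \<le> real C powr d" using d by (intro powr_mono2) auto
  then have "4 \<le> real C powr d" using d by (simp add: powr_powr)
  then have "4 * real C powr (s / 2) \<le> real C powr d * real C powr (s / 2)"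
    by (intro mult_right_mono) auto
  also have "\<dots> = real C powr real CARD('d)" using C2 by (simp add: powr_add[symmetric] d_def)
  also have "\<dots> = real (C ^ CARD('d))" using C2 by (simp add: powr_realpow)
  finally have *: "4 * real C powr (s / 2) \<le> real (C ^ CARD('d))" .
  have "1 \<le> real C powr (s / 2)" using C2 s_pos by (intro ge_one_powr_ge_zero) auto
  then have "2 * real C powr (s / 2) \<le> real (C ^ CARD('d)) - 1" using * by linarith
  also have "\<dots> = real (C ^ CARD('d) - 1)" using C2 by (subst of_nat_diff) auto
  finally show ?thesis using C2 by blast
qed

text \<open>The constants depend on \<beta> only through the lower bound \<open>b0\<close>. This
  uniformity allows the criterion, found at one \<beta>, to be applied at a slightly smaller
  one.\<close>

lemma renormalization:
  assumes b0: "b0 > 0"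
  shows "\<exists>\<rho>>0. \<exists>\<eta>>0. \<forall>\<beta>\<ge>b0. \<forall>N\<ge>1.
     \<phi> \<beta> (cube 0 N) (has_big (cube 0 N) (cube 0 N) (\<rho> * real N powr (s / 2))) \<ge> 1 - \<eta> \<longrightarrow>
     (\<exists>(L :: nat \<Rightarrow> nat) (m :: nat \<Rightarrow> real). filterlim m at_top sequentially \<and>
        (\<forall>n k. k \<le> n \<longrightarrow> cube (0 :: int ^ 'd) (L k) \<subseteq> cube 0 (L n) \<and>
           \<phi> \<beta> (cube 0 (L n)) (has_big (cube 0 (L k)) (cube 0 (L n)) (m n)) \<ge> 1 - (1 / 2) ^ k))"
proof -
  obtain C :: nat where C: "C \<ge> 2" "2 * real C powr (s / 2) \<le> real (C ^ CARD('d) - 1)"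
    using block_factor by auto
  define G where "G = real (C ^ CARD('d) - 1)"
  define K where "K = real (C ^ CARD('d)) ^ 2"
  \<comment> \<open>With this \<eta>, K times (\<eta> 2^(-k))^2 is at most a quarter of \<eta>
    2^(-k), and a linking error of at most 2^(-k) / (16 K^2) contributes another quarter: the bound
    on the failure probability halves at each scale.\<close>
  define \<eta> where "\<eta> = 1 / (4 * K)"
  define \<kappa> where "\<kappa> = 2 * real ((2 * R) ^ CARD('d))"
  define H where "H = (real CARD('d) * real C) powr (- s)"
  \<comment> \<open>\<open>\<kappa>\<close> provides the minimal size for
    \<open>sum_cross_ge\<close>; the square root makes the linking exponent at least
    \<open>16 * K\<^sup>2\<close> already at scale 0.\<close>
  define \<rho> where "\<rho> = \<kappa> + sqrt (64 * q * K\<^sup>2 / (b0 * H))"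
  have "real (C ^ CARD('d)) \<ge> 1" using C by simp
  then have K1: "K \<ge> 1" unfolding K_def by (rule one_le_power)
  have \<eta>: "\<eta> > 0" "\<eta> \<le> 1 / 2" using K1 by (auto simp: \<eta>_def field_simps)
  have H: "H > 0" using C by (simp add: H_def)
  have \<kappa>: "\<kappa> > 0" using R_pos by (simp add: \<kappa>_def)
  have G2: "2 \<le> G"
  proof -
    have "1 \<le> real C powr (s / 2)" using C s_pos by (intro ge_one_powr_ge_zero) auto
    then show ?thesis using C by (simp add: G_def)
  qed
  have \<rho>\<kappa>: "\<rho> \<ge> \<kappa>" using q_ge_1 b0 H by (simp add: \<rho>_def)
  have \<rho>0: "\<rho> > 0" using \<rho>\<kappa> \<kappa> by simp
  have Y: "16 * K\<^sup>2 \<le> b0 * \<rho>\<^sup>2 * H / (4 * q)"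
  proof -
    have "64 * q * K\<^sup>2 / (b0 * H) = (sqrt (64 * q * K\<^sup>2 / (b0 * H)))\<^sup>2"
      using q_ge_1 b0 H by simp
    also have "\<dots> \<le> \<rho>\<^sup>2" using \<kappa> q_ge_1 b0 H by (intro power_mono) (auto simp: \<rho>_def)
    finally show ?thesis using q_ge_1 b0 H by (simp add: field_simps)
  qed
  have main: "\<exists>(L :: nat \<Rightarrow> nat) (m :: nat \<Rightarrow> real). filterlim m at_top sequentially \<and>
        (\<forall>n k. k \<le> n \<longrightarrow> cube (0 :: int ^ 'd) (L k) \<subseteq> cube 0 (L n) \<and>
           \<phi> \<beta> (cube 0 (L n)) (has_big (cube 0 (L k)) (cube 0 (L n)) (m n)) \<ge> 1 - (1 / 2) ^ k)"
    if \<beta>: "\<beta> \<ge> b0" and N: "N \<ge> 1"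
      and base: "\<phi> \<beta> (cube 0 N) (has_big (cube 0 N) (cube 0 N) (\<rho> * real N powr (s / 2))) \<ge> 1 - \<eta>" for \<beta> N
  proof -
    interpret long_range_beta P q s R \<beta>
      by unfold_locales (use \<beta> b0 in auto)
    define L where "L k = C ^ k * N" for k
    define m where "m k = \<rho> * real N powr (s / 2) * G ^ k" for k
    have N1: "1 \<le> real N powr (s / 2)" using N s_pos by (intro ge_one_powr_ge_zero) auto
    have m_base: "\<rho> * real N powr (s / 2) \<ge> \<rho>"
      using N1 \<rho>0 by simp
    have m_ge: "m k \<ge> \<rho> * 2 ^ k" for k
      unfolding m_def using m_base G2 \<rho>0 N1 by (intro mult_mono power_mono) auto
    have m_\<kappa>: "m k \<ge> \<kappa>" for k
    proof -
      have "\<rho> * 1 \<le> \<rho> * 2 ^ k" using \<rho>0 by (intro mult_left_mono) auto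
      then show ?thesis using m_ge[of k] \<rho>\<kappa> by simp
    qed
    have m_lim: "filterlim m at_top sequentially"
    proof (rule filterlim_at_top_mono)
      show "filterlim (\<lambda>k. \<rho> * real k) at_top sequentially"
        using \<rho>0 by (intro filterlim_tendsto_pos_mult_at_top[OF tendsto_const] filterlim_real_sequentially)
      have "\<rho> * real k \<le> m k" for k
      proof -
        have "real k \<le> 2 ^ k" using of_nat_less_two_power[of k, where 'a = real] by simp
        then have "\<rho> * real k \<le> \<rho> * 2 ^ k" using \<rho>0 by (intro mult_left_mono) auto
        then show ?thesis using m_ge[of k] by linarith
      qed
      then show "\<forall>\<^sub>F k in sequentially. \<rho> * real k \<le> m k" by simp
    qed
    have L1: "L k \<ge> 1" for k using C N by (simp add: L_def)
    have L_Suc: "L (Suc k) = C * L k" for k by (simp add: L_def)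
    have m_Suc: "m (Suc k) = G * m k" for k by (simp add: m_def)
    have L_mono: "k \<le> n \<Longrightarrow> L k \<le> L n" for k n
      using C by (auto simp: L_def intro!: mult_right_mono power_increasing)
    let ?f = "\<lambda>W k. pr (pairs (cube 0 (L k))) (\<lambda>S. \<not> has_big W (cube 0 (L k)) (m k) S)"
    have X: "exp (- (\<beta> * (m k)\<^sup>2 / 4 * (real CARD('d) * (C * L k)) powr (- s)) / q) \<le> (1 / 2) ^ k / (16 * K\<^sup>2)" for k
    proof -
      define y where "y = \<beta> * (m k)\<^sup>2 / 4 * (real CARD('d) * (C * L k)) powr (- s) / q"
      have Lp: "(real CARD('d) * (C * L k)) powr (- s) = H * (real C powr (- s)) ^ k * real N powr (- s)"
      proof -
        have "real CARD('d) * real (C * L k) = (real CARD('d) * real C) * real C ^ k * real N"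
          by (simp add: L_def)
        then show ?thesis using C N by (simp add: powr_mult H_def powr_power mult.commute powr_realpow[symmetric] powr_powr)
      qed
      have m2: "(m k)\<^sup>2 = \<rho>\<^sup>2 * real N powr s * (G\<^sup>2) ^ k"
      proof -
        have "(real N powr (s / 2))\<^sup>2 = real N powr s"
          using N by (simp add: power2_eq_square powr_add[symmetric])
        then show ?thesis by (simp add: m_def power_mult_distrib power_mult[symmetric] mult.commute)
      qed
      have G4: "4 \<le> G\<^sup>2 * real C powr (- s)"
      proof -
        have "(2 * real C powr (s / 2))\<^sup>2 \<le> G\<^sup>2" using C by (intro power_mono) (auto simp: G_def)
        then have "4 * real C powr s \<le> G\<^sup>2"
          using C by (simp add: power_mult_distrib) (simp add: power2_eq_square powr_add[symmetric])
        then have "4 * real C powr s * real C powr (- s) \<le> G\<^sup>2 * real C powr (- s)"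
          by (intro mult_right_mono) auto
        then show ?thesis using C by (simp add: mult.assoc powr_add[symmetric])
      qed
      have "real N powr s * real N powr (- s) = 1" using N by (simp add: powr_add[symmetric])
      then have yeq: "y = \<beta> * \<rho>\<^sup>2 * H / (4 * q) * (G\<^sup>2 * real C powr (- s)) ^ k"
        unfolding y_def m2 Lp by (simp add: power_mult_distrib field_simps)
      have "16 * K\<^sup>2 * 2 ^ k \<le> \<beta> * \<rho>\<^sup>2 * H / (4 * q) * (G\<^sup>2 * real C powr (- s)) ^ k"
      proof (rule mult_mono)
        have "b0 * \<rho>\<^sup>2 * H / (4 * q) \<le> \<beta> * \<rho>\<^sup>2 * H / (4 * q)"
          using \<beta> H q_ge_1 by (intro divide_right_mono mult_right_mono) auto
        then show "16 * K\<^sup>2 \<le> \<beta> * \<rho>\<^sup>2 * H / (4 * q)" using Y by linarith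
        then show "0 \<le> \<beta> * \<rho>\<^sup>2 * H / (4 * q)" by (smt (verit) zero_le_power2)
        show "2 ^ k \<le> (G\<^sup>2 * real C powr (- s)) ^ k" using G4 by (intro power_mono) auto
      qed auto
      then have yge: "16 * K\<^sup>2 * 2 ^ k \<le> y" by (simp add: yeq)
      have y0: "0 < 16 * K\<^sup>2 * 2 ^ k" using K1 by simp
      have "exp (- y) = 1 / exp y" by (simp add: exp_minus field_simps)
      also have "\<dots> \<le> 1 / (16 * K\<^sup>2 * 2 ^ k)"
      proof (rule divide_left_mono)
        show "16 * K\<^sup>2 * 2 ^ k \<le> exp y" using yge exp_ge_add_one_self[of y] by linarith
      qed (use y0 in auto)
      also have "\<dots> = (1 / 2) ^ k / (16 * K\<^sup>2)" by (simp add: power_one_over field_simps)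
      finally show ?thesis by (simp add: y_def)
    qed
    have step: "?f (cube 0 (L (Suc k))) (Suc k) \<le> \<eta> * (1 / 2) ^ Suc k \<and>
        (\<forall>W \<subseteq> cube 0 (L k). ?f W (Suc k) \<le> ?f W k + \<eta> * (1 / 2) ^ Suc k)"
      if IH: "?f (cube 0 (L k)) k \<le> \<eta> * (1 / 2) ^ k" for k
    proof -
      let ?G = "\<lambda>W S. \<not> has_big (cube 0 (C * L k)) (cube 0 (C * L k)) (real (C ^ CARD('d) - 1) * m k) S \<or>
         has_big W (cube 0 (L k)) (m k) S \<and> \<not> has_big W (cube 0 (C * L k)) (real (C ^ CARD('d) - 1) * m k) S"
      let ?E = "pairs (cube (0 :: int ^ 'd) (L (Suc k)))"
      have bound: "pr ?E (?G W) \<le> \<eta> * (1 / 2) ^ Suc k" if W: "W \<subseteq> cube 0 (L k)" for W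
      proof -
        have "pr ?E (?G W) \<le> real (C ^ CARD('d)) ^ 2 * ((\<eta> * (1 / 2) ^ k)\<^sup>2 +
            exp (- (\<beta> * (m k)\<^sup>2 / 4 * (real CARD('d) * (C * L k)) powr (- s)) / q))"
          unfolding L_Suc
        proof (rule renormalization_step)
          show "2 * real ((2 * R) ^ CARD('d)) \<le> m k" using m_\<kappa> by (simp add: \<kappa>_def)
          show "1 - \<eta> * (1 / 2) ^ k \<le> pr (pairs (cube 0 (L k))) (has_big (cube 0 (L k)) (cube 0 (L k)) (m k))"
            using IH by (subst (asm) pr_not) auto
        qed (use C L1 W in auto)
        also have "\<dots> \<le> K * ((\<eta> * (1 / 2) ^ k)\<^sup>2 + (1 / 2) ^ k / (16 * K\<^sup>2))"
          unfolding K_def using X[of k] K1 by (intro mult_left_mono add_left_mono) (auto simp: K_def)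
        also have "\<dots> = \<eta> * (1 / 2) ^ k * ((1 / 2) ^ k / 4) + \<eta> * (1 / 2) ^ k / 4"
          using K1 by (simp add: \<eta>_def field_simps power2_eq_square)
        also have "\<dots> \<le> \<eta> * (1 / 2) ^ k * (1 / 4) + \<eta> * (1 / 2) ^ k / 4"
          using \<eta> by (intro add_mono mult_left_mono) (auto simp: power_le_one)
        finally show ?thesis by simp
      qed
      have GG: "real (C ^ CARD('d) - 1) * m k = m (Suc k)" by (simp add: m_Suc G_def)
      \<comment> \<open>With \<open>W\<close> empty the second alternative of the event is
        void.\<close>
      have "?f (cube 0 (L (Suc k))) (Suc k) \<le> pr ?E (?G {})"
        unfolding L_Suc GG by (rule pr_mono) auto
      moreover have "?f W (Suc k) \<le> ?f W k + \<eta> * (1 / 2) ^ Suc k" if W: "W \<subseteq> cube 0 (L k)" for W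
      proof -
        have "?f W (Suc k) \<le> pr ?E (\<lambda>S. ?G W S \<or> \<not> has_big W (cube 0 (L k)) (m k) S)"
          unfolding L_Suc GG by (rule pr_mono) auto
        also have "\<dots> \<le> pr ?E (?G W) + pr ?E (\<lambda>S. \<not> has_big W (cube 0 (L k)) (m k) S)"
          by (rule pr_disj) simp
        also have "pr ?E (\<lambda>S. \<not> has_big W (cube 0 (L k)) (m k) S) \<le> ?f W k"
        proof -
          have "pr (pairs (cube 0 (L k))) (has_big W (cube 0 (L k)) (m k)) \<le> pr ?E (has_big W (cube 0 (L k)) (m k))"
          proof (rule pr_increasing)
            show "pairs (cube (0 :: int ^ 'd) (L k)) \<subseteq> ?E" by (intro pairs_mono cube_mono L_mono) simp
          qed (auto intro: has_big_mono)
          then show ?thesis by (simp add: pr_not)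
        qed
        finally show ?thesis using bound[OF W] by simp
      qed
      ultimately show ?thesis using bound[of "{}"] by fastforce
    qed
    have f0: "?f (cube 0 (L k)) k \<le> \<eta> * (1 / 2) ^ k" for k
    proof (induct k)
      case 0
      show ?case using base by (simp add: pr_not L_def m_def)
    next
      case (Suc k)
      then show ?case using step by blast
    qed
    \<comment> \<open>Sum of the errors: \<eta> 2^(-k) at scale k, and \<eta> 2^(-i) for every later
      scale i up to n.\<close>
    have f: "?f (cube 0 (L k)) n \<le> \<eta> * (2 * (1 / 2) ^ k - (1 / 2) ^ n)" if "k \<le> n" for k n
      using that
    proof (induct n rule: dec_induct)
      case base
      show ?case using f0[of k] by simp
    next
      case (step n)
      have "?f (cube 0 (L k)) (Suc n) \<le> ?f (cube 0 (L k)) n + \<eta> * (1 / 2) ^ Suc n"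
        using \<open>?f (cube 0 (L n)) n \<le> \<eta> * (1 / 2) ^ n \<Longrightarrow> _\<close>[OF f0] cube_mono[OF L_mono[OF step(1)]] by blast
      also have "\<dots> \<le> \<eta> * (2 * (1 / 2) ^ k - (1 / 2) ^ Suc n)"
        using step(3) by (simp add: algebra_simps)
      finally show ?case .
    qed
    have "pr (pairs (cube 0 (L n))) (has_big (cube 0 (L k)) (cube 0 (L n)) (m n)) \<ge> 1 - (1 / 2) ^ k"
      if "k \<le> n" for k n
    proof -
      have "\<eta> * (2 * (1 / 2) ^ k - (1 / 2) ^ n) \<le> \<eta> * (2 * (1 / 2) ^ k)"
        using \<eta> by (intro mult_left_mono) auto
      also have "\<dots> \<le> (1 / 2) * (2 * (1 / 2) ^ k)" using \<eta> by (intro mult_right_mono) auto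
      finally show ?thesis using f[OF that] by (simp add: pr_not)
    qed
    then show ?thesis using m_lim cube_mono L_mono by blast
  qed
  then show ?thesis using \<rho>0 \<eta>(1) by blast
qed

end

section \<open>Merging large clusters\<close>

lemma card_Pow_split:
  assumes "finite C" "a \<in> C" "b \<in> C" "a \<noteq> b"
  shows "4 * card {A \<in> Pow C. a \<in> A \<and> b \<notin> A} = 2 ^ card C"
proof -
  have "{A \<in> Pow C. a \<in> A \<and> b \<notin> A} = insert a ` Pow (C - {a, b})"
  proof (intro set_eqI iffI)
    fix A assume A: "A \<in> {A \<in> Pow C. a \<in> A \<and> b \<notin> A}"
    then have "A = insert a (A - {a})" "A - {a} \<subseteq> C - {a, b}" by auto
    then show "A \<in> insert a ` Pow (C - {a, b})" by blast
  qed (use assms in auto)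
  moreover have "inj_on (insert a) (Pow (C - {a, b}))" by (auto simp: inj_on_def)
  ultimately have "card {A \<in> Pow C. a \<in> A \<and> b \<notin> A} = 2 ^ card (C - {a, b})"
    using assms by (simp add: card_image card_Pow)
  moreover have "card C = Suc (Suc (card (C - {a, b})))"
  proof -
    have "C = insert a (insert b (C - {a, b}))" using assms by auto
    then have "card C = card (insert a (insert b (C - {a, b})))" by simp
    then show ?thesis using assms by simp
  qed
  ultimately show ?thesis by simp
qed

text \<open>A uniformly random set of classes separates a given pair, in a given direction,
  with probability \<open>1 / 4\<close>.\<close>

lemma exists_cut:
  assumes "finite C" "finite Z"
    and Z: "\<And>x y. (x, y) \<in> Z \<Longrightarrow> c x \<in> C \<and> c y \<in> C \<and> c x \<noteq> c y"
  shows "\<exists>A\<subseteq>C. card Z \<le> 4 * card {(x, y) \<in> Z. c x \<in> A \<and> c y \<notin> A}"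
proof (rule ccontr)
  assume neg: "\<not> ?thesis"
  have less: "4 * card {(x, y) \<in> Z. c x \<in> A \<and> c y \<notin> A} < card Z" if "A \<in> Pow C" for A
  proof (rule ccontr)
    assume "\<not> ?thesis"
    then have "card Z \<le> 4 * card {(x, y) \<in> Z. c x \<in> A \<and> c y \<notin> A}" by (rule leI)
    then show False using neg that by blast
  qed
  have "(\<Sum>A\<in>Pow C. 4 * card {(x, y) \<in> Z. c x \<in> A \<and> c y \<notin> A}) < (\<Sum>A\<in>Pow C. card Z)"
    by (rule sum_strict_mono) (use less assms in auto)
  moreover have "(\<Sum>A\<in>Pow C. 4 * card {(x, y) \<in> Z. c x \<in> A \<and> c y \<notin> A}) = (\<Sum>A\<in>Pow C. card Z)"
  proof -
    have "card {(x, y) \<in> Z. c x \<in> A \<and> c y \<notin> A} = (\<Sum>p\<in>Z. of_bool (c (fst p) \<in> A \<and> c (snd p) \<notin> A))" for A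
    proof -
      have "{(x, y) \<in> Z. c x \<in> A \<and> c y \<notin> A} = Z \<inter> {p. c (fst p) \<in> A \<and> c (snd p) \<notin> A}" by auto
      then show ?thesis using assms(2) by (simp add: sum_of_bool_eq)
    qed
    then have "(\<Sum>A\<in>Pow C. 4 * card {(x, y) \<in> Z. c x \<in> A \<and> c y \<notin> A}) =
        (\<Sum>A\<in>Pow C. \<Sum>p\<in>Z. 4 * of_bool (c (fst p) \<in> A \<and> c (snd p) \<notin> A))"
      by (simp add: sum_distrib_left)
    also have "\<dots> = (\<Sum>p\<in>Z. \<Sum>A\<in>Pow C. 4 * of_bool (c (fst p) \<in> A \<and> c (snd p) \<notin> A))"
      by (rule sum.swap)
    also have "\<dots> = (\<Sum>p\<in>Z. 2 ^ card C)"
    proof (rule sum.cong[OF refl])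
      fix p assume "p \<in> Z"
      then have p: "c (fst p) \<in> C" "c (snd p) \<in> C" "c (fst p) \<noteq> c (snd p)"
        using Z[of "fst p" "snd p"] by auto
      have "(\<Sum>A\<in>Pow C. 4 * of_bool (c (fst p) \<in> A \<and> c (snd p) \<notin> A)) =
          4 * card {A \<in> Pow C. c (fst p) \<in> A \<and> c (snd p) \<notin> A}"
        using assms(1) by (simp add: sum_distrib_left[symmetric] sum_of_bool_eq Int_def)
      then show "(\<Sum>A\<in>Pow C. 4 * of_bool (c (fst p) \<in> A \<and> c (snd p) \<notin> A)) = (2 ^ card C :: nat)"
        using card_Pow_split[OF assms(1) p] by simp
    qed
    finally show ?thesis using assms by (simp add: card_Pow)
  qed
  ultimately show False by simp
qed

text \<open>The colourings of exposed clusters vary with the exposed configuration. Numbering them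
  by a fixed range makes the later union bound run over a deterministic set.\<close>

lemma finite_enumeration:
  assumes "finite B" "card B \<le> n"
  shows "\<exists>g. B \<subseteq> g ` {..<n::nat}"
proof -
  obtain h where "bij_betw h {0..<card B} B" using ex_bij_betw_nat_finite[OF assms(1)] by auto
  then have "B = h ` {0..<card B}" by (simp add: bij_betw_def)
  also have "\<dots> \<subseteq> h ` {..<n}" using assms by (intro image_mono) auto
  finally show ?thesis by blast
qed

text \<open>Distinct clusters are disjoint. This bounds the exponent in the number of
  two-colourings.\<close>

lemma card_big_clusters:
  assumes "finite V" "T \<subseteq> pairs V" "K > 0"
  shows "real (card (cl T ` {x \<in> V. K \<le> real (card (cl T x))})) * K \<le> real (card V)"
proof -
  let ?X = "{x \<in> V. K \<le> real (card (cl T x))}"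
  let ?C = "cl T ` ?X"
  have sub: "cl T x \<subseteq> V" if "x \<in> V" for x using assms that by (intro cl_subset_pairs)
  have "real (card ?C) * K \<le> (\<Sum>c\<in>?C. real (card c))" by (rule sum_bounded_below) auto
  also have "\<dots> = real (card (\<Union>?C))"
  proof (subst card_Union_disjoint)
    show "pairwise disjnt ?C"
    proof (rule pairwiseI)
      fix c c' assume c: "c \<in> ?C" "c' \<in> ?C" "c \<noteq> c'"
      then obtain x x' where "c = cl T x" "c' = cl T x'" by auto
      then show "disjnt c c'" unfolding disjnt_def
        using c(3) cl_eq[of _ T x] cl_eq[of _ T x'] by (metis disjoint_iff)
    qed
    show "finite A" if "A \<in> ?C" for A using that sub finite_subset[OF _ assms(1)] by auto
  qed simp
  also have "\<dots> \<le> real (card V)" using assms(1) sub by (intro of_nat_mono card_mono) auto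
  finally show ?thesis .
qed

text \<open>Cauchy-Schwarz over the tiles: an even spread of \<open>Y\<close> is the worst case for
  the number of pairs sharing a tile.\<close>

lemma same_tile_pairs_ge:
  fixes Y :: "(int ^ 'd::finite) set"
  assumes "r \<ge> 1" "Y \<subseteq> cube a (C * r)"
  shows "real (card Y) ^ 2 \<le> real (C ^ CARD('d)) * real (card (\<Union>z\<in>cube 0 C. (Y \<inter> tile a r z) \<times> (Y \<inter> tile a r z)))"
proof -
  let ?I = "cube 0 C :: (int ^ 'd) set"
  have fin: "finite Y" using assms(2) finite_cube finite_subset by blast
  have "Y = (\<Union>z\<in>?I. Y \<inter> tile a r z)"
    using assms UN_tiles[where N = r and C = C and a = a] by auto
  then have "card Y = card (\<Union>z\<in>?I. Y \<inter> tile a r z)" by simp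
  also have "\<dots> = (\<Sum>z\<in>?I. card (Y \<inter> tile a r z))"
  proof (rule card_UN_disjoint)
    show "\<forall>i\<in>?I. \<forall>j\<in>?I. i \<noteq> j \<longrightarrow> Y \<inter> tile a r i \<inter> (Y \<inter> tile a r j) = {}"
      using tile_disjoint[of _ _ a r] by blast
  qed (use fin in auto)
  finally have c: "card Y = (\<Sum>z\<in>?I. card (Y \<inter> tile a r z))" .
  have "real (card Y) ^ 2 = (\<Sum>z\<in>?I. real (card (Y \<inter> tile a r z))) ^ 2" by (simp add: c)
  also have "\<dots> \<le> (\<Sum>z\<in>?I. (real (card (Y \<inter> tile a r z)))\<^sup>2) * real (card ?I)"
    by (rule sum_squared_le_sum_of_squares)
  also have "(\<Sum>z\<in>?I. (real (card (Y \<inter> tile a r z)))\<^sup>2) =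
      real (card (\<Union>z\<in>?I. (Y \<inter> tile a r z) \<times> (Y \<inter> tile a r z)))"
  proof (subst card_UN_disjoint)
    show "\<forall>i\<in>?I. \<forall>j\<in>?I. i \<noteq> j \<longrightarrow> (Y \<inter> tile a r i) \<times> (Y \<inter> tile a r i) \<inter> (Y \<inter> tile a r j) \<times> (Y \<inter> tile a r j) = {}"
      using tile_disjoint[of _ _ a r] by blast
  qed (use fin in \<open>auto simp: card_cartesian_product power2_eq_square\<close>)
  finally show ?thesis by (simp add: mult.commute)
qed

context long_range_beta
begin

text \<open>Few clusters that are large in total admit few two-colourings, whereas a colouring that splits
  the vertices of many tiles costs a factor exponential in the number of bichromatic pairs.\<close>

lemma coloring_stage:
  fixes K \<theta> \<theta>' :: real
  assumes r: "r \<ge> 1" and C: "C \<ge> 1" and \<theta>': "\<theta>' > 0" and K: "K > 0"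
    and F: "F \<subseteq> F'" "F' \<subseteq> pairs (cube 0 (C * r))"
    and nonfresh: "\<And>x z. z \<in> cube 0 C \<Longrightarrow> x \<in> tile 0 r z \<Longrightarrow>
       4 * real (card {y \<in> tile 0 r z. y = x \<or> {x, y} \<in> F}) \<le> \<theta>'\<^sup>2 * real (r ^ CARD('d))"
    and far: "\<And>x y z. z \<in> cube 0 C \<Longrightarrow> x \<in> tile 0 r z \<Longrightarrow> y \<in> tile 0 r z \<Longrightarrow> x \<noteq> y \<Longrightarrow> {x, y} \<notin> F \<Longrightarrow>
       {x, y} \<in> F' \<and> real R \<le> l1_norm (x - y)"
  shows "pr (pairs (cube 0 (C * r))) (\<lambda>S.
      \<theta> * real (card (cube (0 :: int ^ 'd) (C * r))) \<le> real (card {x \<in> cube 0 (C * r). K \<le> real (card (cl (S \<inter> F) x))}) \<and>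
      real (card {x \<in> cube 0 (C * r). \<theta>'\<^sup>2 * real (r ^ CARD('d)) / 4 \<le> real (card (cl (S \<inter> F') x))})
        < (\<theta> - \<theta>') * real (card (cube (0 :: int ^ 'd) (C * r))))
    \<le> exp (real (card (cube (0 :: int ^ 'd) (C * r))) *
        (ln 2 / K - \<beta> / (16 * q) * \<theta>'\<^sup>2 * real (r ^ CARD('d)) * (real CARD('d) * r) powr (- s)))"
proof -
  let ?\<Lambda> = "cube 0 (C * r) :: (int ^ 'd) set"
  let ?E = "pairs ?\<Lambda>"
  let ?I = "cube 0 C :: (int ^ 'd) set"
  let ?V = "real (card ?\<Lambda>)"
  let ?K' = "\<theta>'\<^sup>2 * real (r ^ CARD('d)) / 4"
  let ?T = "tile (0 :: int ^ 'd) r"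
  \<comment> \<open>\<open>U\<close> is the set of open edges of the exposed part \<open>F\<close>,
    and \<open>X U\<close> the vertices of its large clusters. \<open>Q U \<A>\<close> consists of
    the unexposed edges within a tile that lead from vertices coloured by \<A> to the other vertices
    of \<open>X U\<close>.\<close>
  define X where "X U = {x \<in> ?\<Lambda>. K \<le> real (card (cl U x))}" for U
  define Q where "Q U \<A> = {e. \<exists>x y z. e = {x, y} \<and> z \<in> ?I \<and> x \<in> ?T z \<and> y \<in> ?T z \<and>
      x \<in> \<Union>\<A> \<and> y \<in> X U \<and> y \<notin> \<Union>\<A> \<and> {x, y} \<notin> F}" for U and \<A> :: "(int ^ 'd) set set"
  \<comment> \<open>The factor 1/16 is 1/2 for the pairs kept in \<open>Z\<close>, times 1/4 for the
    best cut, times 1/2 from \<open>P_lower\<close>.\<close>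
  define c where "c = ?V * (\<beta> / 16 * \<theta>'\<^sup>2 * real (r ^ CARD('d)) * (real CARD('d) * r) powr (- s))"
  define n where "n = nat \<lfloor>?V / K\<rfloor>"
  have V0: "?V > 0" using r C by simp
  have fF: "finite F" "finite F'" "F \<subseteq> ?E" using F finite_subset[of _ ?E] by auto
  have "\<exists>g. Pow (cl U ` X U) \<subseteq> g ` {..<2 ^ n :: nat}" if U: "U \<subseteq> F" for U
  proof (rule finite_enumeration)
    have "real (card (cl U ` X U)) * K \<le> ?V"
      unfolding X_def using U fF K by (intro card_big_clusters) auto
    then have "real (card (cl U ` X U)) \<le> ?V / K" using K by (simp add: pos_le_divide_eq)
    then have "card (cl U ` X U) \<le> n" unfolding n_def by linarith
    then show "card (Pow (cl U ` X U)) \<le> 2 ^ n"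
      using U by (subst card_Pow) (auto simp: X_def)
  qed (simp add: X_def)
  then obtain g where g: "Pow (cl U ` X U) \<subseteq> g U ` {..<2 ^ n :: nat}" if "U \<subseteq> F" for U by metis
  let ?A = "\<lambda>i U. c \<le> (\<Sum>e\<in>Q U (g U i). \<beta> * coupling P e) \<and> g U i \<subseteq> cl U ` X U"
  let ?bad = "\<lambda>S. \<theta> * ?V \<le> real (card {x \<in> ?\<Lambda>. K \<le> real (card (cl (S \<inter> F) x))}) \<and>
      real (card {x \<in> ?\<Lambda>. ?K' \<le> real (card (cl (S \<inter> F') x))}) < (\<theta> - \<theta>') * ?V"
  have Q_sub: "Q U \<A> \<subseteq> ?E - F" for U \<A>
  proof
    fix e assume "e \<in> Q U \<A>"
    then obtain x y z where xy: "e = {x, y}" "z \<in> ?I" "x \<in> ?T z" "y \<in> ?T z" "x \<in> \<Union>\<A>" "y \<notin> \<Union>\<A>" "{x, y} \<notin> F"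
      by (auto simp: Q_def)
    then have "x \<in> ?\<Lambda>" "y \<in> ?\<Lambda>" "x \<noteq> y" using tile_subset[OF xy(2)] by auto
    then show "e \<in> ?E - F" using xy by (auto intro: pairsI)
  qed
  have det: "\<exists>i\<in>{..<2 ^ n}. ?A i (S \<inter> F) \<and> S \<inter> Q (S \<inter> F) (g (S \<inter> F) i) = {}"
    if S: "S \<subseteq> ?E" and bad: "?bad S" for S
  proof -
    define U where "U = S \<inter> F"
    define S' where "S' = S \<inter> F'"
    have US': "U \<subseteq> S'" "U \<subseteq> ?E" "S' \<subseteq> ?E" "U \<subseteq> F" using F by (auto simp: U_def S'_def)
    have sub': "cl S' x \<subseteq> ?\<Lambda>" if "x \<in> ?\<Lambda>" for x using US' that by (intro cl_subset_pairs)
    \<comment> \<open>Vertices of large exposed clusters that remain in small clusters when the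
      edges of \<open>F'\<close> are added. The bad event forces them to make up more than a
      fraction \<theta>' of the cube.\<close>
    define Y where "Y = {x \<in> X U. real (card (cl S' x)) < ?K'}"
    have Y_sub: "Y \<subseteq> ?\<Lambda>" by (auto simp: Y_def X_def)
    have fY: "finite Y" using Y_sub by (rule finite_subset) simp
    have "real (card (X U)) \<le> real (card Y) + real (card {x \<in> ?\<Lambda>. ?K' \<le> real (card (cl S' x))})"
    proof -
      have "card (X U) \<le> card (Y \<union> {x \<in> ?\<Lambda>. ?K' \<le> real (card (cl S' x))})"
        using fY by (intro card_mono) (auto simp: Y_def X_def)
      also have "\<dots> \<le> card Y + card {x \<in> ?\<Lambda>. ?K' \<le> real (card (cl S' x))}" by (rule card_Un_le)
      finally show ?thesis by linarith
    qed
    then have cY: "\<theta>' * ?V < real (card Y)"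
      using bad by (simp add: X_def U_def S'_def algebra_simps)
    \<comment> \<open>\<open>Z0\<close> has at least \<theta>'^2 r^d times the volume many elements.
      At most a quarter of this number are diagonal or exposed, by \<open>nonfresh\<close>, and at
      most a quarter lie in a common cluster of \<open>S'\<close>, since clusters of vertices of
      \<open>Y\<close> have fewer than \<open>?K'\<close> vertices. Half of it therefore remains in
      \<open>Z\<close>.\<close>
    define Z0 where "Z0 = (\<Union>z\<in>?I. (Y \<inter> ?T z) \<times> (Y \<inter> ?T z))"
    define Z where "Z = {(x, y) \<in> Z0. y \<noteq> x \<and> {x, y} \<notin> F \<and> y \<notin> cl S' x}"
    have Z0_sub: "Z0 \<subseteq> Y \<times> Y" by (auto simp: Z0_def)
    have fZ0: "finite Z0" using Z0_sub by (rule finite_subset) (use fY in simp)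
    have fZ: "finite Z" using fZ0 by (rule finite_subset[rotated]) (auto simp: Z_def)
    have Veq: "?V = real (C ^ CARD('d)) * real (r ^ CARD('d))" by (simp add: power_mult_distrib)
    have cZ0: "\<theta>'\<^sup>2 * real (r ^ CARD('d)) * ?V \<le> real (card Z0)"
    proof -
      have "(\<theta>' * ?V)\<^sup>2 \<le> (real (card Y))\<^sup>2" using cY \<theta>' by (intro power_mono) auto
      also have "\<dots> \<le> real (C ^ CARD('d)) * real (card Z0)"
        unfolding Z0_def using r Y_sub by (rule same_tile_pairs_ge)
      finally have "real (C ^ CARD('d)) * (\<theta>'\<^sup>2 * real (r ^ CARD('d)) * ?V) \<le> real (C ^ CARD('d)) * real (card Z0)"
        unfolding Veq power2_eq_square by (simp only: mult_ac)
      then show ?thesis using C by (simp add: mult_le_cancel_left)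
    qed
    have c1: "real (card {(x, y) \<in> Z0. y = x \<or> {x, y} \<in> F}) \<le> ?V * ?K'"
    proof -
      let ?N = "\<lambda>x. {y. \<exists>z\<in>?I. x \<in> ?T z \<and> y \<in> ?T z \<and> (y = x \<or> {x, y} \<in> F)}"
      have N: "finite (?N x) \<and> real (card (?N x)) \<le> ?K'" for x
      proof (cases "\<exists>z\<in>?I. x \<in> ?T z")
        case True
        then obtain z where z: "z \<in> ?I" "x \<in> ?T z" by (elim bexE)
        have uniq: "z' = z" if "x \<in> ?T z'" for z'
          using z(2) that tile_disjoint[of z z' 0 r] by blast
        have "?N x = {y \<in> ?T z. y = x \<or> {x, y} \<in> F}"
        proof (intro set_eqI iffI)
          fix y assume "y \<in> ?N x"
          then obtain z' where z': "x \<in> ?T z'" "y \<in> ?T z'" "y = x \<or> {x, y} \<in> F" by blast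
          then show "y \<in> {y \<in> ?T z. y = x \<or> {x, y} \<in> F}" using uniq[OF z'(1)] by simp
        next
          fix y assume "y \<in> {y \<in> ?T z. y = x \<or> {x, y} \<in> F}"
          then show "y \<in> ?N x" using z by blast
        qed
        then show ?thesis using nonfresh[OF z] by auto
      next
        case False
        then have "?N x = {}" by blast
        then show ?thesis unfolding \<open>?N x = {}\<close> by simp
      qed
      have "card {(x, y) \<in> Z0. y = x \<or> {x, y} \<in> F} \<le> card (SIGMA x:?\<Lambda>. ?N x)"
        using Y_sub N by (intro card_mono finite_SigmaI) (auto simp: Z0_def)
      also have "\<dots> = (\<Sum>x\<in>?\<Lambda>. card (?N x))" using N by (intro card_SigmaI) auto
      finally have "real (card {(x, y) \<in> Z0. y = x \<or> {x, y} \<in> F}) \<le> (\<Sum>x\<in>?\<Lambda>. real (card (?N x)))"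
        unfolding of_nat_sum[symmetric] of_nat_le_iff .
      also have "\<dots> \<le> (\<Sum>x\<in>?\<Lambda>. ?K')" by (intro sum_mono) (use N in auto)
      finally show ?thesis by simp
    qed
    have c2: "real (card {(x, y) \<in> Z0. y \<in> cl S' x}) \<le> ?V * ?K'"
    proof -
      have "card {(x, y) \<in> Z0. y \<in> cl S' x} \<le> card (SIGMA x:Y. cl S' x)"
        using fY Y_sub sub' finite_subset[OF sub'] Z0_sub by (intro card_mono finite_SigmaI) auto
      also have "\<dots> = (\<Sum>x\<in>Y. card (cl S' x))"
        using fY Y_sub finite_subset[OF sub'] by (intro card_SigmaI) auto
      finally have "real (card {(x, y) \<in> Z0. y \<in> cl S' x}) \<le> (\<Sum>x\<in>Y. real (card (cl S' x)))"
        unfolding of_nat_sum[symmetric] of_nat_le_iff .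
      also have "\<dots> \<le> (\<Sum>x\<in>Y. ?K')" by (intro sum_mono) (auto simp: Y_def)
      also have "\<dots> = real (card Y) * ?K'" by simp
      also have "\<dots> \<le> ?V * ?K'" using Y_sub by (intro mult_right_mono of_nat_mono card_mono) auto
      finally show ?thesis .
    qed
    have cZ: "\<theta>'\<^sup>2 * real (r ^ CARD('d)) * ?V / 2 \<le> real (card Z)"
    proof -
      have "card Z0 \<le> card (Z \<union> ({(x, y) \<in> Z0. y = x \<or> {x, y} \<in> F} \<union> {(x, y) \<in> Z0. y \<in> cl S' x}))"
        using fZ0 fZ by (intro card_mono) (auto simp: Z_def intro: finite_subset[OF _ fZ0])
      also have "\<dots> \<le> card Z + (card {(x, y) \<in> Z0. y = x \<or> {x, y} \<in> F} + card {(x, y) \<in> Z0. y \<in> cl S' x})"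
        by (intro order_trans[OF card_Un_le] add_left_mono card_Un_le)
      finally have "real (card Z0) \<le> real (card Z) + (real (card {(x, y) \<in> Z0. y = x \<or> {x, y} \<in> F}) + real (card {(x, y) \<in> Z0. y \<in> cl S' x}))"
        by linarith
      then show ?thesis using cZ0 c1 c2 by (simp add: algebra_simps)
    qed
    have "\<exists>A\<subseteq>cl S' ` ?\<Lambda>. card Z \<le> 4 * card {(x, y) \<in> Z. cl S' x \<in> A \<and> cl S' y \<notin> A}"
    proof (rule exists_cut)
      fix x y assume "(x, y) \<in> Z"
      then show "cl S' x \<in> cl S' ` ?\<Lambda> \<and> cl S' y \<in> cl S' ` ?\<Lambda> \<and> cl S' x \<noteq> cl S' y"
        using Y_sub Z0_sub by (auto simp: Z_def)
    qed (use fZ in auto)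
    then obtain A where A: "card Z \<le> 4 * card {(x, y) \<in> Z. cl S' x \<in> A \<and> cl S' y \<notin> A}" by auto
    \<comment> \<open>The cut colours clusters of \<open>S'\<close>. Each exposed cluster lies
      inside one of them and inherits its colour, so the cut is among the few colourings of the
      large exposed clusters.\<close>
    define \<A> where "\<A> = cl U ` {x \<in> X U. cl S' x \<in> A}"
    have UA: "\<Union>\<A> = {x \<in> X U. cl S' x \<in> A}"
    proof (intro set_eqI iffI)
      fix y assume "y \<in> \<Union>\<A>"
      then obtain x where x: "x \<in> X U" "cl S' x \<in> A" "y \<in> cl U x" by (auto simp: \<A>_def)
      have "y \<in> ?\<Lambda>" using x US'(2) cl_subset_pairs[of U ?\<Lambda> x] by (auto simp: X_def)
      moreover have "cl U y = cl U x" using x by (intro cl_eq)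
      moreover have "cl S' y = cl S' x" using x cl_mono[OF US'(1)] by (intro cl_eq) auto
      ultimately show "y \<in> {x \<in> X U. cl S' x \<in> A}" using x by (auto simp: X_def)
    qed (auto simp: \<A>_def)
    have \<A>_sub: "\<A> \<subseteq> cl U ` X U" by (auto simp: \<A>_def)
    then obtain i where i: "i < 2 ^ n" "\<A> = g U i" using g[OF US'(4)] by blast
    \<comment> \<open>An open edge of \<open>Q U \<A>\<close> would belong to \<open>F'\<close>, put
      its two ends into one cluster of \<open>S'\<close> and so give them the same colour.\<close>
    have closed: "S \<inter> Q U \<A> = {}"
    proof (rule ccontr)
      assume "S \<inter> Q U \<A> \<noteq> {}"
      then obtain x y z where xy: "{x, y} \<in> S" "z \<in> ?I" "x \<in> ?T z" "y \<in> ?T z" "x \<in> \<Union>\<A>" "y \<in> X U" "y \<notin> \<Union>\<A>" "{x, y} \<notin> F"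
        by (auto simp: Q_def)
      then have "{x, y} \<in> F'" using far[OF xy(2,3,4)] by auto
      then have "y \<in> cl S' x" using xy by (intro cl_edge) (simp add: S'_def)
      then have "cl S' y = cl S' x" by (rule cl_eq)
      then show False using xy UA by auto
    qed
    have "c \<le> (\<Sum>e\<in>Q U \<A>. \<beta> * coupling P e)"
    proof -
      let ?Z = "{(x, y) \<in> Z. cl S' x \<in> A \<and> cl S' y \<notin> A}"
      let ?p = "(real CARD('d) * r) powr (- s)"
      have sub: "(\<lambda>(x, y). {x, y}) ` ?Z \<subseteq> Q U \<A>"
      proof
        fix e assume "e \<in> (\<lambda>(x, y). {x, y}) ` ?Z"
        then obtain x y where e: "e = {x, y}" "(x, y) \<in> Z" "cl S' x \<in> A" "cl S' y \<notin> A" by auto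
        then have "x \<in> Y" "y \<in> Y" using Z0_sub by (auto simp: Z_def)
        then have "x \<in> \<Union>\<A>" "y \<in> X U" "y \<notin> \<Union>\<A>" using e by (auto simp: UA Y_def)
        moreover obtain z where "z \<in> ?I" "x \<in> ?T z" "y \<in> ?T z" using e by (auto simp: Z_def Z0_def)
        moreover have "{x, y} \<notin> F" using e by (auto simp: Z_def)
        ultimately show "e \<in> Q U \<A>" unfolding Q_def using e(1) by blast
      qed
      \<comment> \<open>The cut orients the pairs: only the first entry has its cluster in
        \<open>A\<close>.\<close>
      have inj: "inj_on (\<lambda>(x, y). {x, y}) ?Z"
        by (rule inj_onI) (auto simp: doubleton_eq_iff)
      have fQ: "finite (Q U \<A>)" using Q_sub[of U \<A>] finite_subset by (metis finite_Diff finite_cube finite_pairs)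
      have "real (card Z) \<le> 4 * real (card ?Z)" using A by linarith
      also have "card ?Z \<le> card (Q U \<A>)"
        using card_mono[OF fQ sub] card_image[OF inj] by simp
      finally have cQ: "\<theta>'\<^sup>2 * real (r ^ CARD('d)) * ?V / 8 \<le> real (card (Q U \<A>))" using cZ by simp
      have "c = \<theta>'\<^sup>2 * real (r ^ CARD('d)) * ?V / 8 * (\<beta> * (?p / 2))"
        by (simp add: c_def algebra_simps)
      also have "\<dots> \<le> real (card (Q U \<A>)) * (\<beta> * (?p / 2))"
        using cQ beta_nonneg by (intro mult_right_mono) auto
      also have "\<dots> = (\<Sum>e\<in>Q U \<A>. \<beta> * (?p / 2))" by simp
      also have "\<dots> \<le> (\<Sum>e\<in>Q U \<A>. \<beta> * coupling P e)"
      proof (intro sum_mono mult_left_mono beta_nonneg)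
        fix e assume "e \<in> Q U \<A>"
        then obtain x y z where xy: "e = {x, y}" "z \<in> ?I" "x \<in> ?T z" "y \<in> ?T z" "x \<in> \<Union>\<A>" "y \<notin> \<Union>\<A>" "{x, y} \<notin> F"
          by (auto simp: Q_def)
        then have ne: "x \<noteq> y" by auto
        then have l: "real R \<le> l1_norm (x - y)" using far[OF xy(2,3,4)] xy(7) by auto
        have "l1_norm (x - y) \<le> real CARD('d) * r"
          using xy(3,4) unfolding tile_def by (rule l1_norm_cube)
        then have "?p \<le> l1_norm (x - y) powr (- s)"
          using l R_pos s_pos by (intro powr_mono2') auto
        then show "?p / 2 \<le> coupling P e" using P_lower[OF l] coupling_eq[OF ne] xy(1) by simp
      qed
      finally show ?thesis .
    qed
    then show ?thesis using i closed \<A>_sub unfolding U_def by (intro bexI[of _ i]) auto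
  qed
  have "pr ?E ?bad \<le> pr ?E (\<lambda>S. \<exists>i\<in>{..<2 ^ n}. ?A i (S \<inter> F) \<and> S \<inter> Q (S \<inter> F) (g (S \<inter> F) i) = {})"
    by (rule pr_mono[OF _ det]) auto
  also have "\<dots> \<le> (\<Sum>i\<in>{..<2 ^ n}. pr ?E (\<lambda>S. ?A i (S \<inter> F) \<and> S \<inter> Q (S \<inter> F) (g (S \<inter> F) i) = {}))"
    by (rule pr_bex) auto
  also have "\<dots> \<le> (\<Sum>i\<in>{..<2 ^ n :: nat}. exp (- c / q))"
  proof (rule sum_mono)
    fix i :: nat
    have "pr ?E (\<lambda>S. ?A i (S \<inter> F) \<and> S \<inter> Q (S \<inter> F) (g (S \<inter> F) i) = {}) \<le> exp (- c / q) * pr ?E (\<lambda>S. ?A i (S \<inter> F))"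
      by (rule pr_closed_le) (use fF Q_sub in auto)
    also have "\<dots> \<le> exp (- c / q) * 1" by (intro mult_left_mono pr_le_1) auto
    finally show "pr ?E (\<lambda>S. ?A i (S \<inter> F) \<and> S \<inter> Q (S \<inter> F) (g (S \<inter> F) i) = {}) \<le> exp (- c / q)" by simp
  qed
  also have "\<dots> = 2 ^ n * exp (- c / q)" by simp
  also have "\<dots> \<le> exp (?V / K * ln 2) * exp (- c / q)"
  proof (rule mult_right_mono)
    have "real n \<le> ?V / K" using V0 K by (simp add: n_def)
    then have "real n * ln 2 \<le> ?V / K * ln 2" by (intro mult_right_mono) auto
    moreover have "(2::real) ^ n = exp (real n * ln 2)" by (simp add: exp_of_nat_mult)
    ultimately show "2 ^ n \<le> exp (?V / K * ln 2)" by simp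
  qed simp
  also have "\<dots> = exp (?V * (ln 2 / K - \<beta> / (16 * q) * \<theta>'\<^sup>2 * real (r ^ CARD('d)) * (real CARD('d) * r) powr (- s)))"
    unfolding exp_add[symmetric] c_def by (simp add: field_simps)
  finally show ?thesis .
qed

end

section \<open>Clusters made of short edges and the density of their vertices\<close>

definition short :: "nat \<Rightarrow> (int ^ 'd::finite) set set" where
  "short r = {{u, v} |u v. l1_norm (u - v) < real r}"

lemma short_iff: "{u, v} \<in> short r \<longleftrightarrow> l1_norm (u - v) < real r"
  by (auto simp: short_def doubleton_eq_iff l1_norm_minus)

context long_range
begin

text \<open>Dyadic shells around \<open>x\<close>: the shell from 2^n r to 2^(n+1) r has at most (4
  2^n r)^d points with coupling at most 2 (2^n r)^(-s) each. The bounds form a geometric series of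
  ratio \<open>g\<close>, which is below 1 because s > d.\<close>

lemma tail_sum:
  "\<exists>c>0. \<forall>r\<ge>R. \<forall>x W. finite W \<longrightarrow> (\<forall>y\<in>W. real r \<le> l1_norm (x - y)) \<longrightarrow>
     (\<Sum>y\<in>W. P (x - y)) \<le> c * real r powr (real CARD('d) - s)"
proof -
  define g where "g = 2 powr (real CARD('d) - s)"
  define c where "c = 2 * 4 ^ CARD('d) / (1 - g)"
  have "g < 2 powr 0" unfolding g_def using dim_less by (intro powr_less_mono) auto
  then have g: "0 < g" "g < 1" by (auto simp: g_def)
  have c0: "c > 0" using g by (simp add: c_def)
  have main: "(\<Sum>y\<in>W. P (x - y)) \<le> c * real r powr (real CARD('d) - s)"
    if r: "r \<ge> R" and W: "finite W" "\<forall>y\<in>W. real r \<le> l1_norm (x - y)" for r x W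
  proof -
    have r0: "real r > 0" using r R_pos by simp
    have shells: "(\<Sum>y\<in>{y \<in> W. l1_norm (x - y) < 2 ^ n * real r}. P (x - y)) \<le>
        2 * 4 ^ CARD('d) * real r powr (real CARD('d) - s) * (\<Sum>i<n. g ^ i)" for n
    proof (induct n)
      case 0
      have e: "{y \<in> W. l1_norm (x - y) < 2 ^ 0 * real r} = {}" using W(2) by auto
      show ?case unfolding e by simp
    next
      case (Suc n)
      let ?A = "{y \<in> W. l1_norm (x - y) < 2 ^ n * real r}"
      let ?B = "{y \<in> W. 2 ^ n * real r \<le> l1_norm (x - y) \<and> l1_norm (x - y) < 2 ^ Suc n * real r}"
      have "2 ^ n * real r \<le> 2 ^ Suc n * real r" using r0 by (intro mult_right_mono) auto
      then have split: "{y \<in> W. l1_norm (x - y) < 2 ^ Suc n * real r} = ?A \<union> ?B"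
        using order_less_le_trans by (auto simp del: power_Suc simp: not_less)
      have "?B \<subseteq> {y. l1_norm (y - x) < real (2 ^ Suc n * r)}"
        using l1_norm_minus[of x] by auto
      then have "card ?B \<le> card {y. l1_norm (y - x) < real (2 ^ Suc n * r)}"
        by (intro card_mono card_l1_ball)
      also have "\<dots> \<le> (2 * (2 ^ Suc n * r)) ^ CARD('d)" by (rule card_l1_ball)
      finally have "real (card ?B) \<le> real ((2 * (2 ^ Suc n * r)) ^ CARD('d))" unfolding of_nat_le_iff .
      also have "\<dots> = (4 * (2 ^ n * real r)) ^ CARD('d)" by (simp add: mult_ac)
      also have "\<dots> = 4 ^ CARD('d) * (2 ^ n * real r) powr real CARD('d)"
        using r0 by (subst powr_realpow) (auto simp: power_mult_distrib)
      finally have cB: "real (card ?B) \<le> 4 ^ CARD('d) * (2 ^ n * real r) powr real CARD('d)" .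
      have "(\<Sum>y\<in>?B. P (x - y)) \<le> (\<Sum>y\<in>?B. 2 * (2 ^ n * real r) powr (- s))"
      proof (rule sum_mono)
        fix y assume y: "y \<in> ?B"
        have "real R \<le> real r" using r by simp
        also have "\<dots> \<le> l1_norm (x - y)" using W(2) y by auto
        finally have "P (x - y) \<le> 2 * l1_norm (x - y) powr (- s)" by (rule P_upper)
        also have "l1_norm (x - y) powr (- s) \<le> (2 ^ n * real r) powr (- s)"
          using y r0 s_pos by (intro powr_mono2') auto
        finally show "P (x - y) \<le> 2 * (2 ^ n * real r) powr (- s)" by simp
      qed
      also have "\<dots> = real (card ?B) * (2 * (2 ^ n * real r) powr (- s))" by simp
      also have "\<dots> \<le> (4 ^ CARD('d) * (2 ^ n * real r) powr real CARD('d)) * (2 * (2 ^ n * real r) powr (- s))"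
        using cB by (intro mult_right_mono) auto
      also have "\<dots> = 2 * 4 ^ CARD('d) * (2 ^ n * real r) powr (real CARD('d) - s)"
        by (simp add: powr_diff powr_minus_divide)
      also have "(2 ^ n * real r) powr (real CARD('d) - s) = g ^ n * real r powr (real CARD('d) - s)"
        using r0 by (simp add: powr_mult g_def powr_power powr_realpow[symmetric] powr_powr mult.commute)
      finally have B: "(\<Sum>y\<in>?B. P (x - y)) \<le> 2 * 4 ^ CARD('d) * (g ^ n * real r powr (real CARD('d) - s))" .
      have "(\<Sum>y\<in>?A \<union> ?B. P (x - y)) = (\<Sum>y\<in>?A. P (x - y)) + (\<Sum>y\<in>?B. P (x - y))"
        using W by (intro sum.union_disjoint) auto
      then show ?case unfolding split using Suc B by (simp add: algebra_simps)
    qed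
    obtain n where n: "Max (insert 0 ((\<lambda>y. l1_norm (x - y)) ` W)) < 2 ^ n"
      using real_arch_pow[of 2] by auto
    have "l1_norm (x - y) < 2 ^ n * real r" if "y \<in> W" for y
    proof -
      have "l1_norm (x - y) \<le> Max (insert 0 ((\<lambda>y. l1_norm (x - y)) ` W))"
        using W(1) that by (intro Max_ge) auto
      also have "\<dots> < 2 ^ n" by (rule n)
      also have "\<dots> \<le> 2 ^ n * real r" using r R_pos by simp
      finally show ?thesis .
    qed
    then have "{y \<in> W. l1_norm (x - y) < 2 ^ n * real r} = W" by auto
    then have "(\<Sum>y\<in>W. P (x - y)) \<le> 2 * 4 ^ CARD('d) * real r powr (real CARD('d) - s) * (\<Sum>i<n. g ^ i)"
      using shells[of n] by simp
    also have "\<dots> \<le> 2 * 4 ^ CARD('d) * real r powr (real CARD('d) - s) * (1 / (1 - g))"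
    proof (rule mult_left_mono)
      have "(\<Sum>i<n. g ^ i) = (1 - g ^ n) / (1 - g)" using g by (simp add: sum_gp_strict)
      also have "\<dots> \<le> 1 / (1 - g)" using g by (intro divide_right_mono) auto
      finally show "(\<Sum>i<n. g ^ i) \<le> 1 / (1 - g)" .
    qed simp
    finally show ?thesis by (simp add: c_def mult_ac)
  qed
  then show ?thesis using c0 by blast
qed

end

context long_range_beta
begin

text \<open>Finite-volume stand-in for the probability of an infinite cluster: \<theta>' is the
  limit in m of the supremum over volumes of the probability that the cluster of 0 has at least m
  vertices. By monotonicity some level \<open>n\<close> is already within \<delta> of the limit. In
  large volumes, sizes between \<open>n\<close> and any larger bound then have probability at most 2
  \<delta>.\<close>

lemma percolation_levels:
  assumes perc: "\<And>m :: real. \<exists>V. finite V \<and> 0 \<in> V \<and> \<theta> \<le> pr (pairs V) (\<lambda>S. m \<le> real (card (cl S 0)))"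
    and \<delta>: "\<delta> > 0"
  shows "\<exists>\<theta>' n V1. \<theta> \<le> \<theta>' \<and> finite V1 \<and> 0 \<in> V1 \<and>
     \<theta>' - \<delta> \<le> pr (pairs V1) (\<lambda>S. n \<le> real (card (cl S 0))) \<and>
     (\<forall>V. finite V \<longrightarrow> 0 \<in> V \<longrightarrow> pr (pairs V) (\<lambda>S. n \<le> real (card (cl S 0))) \<le> \<theta>' + \<delta>) \<and>
     (\<forall>m. \<exists>V. finite V \<and> 0 \<in> V \<and> \<theta>' - \<delta> \<le> pr (pairs V) (\<lambda>S. m \<le> real (card (cl S 0))))"
proof -
  let ?V = "{V. finite V \<and> (0 :: int ^ 'd) \<in> V}"
  define p where "p m V = pr (pairs V) (\<lambda>S. m \<le> real (card (cl S (0 :: int ^ 'd))))" for m V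
  define a where "a m = (SUP V\<in>?V. p m V)" for m
  have bdd: "bdd_above (p m ` ?V)" for m
    by (rule bdd_aboveI[of _ 1]) (auto simp: p_def intro!: pr_le_1)
  have ub: "p m V \<le> a m" if "finite V" "0 \<in> V" for m V
    unfolding a_def using bdd that by (intro cSUP_upper) auto
  have ge: "\<theta> \<le> a m" for m
  proof -
    obtain V where "finite V" "0 \<in> V" "\<theta> \<le> p m V" using perc[of m] by (auto simp: p_def)
    then show ?thesis using ub[of V m] by simp
  qed
  have mono: "a m' \<le> a m" if "m \<le> m'" for m m'
    unfolding a_def
  proof (rule cSUP_mono)
    fix V assume V: "V \<in> ?V"
    have "p m' V \<le> p m V" unfolding p_def using V that by (intro pr_mono) auto
    then show "\<exists>V'\<in>?V. p m' V \<le> p m V'" using V by blast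
  qed (use bdd in auto)
  define \<theta>' where "\<theta>' = (INF n :: nat. a (real n))"
  have bddb: "bdd_below (range (\<lambda>n :: nat. a (real n)))" using ge by (intro bdd_belowI[of _ \<theta>]) auto
  have 1: "\<theta> \<le> \<theta>'" unfolding \<theta>'_def using ge by (intro cINF_greatest) auto
  have 2: "\<theta>' \<le> a m" for m
  proof -
    have "\<theta>' \<le> a (real (nat \<lceil>m\<rceil>))" unfolding \<theta>'_def using bddb by (intro cINF_lower) auto
    also have "\<dots> \<le> a m" by (rule mono) linarith
    finally show ?thesis .
  qed
  have "\<exists>n::nat. a (real n) < \<theta>' + \<delta>"
    using \<delta> bddb cINF_less_iff[of UNIV "\<lambda>n::nat. a (real n)" "\<theta>' + \<delta>"] by (auto simp: \<theta>'_def)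
  then obtain n :: nat where n: "a (real n) < \<theta>' + \<delta>" by auto
  have ex: "\<exists>V. finite V \<and> 0 \<in> V \<and> \<theta>' - \<delta> \<le> p m V" for m
  proof -
    have "\<exists>V\<in>?V. \<theta>' - \<delta> < p m V"
      using less_cSUP_iff[of ?V "p m" "\<theta>' - \<delta>"] bdd 2[of m] \<delta> unfolding a_def by (smt (verit) finite.emptyI finite_insert insertI1 mem_Collect_eq empty_iff)
    then show ?thesis by fastforce
  qed
  obtain V1 where "finite V1" "0 \<in> V1" "\<theta>' - \<delta> \<le> p (real n) V1" using ex by blast
  moreover have "p (real n) V \<le> \<theta>' + \<delta>" if "finite V" "0 \<in> V" for V
    using ub[OF that, of "real n"] n by simp
  ultimately show ?thesis using 1 ex unfolding p_def by blast
qed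

text \<open>Translation moves the origin to \<open>x\<close>. Enlarging the volume while keeping
  only edges of \<open>F\<close> cannot hurt, as \<open>F\<close> contains all pairs of the
  translate and the event is increasing.\<close>

lemma pr_cluster_shift:
  assumes "finite V" "finite \<Lambda>" "(+) x ` V \<subseteq> \<Lambda>" "pairs ((+) x ` V) \<subseteq> F"
  shows "pr (pairs V) (\<lambda>S. m \<le> real (card (cl S 0))) \<le> pr (pairs \<Lambda>) (\<lambda>S. m \<le> real (card (cl (S \<inter> F) x)))"
proof -
  let ?W = "(+) x ` V"
  have "pr (pairs V) (\<lambda>S. m \<le> real (card (cl S 0))) = pr (pairs V) (\<lambda>S. m \<le> real (card (cl ((`) ((+) x) ` S) x)))"
  proof (rule pr_cong)
    fix S :: "(int ^ 'd) set set"
    have "cl ((`) ((+) x) ` S) (x + 0) = (+) x ` cl S 0" by (rule cl_image) simp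
    then show "(m \<le> real (card (cl S 0))) = (m \<le> real (card (cl ((`) ((+) x) ` S) x)))"
      by (simp add: card_image)
  qed
  also have "\<dots> = pr (pairs ?W) (\<lambda>S. m \<le> real (card (cl S x)))"
    using assms(1) by (simp add: pr_shift)
  also have "\<dots> = pr (pairs ?W) (\<lambda>S. m \<le> real (card (cl (S \<inter> F) x)))"
    using assms(4) by (intro pr_cong) (simp add: Int_absorb2 subset_trans)
  also have "\<dots> \<le> pr (pairs \<Lambda>) (\<lambda>S. m \<le> real (card (cl (S \<inter> F) x)))"
  proof (rule pr_increasing)
    show "pairs ?W \<subseteq> pairs \<Lambda>" using assms(3) by (rule pairs_mono)
    fix S S' assume S: "S \<subseteq> S'" "S' \<subseteq> pairs \<Lambda>" "m \<le> real (card (cl (S \<inter> F) x))"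
    have "cl (S' \<inter> F) x \<subseteq> insert x \<Lambda>"
      using cl_subset_Un[of "S' \<inter> F" x] S by (auto simp: pairs_def)
    then have "finite (cl (S' \<inter> F) x)" using assms(2) by (meson finite.insertI finite_subset)
    then have "card (cl (S \<inter> F) x) \<le> card (cl (S' \<inter> F) x)" using S by (intro card_mono cl_mono) auto
    then show "m \<le> real (card (cl (S' \<inter> F) x))" using S(3) by linarith
  qed (use assms in auto)
  finally show ?thesis .
qed

text \<open>A cluster of bounded size made of short edges is not extended by long edges with probability
  bounded below, so it is typically not part of an infinite cluster.\<close>

lemma short_cluster_prob:
  fixes n K G \<delta> \<theta> :: real
  assumes fin: "finite \<Lambda>" "x \<in> \<Lambda>" "finite V1" "finite V2" "(+) x ` V1 \<subseteq> \<Lambda>" "(+) x ` V2 \<subseteq> \<Lambda>"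
    and V1: "pairs ((+) x ` V1) \<subseteq> short r" "\<theta> - \<delta> \<le> pr (pairs V1) (\<lambda>S. n \<le> real (card (cl S 0)))"
    and V2: "\<theta> - \<delta> \<le> pr (pairs V2) (\<lambda>S. max n K \<le> real (card (cl S 0)))"
    and up: "\<And>V. finite V \<Longrightarrow> 0 \<in> V \<Longrightarrow> pr (pairs V) (\<lambda>S. n \<le> real (card (cl S 0))) \<le> \<theta> + \<delta>"
    and tail: "\<And>u W. finite W \<Longrightarrow> \<forall>v\<in>W. real r \<le> l1_norm (u - v) \<Longrightarrow> K * (\<beta> * (\<Sum>v\<in>W. P (u - v))) \<le> G"
    and G: "G \<ge> 0" and K: "K > 0"
  shows "\<theta> - \<delta> - 2 * \<delta> * exp G \<le> pr (pairs \<Lambda>) (\<lambda>S. K \<le> real (card (cl (S \<inter> short r) x)))"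
proof -
  let ?E = "pairs \<Lambda>"
  let ?F = "?E \<inter> short r"
  let ?A = "\<lambda>U. n \<le> real (card (cl U x)) \<and> real (card (cl U x)) < K"
  \<comment> \<open>The long edges at the exposed short cluster of \<open>x\<close>. A cluster of
    fewer than \<open>K\<close> vertices has total weight at most \<open>G\<close> on them, so they
    are all closed with conditional probability at least exp(-G).\<close>
  let ?Q = "\<lambda>U. {e \<in> ?E - ?F. e \<inter> cl U x \<noteq> {}}"
  have SF: "S \<inter> ?F = S \<inter> short r" if "S \<subseteq> ?E" for S using that by auto
  have "pr ?E (\<lambda>S. ?A (S \<inter> ?F)) \<le> exp G * pr ?E (\<lambda>S. ?A (S \<inter> ?F) \<and> S \<inter> ?Q (S \<inter> ?F) = {})"
  proof (rule pr_closed_ge)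
    fix U assume U: "U \<subseteq> ?F" "?A U"
    have sub: "cl U x \<subseteq> \<Lambda>" using U fin by (intro cl_subset_pairs) auto
    have fc: "finite (cl U x)" using sub fin(1) by (rule finite_subset)
    let ?S = "SIGMA u:cl U x. {v \<in> \<Lambda>. real r \<le> l1_norm (u - v) \<and> u \<noteq> v}"
    have "?Q U \<subseteq> (\<lambda>(u, v). {u, v}) ` ?S"
    proof
      fix e assume e: "e \<in> ?Q U"
      then obtain a b where ab: "e = {a, b}" "a \<noteq> b" "a \<in> \<Lambda>" "b \<in> \<Lambda>" using doubleton_pairs[of e \<Lambda>] by auto
      have "e \<notin> short r" using e by auto
      then have l: "real r \<le> l1_norm (a - b)" "real r \<le> l1_norm (b - a)"
        using ab(1) short_iff[of a b r] l1_norm_minus[of a b] by auto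
      show "e \<in> (\<lambda>(u, v). {u, v}) ` ?S"
      proof (cases "a \<in> cl U x")
        case True
        then show ?thesis using ab l by (intro image_eqI[where x = "(a, b)"]) auto
      next
        case False
        then have "b \<in> cl U x" using e ab by auto
        then show ?thesis using ab l by (intro image_eqI[where x = "(b, a)"]) auto
      qed
    qed
    then have "(\<Sum>e\<in>?Q U. \<beta> * coupling P e) \<le> (\<Sum>e\<in>(\<lambda>(u, v). {u, v}) ` ?S. \<beta> * coupling P e)"
      using fc fin(1) coupling_nonneg beta_nonneg by (intro sum_mono2) auto
    also have "\<dots> \<le> (\<Sum>p\<in>?S. ((\<lambda>e. \<beta> * coupling P e) \<circ> (\<lambda>(u, v). {u, v})) p)"
      using fc fin(1) coupling_nonneg beta_nonneg by (intro sum_image_le) auto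
    also have "\<dots> = (\<Sum>u\<in>cl U x. \<Sum>v\<in>{v \<in> \<Lambda>. real r \<le> l1_norm (u - v) \<and> u \<noteq> v}. \<beta> * P (u - v))"
      using fc fin(1) by (subst sum.Sigma) (auto intro!: sum.cong simp: coupling_eq)
    also have "\<dots> \<le> (\<Sum>u\<in>cl U x. G / K)"
    proof (rule sum_mono)
      fix u
      have "K * (\<beta> * (\<Sum>v\<in>{v \<in> \<Lambda>. real r \<le> l1_norm (u - v) \<and> u \<noteq> v}. P (u - v))) \<le> G"
        using fin(1) by (intro tail) auto
      then show "(\<Sum>v\<in>{v \<in> \<Lambda>. real r \<le> l1_norm (u - v) \<and> u \<noteq> v}. \<beta> * P (u - v)) \<le> G / K"
        using K by (simp add: sum_distrib_left[symmetric] pos_le_divide_eq mult.commute)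
    qed
    also have "\<dots> = real (card (cl U x)) * (G / K)" by simp
    also have "\<dots> \<le> K * (G / K)" using U G K by (intro mult_right_mono) auto
    also have "\<dots> = G" using K by simp
    finally show "?Q U \<subseteq> ?E - ?F \<and> (\<Sum>e\<in>?Q U. \<beta> * coupling P e) \<le> G" by auto
  qed (use fin in auto)
  \<comment> \<open>With these edges closed the short cluster is the whole cluster, whose size is
    then at least \<open>n\<close> and below \<open>K\<close>.\<close>
  also have "pr ?E (\<lambda>S. ?A (S \<inter> ?F) \<and> S \<inter> ?Q (S \<inter> ?F) = {}) \<le> pr ?E ?A"
  proof (rule pr_mono)
    fix S assume S: "S \<subseteq> ?E" and A: "?A (S \<inter> ?F) \<and> S \<inter> ?Q (S \<inter> ?F) = {}"
    have "cl S x \<subseteq> cl (S \<inter> ?F) x"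
    proof (rule cl_closed)
      fix a b assume ab: "{a, b} \<in> S" "a \<in> cl (S \<inter> ?F) x"
      then have "{a, b} \<in> S \<inter> ?F" using A S by blast
      then have "b \<in> cl (S \<inter> ?F) a" by (rule cl_edge)
      then show "b \<in> cl (S \<inter> ?F) x" using cl_eq[OF ab(2)] by simp
    qed simp
    moreover have "cl (S \<inter> ?F) x \<subseteq> cl S x" by (rule cl_mono) simp
    ultimately have "cl S x = cl (S \<inter> ?F) x" by (rule equalityI)
    then show "?A S" using A by simp
  qed (use fin in simp)
  \<comment> \<open>The levels make such intermediate sizes rare: a size of at least
    \<open>n\<close> has probability at most \<theta> + \<delta>, and one of at least
    \<open>max n K\<close> has probability at least \<theta> - \<delta>.\<close>
  also have "pr ?E ?A \<le> 2 * \<delta>"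
  proof -
    have eq: "?E = pairs ((+) x ` ((+) (- x) ` \<Lambda>))" by (simp add: image_image)
    have "pr ?E (\<lambda>S. n \<le> real (card (cl S x))) = pr (pairs ((+) (- x) ` \<Lambda>)) (\<lambda>S. n \<le> real (card (cl S 0)))"
    proof -
      have "cl ((`) ((+) x) ` S) (x + 0) = (+) x ` cl S 0" for S by (rule cl_image) simp
      then have "card (cl ((`) ((+) x) ` S) x) = card (cl S 0)" for S by (simp add: card_image)
      then show ?thesis unfolding eq using fin(1) by (subst pr_shift) auto
    qed
    also have "\<dots> \<le> \<theta> + \<delta>" using fin by (intro up) (auto intro: image_eqI[of _ _ x])
    finally have 1: "pr ?E (\<lambda>S. n \<le> real (card (cl S x))) \<le> \<theta> + \<delta>" .
    have "\<theta> - \<delta> \<le> pr ?E (\<lambda>S. max n K \<le> real (card (cl (S \<inter> UNIV) x)))"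
      using V2 fin by (intro order_trans[OF V2 pr_cluster_shift]) auto
    then have 2: "\<theta> - \<delta> \<le> pr ?E (\<lambda>S. max n K \<le> real (card (cl S x)))" by simp
    have "pr ?E ?A + pr ?E (\<lambda>S. max n K \<le> real (card (cl S x))) \<le> pr ?E (\<lambda>S. n \<le> real (card (cl S x)))"
      unfolding pr_def using fin by (subst ex_add[symmetric]) (intro ex_mono, auto)
    then show ?thesis using 1 2 by simp
  qed
  finally have A: "pr ?E (\<lambda>S. ?A (S \<inter> ?F)) \<le> exp G * (2 * \<delta>)" by simp
  have "\<theta> - \<delta> \<le> pr ?E (\<lambda>S. n \<le> real (card (cl (S \<inter> short r) x)))"
    using V1 fin by (intro order_trans[OF V1(2) pr_cluster_shift]) auto
  also have "\<dots> \<le> pr ?E (\<lambda>S. ?A (S \<inter> ?F) \<or> K \<le> real (card (cl (S \<inter> short r) x)))"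
    by (rule pr_mono) (use fin SF in auto)
  also have "\<dots> \<le> pr ?E (\<lambda>S. ?A (S \<inter> ?F)) + pr ?E (\<lambda>S. K \<le> real (card (cl (S \<inter> short r) x)))"
    using fin by (intro pr_disj) simp
  finally show ?thesis using A by (simp add: algebra_simps)
qed

end

section \<open>Nested tilings, growth of scales and multiscale merging\<close>

definition tiled :: "nat \<Rightarrow> (int ^ 'd::finite) set set" where
  "tiled r = (\<Union>z. pairs (tile 0 r z))"

text \<open>Dividing by r and then by c is dividing by r c. Nesting makes the edge sets exposed at
  successive stages increase.\<close>

lemma tile_nested:
  fixes z :: "int ^ 'd::finite"
  assumes "r > 0" "r dvd r'" "r' > 0"
  shows "\<exists>z'. tile 0 r z \<subseteq> tile 0 r' z'"
proof -
  obtain c where c: "r' = r * c" using assms(2) by auto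
  have "tile 0 r z \<subseteq> tile 0 r' (\<chi> i. z $ i div int c)"
  proof
    fix x assume "x \<in> tile 0 r z"
    then have "z $ i = x $ i div int r" for i using assms(1) by (simp add: tile_iff)
    then have "z $ i div int c = x $ i div int r'" for i by (simp add: c zdiv_zmult2_eq)
    then show "x \<in> tile 0 r' (\<chi> i. z $ i div int c)" using assms(3) by (simp add: tile_iff)
  qed
  then show ?thesis by blast
qed

lemma tiled_mono:
  "r > 0 \<Longrightarrow> r' > 0 \<Longrightarrow> r dvd r' \<Longrightarrow> tiled r \<subseteq> (tiled r' :: (int ^ 'a::finite) set set)"
proof -
  assume r: "r > 0" "r' > 0" "r dvd r'"
  have "pairs (tile 0 r z) \<subseteq> tiled r'" for z :: "int ^ 'a"
  proof -
    obtain z' where "tile 0 r z \<subseteq> tile 0 r' z'" using tile_nested[of r r' z] r by blast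
    then have "pairs (tile 0 r z) \<subseteq> pairs (tile 0 r' z')" by (rule pairs_mono)
    also have "\<dots> \<subseteq> tiled r'" unfolding tiled_def by (rule UN_upper) simp
    finally show ?thesis .
  qed
  then show ?thesis unfolding tiled_def[of r] by (rule UN_least)
qed

lemma card_tiled_neighbours:
  fixes x :: "int ^ 'd::finite"
  assumes "r > 0"
  shows "finite {y. y \<noteq> x \<and> {x, y} \<in> tiled r}" "card {y. y \<noteq> x \<and> {x, y} \<in> tiled r} \<le> r ^ CARD('d)"
proof -
  have "\<exists>z. {y. y \<noteq> x \<and> {x, y} \<in> tiled r} \<subseteq> tile 0 r z"
  proof -
    let ?z = "\<chi> i. x $ i div int r"
    have "y \<in> tile 0 r ?z" if xy: "{x, y} \<in> tiled r" for y
    proof -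
      obtain z where z: "x \<in> tile 0 r z" "y \<in> tile 0 r z"
        using xy by (auto simp: tiled_def pairs_def doubleton_eq_iff)
      then have "z = ?z" using assms by (simp add: tile_iff vec_eq_iff)
      then show ?thesis using z by simp
    qed
    then show ?thesis by blast
  qed
  then obtain z where z: "{y. y \<noteq> x \<and> {x, y} \<in> tiled r} \<subseteq> tile 0 r z" by auto
  show "finite {y. y \<noteq> x \<and> {x, y} \<in> tiled r}" using z by (rule finite_subset) simp
  show "card {y. y \<noteq> x \<and> {x, y} \<in> tiled r} \<le> r ^ CARD('d)"
    using card_mono[OF finite_tile z] by simp
qed

text \<open>A power \<delta> of these scales grows like the exponential of a multiple of j^2 and
  beats every geometric loss: B^(\<delta> j (j+1) / 2) equals (b^(j+1))^j, and b^(j+1) exceeds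
  \<open>Y\<close> for j beyond some k. The finitely many smaller j cost a factor
  \<open>Y ^ k\<close>, paid by a large first scale.\<close>

lemma superexponential_growth:
  fixes Q Y \<delta> :: real and B :: nat
  assumes "Q \<ge> 0" "Y \<ge> 1" "\<delta> > 0" "B \<ge> 2"
  shows "\<exists>r1::nat. \<forall>r\<ge>r1. \<forall>j. Q * Y ^ j \<le> real (r * B ^ (j * (j + 1) div 2)) powr \<delta>"
proof -
  define b where "b = real B powr (\<delta> / 2)"
  have b1: "b > 1"
  proof -
    have "real B powr 0 < real B powr (\<delta> / 2)" using assms by (intro powr_less_mono) auto
    then show ?thesis using assms by (simp add: b_def)
  qed
  obtain k where k: "Y < b ^ k" using real_arch_pow[OF b1] by auto
  have Yk: "Y ^ k \<ge> 1" using assms by (simp add: one_le_power)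
  have B: "Y ^ j \<le> Y ^ k * real (B ^ (j * (j + 1) div 2)) powr \<delta>" for j
  proof (cases "j \<le> k")
    case True
    have "real (B ^ (j * (j + 1) div 2)) \<ge> 1" using assms by simp
    then have "1 \<le> real (B ^ (j * (j + 1) div 2)) powr \<delta>" using assms by (intro ge_one_powr_ge_zero) auto
    moreover have "Y ^ j \<le> Y ^ k" using assms True by (intro power_increasing) auto
    ultimately show ?thesis using Yk by (smt (verit) mult_left_le mult_le_cancel_left1)
  next
    case False
    have "even (j * (j + 1))" by simp
    then have "2 * real (j * (j + 1) div 2) = real j * real (j + 1)"
      by (metis of_nat_mult of_nat_numeral dvd_mult_div_cancel)
    then have h: "real (j * (j + 1) div 2) = real j * real (j + 1) / 2" by simp
    have "Y ^ j \<le> (b ^ k) ^ j" using k assms by (intro power_mono) auto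
    also have "\<dots> \<le> (b ^ (j + 1)) ^ j" using False b1 by (intro power_mono power_increasing) auto
    also have "\<dots> = b powr (real j * real (j + 1))"
    proof -
      have "(b ^ (j + 1)) ^ j = b ^ (j * (j + 1))" by (simp only: power_mult[symmetric] mult.commute)
      also have "\<dots> = b powr real (j * (j + 1))" using b1 by (intro powr_realpow[symmetric]) simp
      finally show ?thesis by (simp only: of_nat_mult)
    qed
    also have "\<dots> = real B powr (real (j * (j + 1) div 2) * \<delta>)"
      unfolding b_def powr_powr h by (simp add: mult_ac)
    also have "\<dots> = real (B ^ (j * (j + 1) div 2)) powr \<delta>"
      using assms by (simp add: powr_realpow[symmetric] powr_powr)
    also have "\<dots> \<le> Y ^ k * real (B ^ (j * (j + 1) div 2)) powr \<delta>"
      using Yk by (simp add: mult_le_cancel_right1)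
    finally show ?thesis .
  qed
  define r1 where "r1 = nat \<lceil>(Q * Y ^ k) powr (1 / \<delta>)\<rceil>"
  have "Q * Y ^ j \<le> real (r * B ^ (j * (j + 1) div 2)) powr \<delta>" if "r \<ge> r1" for r j
  proof -
    have "(Q * Y ^ k) powr (1 / \<delta>) \<le> real r" using that unfolding r1_def by linarith
    then have "((Q * Y ^ k) powr (1 / \<delta>)) powr \<delta> \<le> real r powr \<delta>" using assms by (intro powr_mono2) auto
    then have Q: "Q * Y ^ k \<le> real r powr \<delta>" using assms by (simp add: powr_powr)
    have "Q * Y ^ j \<le> Q * (Y ^ k * real (B ^ (j * (j + 1) div 2)) powr \<delta>)"
      using B assms by (intro mult_left_mono) auto
    also have "\<dots> \<le> real r powr \<delta> * real (B ^ (j * (j + 1) div 2)) powr \<delta>"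
      unfolding mult.assoc[symmetric] using Q by (intro mult_right_mono) auto
    also have "\<dots> = real (r * B ^ (j * (j + 1) div 2)) powr \<delta>" by (simp add: powr_mult)
    finally show ?thesis .
  qed
  then show ?thesis by blast
qed

text \<open>Pointwise form of the reverse Markov inequality, used to turn a mean density into a
  probability.\<close>

lemma le_add_of_bool: "(c::real) \<le> V \<Longrightarrow> 0 \<le> a \<Longrightarrow> c \<le> a + V * of_bool (a \<le> c)"
  by (cases "a \<le> c") auto

lemma exp_minus_le_inverse: "(y::real) > 0 \<Longrightarrow> exp (- y) \<le> 1 / y"
proof -
  assume y: "y > 0"
  have "y \<le> exp y" using exp_ge_add_one_self[of y] by linarith
  then have "1 / exp y \<le> 1 / y" using y by (intro divide_left_mono) auto
  then show ?thesis by (simp add: exp_minus field_simps)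
qed

context long_range_beta
begin

text \<open>The tiles offer \<open>C ^ CARD('d)\<close> attempts, and by
  \<open>pr_decreasing_disjoint\<close> failing all of them is at most as likely as for independent
  ones. A probability bounded below thus becomes close to 1 at the cost of a larger cube.\<close>

lemma pr_boost:
  assumes N: "N \<ge> 1" and p: "p \<le> pr (pairs (cube 0 N)) (has_big (cube 0 N) (cube 0 N) m)"
  shows "1 - (1 - p) ^ (C ^ CARD('d)) \<le>
    pr (pairs (cube 0 (C * N))) (has_big (cube 0 (C * N)) (cube (0 :: int ^ 'd) (C * N)) m)"
proof -
  let ?T = "tile (0 :: int ^ 'd) N"
  let ?bad = "\<lambda>z S. \<not> has_big (?T z) (?T z) m S"
  have e: "pr (pairs (?T z)) (?bad z) \<le> 1 - p" for z
  proof -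
    have "?T z = (+) (\<chi> i. int N * z $ i) ` cube 0 N"
      unfolding tile_def by (metis add.commute cube_shift)
    then have "pr (pairs (?T z)) (has_big (?T z) (?T z) m) = pr (pairs (cube 0 N)) (has_big (cube 0 N) (cube 0 N) m)"
      using pr_has_big_shift[of "cube 0 N" "\<chi> i. int N * z $ i" "cube 0 N" m] by simp
    then show ?thesis using p by (subst pr_not) auto
  qed
  have p1: "0 \<le> 1 - p" using order_trans[OF pr_nonneg e] by simp
  have "pr (pairs (\<Union>z\<in>I. ?T z)) (\<lambda>S. \<forall>z\<in>I. ?bad z S) \<le> (1 - p) ^ card I" if "finite I" for I
    using that
  proof (induct I rule: finite_induct)
    case empty
    show ?case by (simp add: pr_le_1 pairs_def)
  next
    case (insert z I)
    let ?U = "\<Union>z\<in>I. ?T z"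
    let ?E = "pairs (\<Union>z\<in>insert z I. ?T z)"
    have "?T z \<inter> ?T y = {}" if "y \<in> I" for y using insert(2) that by (intro tile_disjoint) auto
    then have d: "?T z \<inter> ?U = {}" by blast
    have i: "S \<inter> pairs ?U \<inter> pairs (?T y) = S \<inter> pairs (?T y)" if "y \<in> I" for y S
      using that pairs_mono[of "?T y" ?U] by blast
    have "pr ?E (\<lambda>S. \<forall>z\<in>insert z I. ?bad z S) =
        pr ?E (\<lambda>S. ?bad z (S \<inter> pairs (?T z)) \<and> (\<forall>y\<in>I. ?bad y (S \<inter> pairs ?U)))"
      by (simp add: has_big_def i)
    also have "\<dots> \<le> pr (pairs (?T z)) (?bad z) * pr (pairs ?U) (\<lambda>S. \<forall>y\<in>I. ?bad y S)"
    proof (rule pr_decreasing_disjoint)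
      show "finite ?E" using insert by simp
      show "pairs (?T z) \<subseteq> ?E" "pairs ?U \<subseteq> ?E" by (rule pairs_mono, blast)+
      show "\<Union> (pairs (?T z)) \<inter> \<Union> (pairs ?U) = {}"
        using d by (auto simp: pairs_def)
      have dec: "?bad y S" if "S \<subseteq> S'" "?bad y S'" for y S S'
        using that has_big_mono[of "?T y" "?T y" "?T y" "?T y" S S' m m] by auto
      show "?bad z S" if "S \<subseteq> S'" "?bad z S'" for S S' using dec that by blast
      show "\<forall>y\<in>I. ?bad y S" if "S \<subseteq> S'" "\<forall>y\<in>I. ?bad y S'" for S S' using dec that by blast
    qed simp
    also have "\<dots> \<le> (1 - p) * (1 - p) ^ card I"
      using insert e[of z] p1 by (intro mult_mono pr_nonneg) auto
    finally show ?case using insert by simp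
  qed
  note this[of "cube 0 C"]
  moreover have "(\<Union>z\<in>cube 0 C. ?T z) = cube 0 (C * N)" using N by (intro UN_tiles) simp
  ultimately have "pr (pairs (cube 0 (C * N))) (\<lambda>S. \<forall>z\<in>cube 0 C. ?bad z S) \<le> (1 - p) ^ (C ^ CARD('d))"
    by simp
  moreover have "pr (pairs (cube 0 (C * N))) (\<lambda>S. \<not> has_big (cube 0 (C * N)) (cube 0 (C * N)) m S)
      \<le> pr (pairs (cube 0 (C * N))) (\<lambda>S. \<forall>z\<in>cube 0 C. ?bad z S)"
  proof (rule pr_mono)
    fix S assume S: "\<not> has_big (cube 0 (C * N)) (cube (0 :: int ^ 'd) (C * N)) m S"
    show "\<forall>z\<in>cube 0 C. ?bad z S"
    proof
      fix z :: "int ^ 'd" assume "z \<in> cube 0 C"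
      then have "?T z \<subseteq> cube 0 (C * N)" by (rule tile_subset)
      then show "?bad z S"
        using S has_big_mono[of "cube 0 (C * N)" "?T z" "cube 0 (C * N)" "?T z" S S m m] by auto
    qed
  qed simp
  ultimately show ?thesis by (simp add: pr_not)
qed

text \<open>The bound \<open>r1\<close> on the range depends on \<open>G\<close> but not on
  \<open>K\<close>. This matters because \<open>K\<close> will be a multiple of r^(s-d), so it can
  be named only after r. The required side \<open>M1\<close> of the cube, in contrast, may depend on
  \<open>K\<close>.\<close>

lemma stage0:
  fixes \<theta> G :: real
  assumes perc: "\<And>m :: real. \<exists>V. finite V \<and> 0 \<in> V \<and> \<theta> \<le> pr (pairs V) (\<lambda>S. m \<le> real (card (cl S 0)))"
    and \<theta>: "\<theta> > 0" and G: "G \<ge> 0"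
  shows "\<exists>r1::nat. \<forall>r\<ge>r1. \<forall>K>0.
     (\<forall>u W. finite W \<longrightarrow> (\<forall>v\<in>W. real r \<le> l1_norm (u - v)) \<longrightarrow> K * (\<beta> * (\<Sum>v\<in>W. P (u - v))) \<le> G) \<longrightarrow>
     (\<exists>M1. \<forall>M\<ge>M1. \<theta> / 4 \<le> pr (pairs (cube (0 :: int ^ 'd) M)) (\<lambda>S. \<theta> / 4 * real (card (cube (0 :: int ^ 'd) M)) \<le>
        real (card {x \<in> cube 0 M. K \<le> real (card (cl (S \<inter> short r) x))})))"
proof -
  \<comment> \<open>Makes \<delta> at most \<theta>/12 and 2 \<delta> exp G equal to \<theta>/6,
    which leaves 3/4 \<theta> in \<open>short_cluster_prob\<close>.\<close>
  define \<delta> where "\<delta> = \<theta> * exp (- G) / 12"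
  have \<delta>: "\<delta> > 0" using \<theta> by (simp add: \<delta>_def)
  obtain \<theta>' n V1 where L: "\<theta> \<le> \<theta>'" "finite V1" "0 \<in> V1"
     "\<theta>' - \<delta> \<le> pr (pairs V1) (\<lambda>S. n \<le> real (card (cl S 0)))"
     "\<And>V. finite V \<Longrightarrow> 0 \<in> V \<Longrightarrow> pr (pairs V) (\<lambda>S. n \<le> real (card (cl S 0))) \<le> \<theta>' + \<delta>"
     "\<And>m. \<exists>V. finite V \<and> 0 \<in> V \<and> \<theta>' - \<delta> \<le> pr (pairs V) (\<lambda>S. m \<le> real (card (cl S 0)))"
    using percolation_levels[OF perc \<delta>] by blast
  \<comment> \<open>Exceeds the diameter of \<open>V1\<close>, so that all edges inside a translate
    of \<open>V1\<close> are short.\<close>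
  define r1 where "r1 = nat \<lceil>\<Sum>u\<in>V1. \<Sum>v\<in>V1. l1_norm (u - v)\<rceil> + 1"
  have V1_short: "pairs ((+) x ` V1) \<subseteq> short r" if "r \<ge> r1" for r x
  proof
    fix e assume "e \<in> pairs ((+) x ` V1)"
    then obtain u v where uv: "e = {x + u, x + v}" "u \<in> V1" "v \<in> V1" by (auto simp: pairs_def)
    have "l1_norm (u - v) \<le> (\<Sum>v\<in>V1. l1_norm (u - v))"
      using uv L by (intro member_le_sum) (auto simp: l1_norm_nonneg)
    also have "\<dots> \<le> (\<Sum>u\<in>V1. \<Sum>v\<in>V1. l1_norm (u - v))"
      using uv L by (intro member_le_sum[where f = "\<lambda>u. \<Sum>v\<in>V1. l1_norm (u - v)"]) (auto simp: l1_norm_nonneg intro!: sum_nonneg)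
    also have "\<dots> < real r1" unfolding r1_def by linarith
    also have "\<dots> \<le> real r" using that by simp
    finally show "e \<in> short r" unfolding uv by (simp add: short_iff)
  qed
  have "\<exists>M1. \<forall>M\<ge>M1. \<theta> / 4 \<le> pr (pairs (cube (0 :: int ^ 'd) M)) (\<lambda>S. \<theta> / 4 * real (card (cube (0 :: int ^ 'd) M)) \<le>
        real (card {x \<in> cube 0 M. K \<le> real (card (cl (S \<inter> short r) x))}))"
    if r: "r \<ge> r1" and K: "K > 0"
      and tail: "\<forall>u W. finite W \<longrightarrow> (\<forall>v\<in>W. real r \<le> l1_norm (u - v)) \<longrightarrow> K * (\<beta> * (\<Sum>v\<in>W. P (u - v))) \<le> G" for r K
  proof -
    obtain V2 where V2: "finite V2" "0 \<in> V2" "\<theta>' - \<delta> \<le> pr (pairs V2) (\<lambda>S. max n K \<le> real (card (cl S 0)))"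
      using L(6) by blast
    define h where "h = nat (\<Sum>v\<in>V1 \<union> V2. \<Sum>i\<in>UNIV. \<bar>v $ i\<bar>)"
    have h: "\<bar>v $ i\<bar> \<le> int h" if "v \<in> V1 \<union> V2" for v i
    proof -
      have "\<bar>v $ i\<bar> \<le> (\<Sum>i\<in>UNIV. \<bar>v $ i\<bar>)" by (rule member_le_sum) auto
      also have "\<dots> \<le> (\<Sum>v\<in>V1 \<union> V2. \<Sum>i\<in>UNIV. \<bar>v $ i\<bar>)"
        using that L V2 by (intro member_le_sum[where f = "\<lambda>v. \<Sum>i\<in>UNIV. \<bar>v $ i\<bar>"]) (auto intro: sum_nonneg)
      finally show ?thesis unfolding h_def by linarith
    qed
    have "\<theta> / 4 \<le> pr (pairs (cube (0 :: int ^ 'd) M)) (\<lambda>S. \<theta> / 4 * real (card (cube (0 :: int ^ 'd) M)) \<le>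
        real (card {x \<in> cube 0 M. K \<le> real (card (cl (S \<inter> short r) x))}))"
      if M: "M \<ge> 6 * h * CARD('d) + 1" for M
    proof -
      let ?\<Lambda> = "cube (0 :: int ^ 'd) M"
      let ?E = "pairs ?\<Lambda>"
      let ?V = "real (card ?\<Lambda>)"
      \<comment> \<open>Translates of \<open>V1\<close> and \<open>V2\<close> by points of
        \<open>?D\<close> stay in the cube. By Bernoulli's inequality the lower bound on
        \<open>M\<close> makes \<open>?D\<close> at least 2/3 of the cube, so the mean density of
        good vertices is at least 2/3 times 3/4 \<theta>, that is \<theta>/2.\<close>
      let ?D = "cube (\<chi> i. int h) (M - 2 * h) :: (int ^ 'd) set"
      have "6 * h \<le> 6 * h * CARD('d)" by simp
      then have Mh: "M \<ge> 2 * h" "M > 0" using M by linarith+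
      have D_sub: "?D \<subseteq> ?\<Lambda>" using Mh by (auto simp: cube_def) (smt (verit) of_nat_0_le_iff)+
      have shift: "(+) x ` V \<subseteq> ?\<Lambda>" if xV: "x \<in> ?D" "V \<subseteq> V1 \<union> V2" for x V
      proof
        fix y assume "y \<in> (+) x ` V"
        then obtain v where v: "y = x + v" "v \<in> V1 \<union> V2" using xV by auto
        show "y \<in> ?\<Lambda>" unfolding cube_def
        proof (simp, intro allI)
          fix i
          have "int h \<le> x $ i" "x $ i < int h + int (M - 2 * h)" using xV by (auto simp: cube_def)
          then show "0 \<le> y $ i \<and> y $ i < int M" using h[OF v(2), of i] Mh v(1) by (auto simp: abs_le_iff)
        qed
      qed
      have pt: "3 / 4 * \<theta> \<le> pr ?E (\<lambda>S. K \<le> real (card (cl (S \<inter> short r) x)))" if x: "x \<in> ?D" for x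
      proof -
        have "\<theta>' - \<delta> - 2 * \<delta> * exp G \<le> pr ?E (\<lambda>S. K \<le> real (card (cl (S \<inter> short r) x)))"
          by (rule short_cluster_prob[where ?V1.0 = V1 and ?V2.0 = V2 and n = n and G = G])
            (use x D_sub shift L V2 V1_short r K tail G in auto)
        moreover have "2 * \<delta> * exp G = \<theta> / 6" by (simp add: \<delta>_def exp_minus field_simps)
        moreover have "\<delta> \<le> \<theta> / 12" using G \<theta> by (simp add: \<delta>_def)
        ultimately show ?thesis using L(1) by linarith
      qed
      have cD: "2 / 3 * ?V \<le> real (card ?D)"
      proof -
        have "2 / 3 \<le> 1 + real CARD('d) * (- (2 * real h / real M))"
        proof -
          have "real (6 * h * CARD('d)) \<le> real M" using M by linarith
          then show ?thesis using Mh by (simp add: field_simps)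
        qed
        also have "\<dots> \<le> (1 + (- (2 * real h / real M))) ^ CARD('d)"
          using Mh by (intro Bernoulli_inequality) (simp add: field_simps)
        also have "1 + (- (2 * real h / real M)) = real (M - 2 * h) / real M"
          using Mh by (simp add: field_simps of_nat_diff)
        finally have "2 / 3 \<le> real (M - 2 * h) ^ CARD('d) / real M ^ CARD('d)" by (simp add: power_divide)
        then show ?thesis using Mh by (simp add: field_simps)
      qed
      let ?c = "\<lambda>S. real (card {x \<in> ?\<Lambda>. K \<le> real (card (cl (S \<inter> short r) x))})"
      have cs: "?c S = (\<Sum>x\<in>?\<Lambda>. of_bool (K \<le> real (card (cl (S \<inter> short r) x))))" for S
        by (simp add: sum_of_bool_eq Int_def)
      have "\<theta> / 2 * ?V = (2 / 3 * ?V) * (3 / 4 * \<theta>)" by simp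
      also have "\<dots> \<le> real (card ?D) * (3 / 4 * \<theta>)" using cD \<theta> by (intro mult_right_mono) auto
      also have "\<dots> = (\<Sum>x\<in>?D. 3 / 4 * \<theta>)" by simp
      also have "\<dots> \<le> (\<Sum>x\<in>?D. pr ?E (\<lambda>S. K \<le> real (card (cl (S \<inter> short r) x))))"
        by (intro sum_mono pt)
      also have "\<dots> \<le> (\<Sum>x\<in>?\<Lambda>. pr ?E (\<lambda>S. K \<le> real (card (cl (S \<inter> short r) x))))"
        using D_sub by (intro sum_mono2) (auto intro: pr_nonneg)
      also have "\<dots> = ex ?E ?c" unfolding pr_def ex_sum[symmetric] cs ..
      \<comment> \<open>A density that never exceeds 1 and has mean at least \<theta>/2 is at least
        \<theta>/4 with probability at least \<theta>/4.\<close>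
      also have "\<dots> \<le> ex ?E (\<lambda>S. \<theta> / 4 * ?V + ?V * of_bool (\<theta> / 4 * ?V \<le> ?c S))"
      proof (rule ex_mono)
        fix S
        have c: "?c S \<le> ?V" by (intro of_nat_mono card_mono) auto
        have "0 \<le> \<theta> / 4 * ?V" using \<theta> by simp
        then show "?c S \<le> \<theta> / 4 * ?V + ?V * of_bool (\<theta> / 4 * ?V \<le> ?c S)"
          using c by (intro le_add_of_bool)
      qed simp
      also have "\<dots> = \<theta> / 4 * ?V + ?V * pr ?E (\<lambda>S. \<theta> / 4 * ?V \<le> ?c S)"
        by (simp only: ex_add ex_cmult pr_def ex_const finite_pairs finite_cube)
      finally have "\<theta> / 4 * ?V \<le> pr ?E (\<lambda>S. \<theta> / 4 * ?V \<le> ?c S) * ?V" by (simp add: algebra_simps del: card_cube)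
      moreover have "?V > 0" using Mh by simp
      ultimately show ?thesis by (simp only: mult_le_cancel_right_pos)
    qed
    then show ?thesis by blast
  qed
  then show ?thesis by blast
qed

text \<open>Stage j merges, inside tiles of side \<open>r (Suc j)\<close>, clusters of size
  \<open>K j\<close> into clusters of size \<open>K (Suc j)\<close>, a fraction of a tile, while the
  density of vertices in such clusters halves. By \<open>small\<close> the entropy of the colourings
  uses up at most half of the cost of a cut; by \<open>err\<close> the other half gives an error of
  at most \<theta>0/2 times 2^(-j-1), so half of the initial probability survives all stages. Short
  edges belong to every \<open>FF j\<close>, so that unexposed pairs have distance at least
  \<open>R\<close>.\<close>

lemma iterate_stages:
  fixes r :: "nat \<Rightarrow> nat" and \<theta> :: "nat \<Rightarrow> real" and \<theta>0 c1 :: real and K :: "nat \<Rightarrow> real" and J B r0 :: nat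
  defines "\<theta> \<equiv> \<lambda>j. \<theta>0 / 2 ^ j"
    and "c1 \<equiv> \<beta> / (16 * q) * real CARD('d) powr (- s)"
    and "r \<equiv> \<lambda>j. r0 * B ^ (j * (j + 1) div 2)"
    and "FF \<equiv> \<lambda>j::nat. short r0 \<union> (if j = 0 then {} else tiled (r j))"
    and "\<Lambda> \<equiv> cube (0 :: int ^ 'd) (r J)"
  defines "Good \<equiv> \<lambda>j S. \<theta> j * real (card \<Lambda>) \<le> real (card {x \<in> \<Lambda>. K j \<le> real (card (cl (S \<inter> FF j) x))})"
  assumes \<theta>0: "0 < \<theta>0" "\<theta>0 \<le> 1" and B: "2 ^ (CARD('d) + 5) / \<theta>0\<^sup>2 \<le> real B" "B \<ge> 2"
    and r0: "r0 \<ge> R" and \<beta>: "\<beta> > 0"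
    and K0: "K 0 > 0" and K_Suc: "\<And>j. K (Suc j) = (\<theta> (Suc j))\<^sup>2 * real (r (Suc j) ^ CARD('d)) / 4"
    and small: "\<And>j. ln 2 / K j \<le> c1 * (\<theta> (Suc j))\<^sup>2 * real (r (Suc j)) powr (real CARD('d) - s) / 2"
    and err: "\<And>j. 4 * 2 ^ Suc j / \<theta>0 \<le> c1 * (\<theta> (Suc j))\<^sup>2 * real (r (Suc j)) powr (2 * real CARD('d) - s)"
    and start: "\<theta>0 \<le> pr (pairs \<Lambda>) (Good 0)"
  shows "\<theta>0 / 2 \<le> pr (pairs \<Lambda>) (Good J)"
proof -
  have r0_pos: "r0 > 0" using r0 R_pos by simp
  have r_pos: "r j > 0" for j using r0_pos B by (simp add: r_def)
  have \<theta>_pos: "\<theta> j > 0" for j using \<theta>0 by (simp add: \<theta>_def)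
  have r_Suc: "r (Suc j) = r j * B ^ Suc j" for j
  proof -
    have "Suc j * (Suc j + 1) div 2 = j * (j + 1) div 2 + Suc j" by simp
    then show ?thesis unfolding r_def by (simp only: power_add mult.assoc)
  qed
  have r_dvd: "r i dvd r j" if "i \<le> j" for i j
    using that by (induct j rule: dec_induct) (auto simp: r_Suc)
  have r0_le: "r0 \<le> r j" for j using dvd_imp_le[OF r_dvd[of 0 j] r_pos] by (simp add: r_def)
  have K_pos: "K j > 0" for j
  proof (cases j)
    case (Suc i)
    have "0 < (\<theta> (Suc i))\<^sup>2 * real (r (Suc i) ^ CARD('d)) / 4"
      using \<theta>_pos[of "Suc i"] r_pos[of "Suc i"] by (intro divide_pos_pos mult_pos_pos) auto
    then show ?thesis unfolding Suc K_Suc .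
  qed (simp add: K0)
  have c1: "c1 > 0" using \<beta> q_ge_1 by (simp add: c1_def)
  have FF_mono: "FF j \<subseteq> FF (Suc j)" for j
    using tiled_mono[OF r_pos r_pos r_dvd[of j "Suc j"]] by (auto simp: FF_def)
  have step: "pr (pairs \<Lambda>) (\<lambda>S. Good j S \<and> \<not> Good (Suc j) S) \<le> \<theta>0 / 2 * (1 / 2) ^ Suc j" if j: "j < J" for j
  proof -
    let ?r = "r (Suc j)"
    let ?\<theta> = "\<theta> (Suc j)"
    obtain C where C: "r J = C * ?r" using r_dvd[of "Suc j" J] j by (auto simp: dvd_def mult.commute)
    have C1: "C \<ge> 1" using C r_pos[of J] by (cases C) auto
    let ?F = "pairs \<Lambda> \<inter> FF j" and ?F' = "pairs \<Lambda> \<inter> FF (Suc j)"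
    have \<Lambda>: "\<Lambda> = cube 0 (C * ?r)" by (simp add: \<Lambda>_def C)
    \<comment> \<open>The exposed neighbours of a vertex, at most 2 (2 r_j)^d in number, must be a
      small part of the new tile. The size of \<open>B\<close> outweighs both the factor 2^(d+3) and
      the loss 4^(j+1) in the squared density.\<close>
    have rB: "8 * (2 * real (r j)) ^ CARD('d) \<le> ?\<theta>\<^sup>2 * real (?r ^ CARD('d))"
    proof -
      let ?D = "CARD('d)"
      have b: "2 ^ (?D + 3) * 4 ^ Suc j / \<theta>0\<^sup>2 \<le> real B ^ Suc j"
      proof -
        have t1: "1 \<le> 2 ^ (?D + 3) / \<theta>0\<^sup>2"
        proof -
          have "\<theta>0\<^sup>2 \<le> 1" using \<theta>0 by (simp add: power_le_one)
          also have "(1::real) \<le> 2 ^ (?D + 3)" by simp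
          finally show ?thesis using \<theta>0 by (simp add: pos_le_divide_eq)
        qed
        have "2 ^ (?D + 3) * 4 ^ Suc j / \<theta>0\<^sup>2 = (2 ^ (?D + 3) / \<theta>0\<^sup>2) ^ 1 * 4 ^ Suc j" by simp
        also have "\<dots> \<le> (2 ^ (?D + 3) / \<theta>0\<^sup>2) ^ Suc j * 4 ^ Suc j"
          using t1 by (intro mult_right_mono power_increasing) auto
        also have "\<dots> = (2 ^ (?D + 5) / \<theta>0\<^sup>2) ^ Suc j"
          unfolding power_mult_distrib[symmetric] by (simp add: power_add mult.commute)
        also have "\<dots> \<le> real B ^ Suc j" using B \<theta>0 by (intro power_mono) auto
        finally show ?thesis .
      qed
      have "real B ^ Suc j * 1 \<le> (real B ^ Suc j) ^ ?D"
      proof -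
        have "1 \<le> real B ^ Suc j" using B by (intro one_le_power) auto
        then show ?thesis using self_le_power[of "real B ^ Suc j" ?D] by simp
      qed
      then have "2 ^ (?D + 3) * 4 ^ Suc j / \<theta>0\<^sup>2 \<le> (real B ^ Suc j) ^ ?D" using b by simp
      then have "2 ^ (?D + 3) \<le> ?\<theta>\<^sup>2 * (real B ^ Suc j) ^ ?D"
      proof -
        assume a: "2 ^ (?D + 3) * 4 ^ Suc j / \<theta>0\<^sup>2 \<le> (real B ^ Suc j) ^ ?D"
        have t: "?\<theta>\<^sup>2 = \<theta>0\<^sup>2 / 4 ^ Suc j"
          by (simp add: \<theta>_def power_divide power_mult[symmetric] power2_eq_square power_mult_distrib[symmetric])
        have "2 ^ (?D + 3) = \<theta>0\<^sup>2 / 4 ^ Suc j * (2 ^ (?D + 3) * 4 ^ Suc j / \<theta>0\<^sup>2)" using \<theta>0 by simp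
        also have "\<dots> \<le> \<theta>0\<^sup>2 / 4 ^ Suc j * (real B ^ Suc j) ^ ?D" using a by (intro mult_left_mono) auto
        finally show ?thesis unfolding t .
      qed
      then have "2 ^ (?D + 3) * real (r j) ^ ?D \<le> ?\<theta>\<^sup>2 * (real B ^ Suc j) ^ ?D * real (r j) ^ ?D"
        by (intro mult_right_mono) auto
      moreover have "real (?r ^ ?D) = real (r j) ^ ?D * (real B ^ Suc j) ^ ?D"
        by (simp only: r_Suc of_nat_power of_nat_mult power_mult_distrib)
      ultimately show ?thesis by (simp add: power_add power_mult_distrib mult_ac)
    qed
    have "pr (pairs \<Lambda>) (\<lambda>S. \<theta> j * real (card \<Lambda>) \<le> real (card {x \<in> \<Lambda>. K j \<le> real (card (cl (S \<inter> ?F) x))}) \<and>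
        real (card {x \<in> \<Lambda>. ?\<theta>\<^sup>2 * real (?r ^ CARD('d)) / 4 \<le> real (card (cl (S \<inter> ?F') x))}) < (\<theta> j - ?\<theta>) * real (card \<Lambda>))
      \<le> exp (real (card \<Lambda>) *
        (ln 2 / K j - \<beta> / (16 * q) * ?\<theta>\<^sup>2 * real (?r ^ CARD('d)) * (real CARD('d) * ?r) powr (- s)))"
      unfolding \<Lambda>
    proof (rule coloring_stage)
      show "1 \<le> ?r" using r_pos[of "Suc j"] by simp
      show "pairs (cube 0 (C * ?r)) \<inter> FF j \<subseteq> pairs (cube 0 (C * ?r)) \<inter> FF (Suc j)" using FF_mono by blast
    next
      fix x z :: "int ^ 'd" assume z: "z \<in> cube 0 C" "x \<in> tile 0 ?r z"
      let ?N1 = "{y. l1_norm (y - x) < real r0}" and ?N2 = "{y. y \<noteq> x \<and> {x, y} \<in> tiled (r j)}"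
      have "{y \<in> tile 0 ?r z. y = x \<or> {x, y} \<in> pairs (cube 0 (C * ?r)) \<inter> FF j} \<subseteq> ?N1 \<union> ?N2"
      proof
        fix y assume y: "y \<in> {y \<in> tile 0 ?r z. y = x \<or> {x, y} \<in> pairs (cube 0 (C * ?r)) \<inter> FF j}"
        show "y \<in> ?N1 \<union> ?N2"
        proof (cases "y = x")
          case True
          then show ?thesis using r0_pos by (simp add: l1_norm_def)
        next
          case False
          then show ?thesis using y by (auto simp: FF_def short_iff l1_norm_minus[of y x] split: if_splits)
        qed
      qed
      then have "card {y \<in> tile 0 ?r z. y = x \<or> {x, y} \<in> pairs (cube 0 (C * ?r)) \<inter> FF j} \<le> card (?N1 \<union> ?N2)"
        using card_l1_ball(1)[of x r0] card_tiled_neighbours(1)[OF r_pos[of j], of x] by (intro card_mono) auto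
      also have "\<dots> \<le> card ?N1 + card ?N2" by (rule card_Un_le)
      also have "\<dots> \<le> (2 * r0) ^ CARD('d) + r j ^ CARD('d)"
        by (intro add_mono card_l1_ball card_tiled_neighbours r_pos)
      also have "\<dots> \<le> (2 * r j) ^ CARD('d) + (2 * r j) ^ CARD('d)"
        using r0_le[of j] by (intro add_mono power_mono) auto
      finally have "card {y \<in> tile 0 ?r z. y = x \<or> {x, y} \<in> pairs (cube 0 (C * ?r)) \<inter> FF j} \<le> 2 * (2 * r j) ^ CARD('d)"
        by simp
      then have "real (card {y \<in> tile 0 ?r z. y = x \<or> {x, y} \<in> pairs (cube 0 (C * ?r)) \<inter> FF j}) \<le> real (2 * (2 * r j) ^ CARD('d))"
        unfolding of_nat_le_iff .
      then show "4 * real (card {y \<in> tile 0 ?r z. y = x \<or> {x, y} \<in> pairs (cube 0 (C * ?r)) \<inter> FF j})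
          \<le> ?\<theta>\<^sup>2 * real (?r ^ CARD('d))"
        using rB by simp
    next
      fix x y z :: "int ^ 'd" assume z: "z \<in> cube 0 C" "x \<in> tile 0 ?r z" "y \<in> tile 0 ?r z" "x \<noteq> y"
        "{x, y} \<notin> pairs (cube 0 (C * ?r)) \<inter> FF j"
      then have p: "{x, y} \<in> pairs (cube 0 (C * ?r))" using tile_subset[OF z(1), of 0 ?r] by (intro pairsI) auto
      have "{x, y} \<in> pairs (tile 0 ?r z)" using z by (intro pairsI)
      then have "{x, y} \<in> tiled ?r" unfolding tiled_def by blast
      then have "{x, y} \<in> FF (Suc j)" by (simp add: FF_def)
      moreover have "{x, y} \<notin> short r0" using z(5) p by (simp add: FF_def)
      then have "real R \<le> l1_norm (x - y)" using r0 by (simp add: short_iff not_less)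
      ultimately show "{x, y} \<in> pairs (cube 0 (C * ?r)) \<inter> FF (Suc j) \<and> real R \<le> l1_norm (x - y)"
        using p by simp
    qed (use C1 \<theta>_pos K_pos in auto)
    \<comment> \<open>By \<open>small\<close> half of the cost survives the entropy. The volume of
      the cube is then bounded below by that of a single tile.\<close>
    also have "\<dots> \<le> exp (- (c1 * ?\<theta>\<^sup>2 * real ?r powr (2 * real CARD('d) - s) / 2))"
    proof -
      let ?D = "real CARD('d)"
      have e: "\<beta> / (16 * q) * ?\<theta>\<^sup>2 * real (?r ^ CARD('d)) * (?D * ?r) powr (- s) = c1 * ?\<theta>\<^sup>2 * real ?r powr (?D - s)"
      proof -
        have "real (?r ^ CARD('d)) = real ?r powr ?D" using r_pos[of "Suc j"] by (simp add: powr_realpow)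
        moreover have "(?D * ?r) powr (- s) = ?D powr (- s) * real ?r powr (- s)" by (simp add: powr_mult)
        moreover have "real ?r powr (?D - s) = real ?r powr ?D * real ?r powr (- s)" by (simp add: powr_add[symmetric])
        ultimately show ?thesis by (simp add: c1_def mult_ac)
      qed
      have V: "real ?r powr ?D \<le> real (card \<Lambda>)"
      proof -
        have "?r \<le> r J" using dvd_imp_le[OF r_dvd r_pos] j by simp
        then have "?r ^ CARD('d) \<le> r J ^ CARD('d)" by (rule power_mono) simp
        then have "real (?r ^ CARD('d)) \<le> real (card \<Lambda>)" unfolding \<Lambda>_def card_cube of_nat_le_iff .
        then show ?thesis using r_pos[of "Suc j"] by (simp add: powr_realpow)
      qed
      let ?y = "c1 * ?\<theta>\<^sup>2 * real ?r powr (?D - s) / 2"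
      have "real (card \<Lambda>) * (ln 2 / K j - c1 * ?\<theta>\<^sup>2 * real ?r powr (?D - s)) \<le> real (card \<Lambda>) * (- ?y)"
      proof (rule mult_left_mono)
        show "ln 2 / K j - c1 * ?\<theta>\<^sup>2 * real ?r powr (?D - s) \<le> - ?y" using small[of j] by linarith
      qed simp
      also have "\<dots> \<le> real ?r powr ?D * (- ?y)"
        using V c1 by (intro mult_right_mono_neg) auto
      also have "\<dots> = - (c1 * ?\<theta>\<^sup>2 * real ?r powr (2 * ?D - s) / 2)"
      proof -
        have "real ?r powr (2 * ?D - s) = real ?r powr ?D * real ?r powr (?D - s)" by (simp add: powr_add[symmetric])
        then show ?thesis by simp
      qed
      finally show ?thesis unfolding e by simp
    qed
    also have "\<dots> \<le> 1 / (c1 * ?\<theta>\<^sup>2 * real ?r powr (2 * real CARD('d) - s) / 2)"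
      using c1 \<theta>_pos[of "Suc j"] r_pos[of "Suc j"] by (intro exp_minus_le_inverse) auto
    also have "\<dots> \<le> 1 / (4 * 2 ^ Suc j / \<theta>0 / 2)"
    proof (rule divide_left_mono)
      show "4 * 2 ^ Suc j / \<theta>0 / 2 \<le> c1 * ?\<theta>\<^sup>2 * real ?r powr (2 * real CARD('d) - s) / 2"
        using err[of j] by (intro divide_right_mono) auto
      have "0 < 4 * 2 ^ Suc j / \<theta>0 / 2" using \<theta>0 by simp
      moreover have "0 < c1 * ?\<theta>\<^sup>2 * real ?r powr (2 * real CARD('d) - s) / 2"
        using c1 \<theta>_pos[of "Suc j"] r_pos[of "Suc j"] by simp
      ultimately show "0 < c1 * ?\<theta>\<^sup>2 * real ?r powr (2 * real CARD('d) - s) / 2 * (4 * 2 ^ Suc j / \<theta>0 / 2)"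
        by (intro mult_pos_pos)
    qed simp
    also have "\<dots> = \<theta>0 / 2 * (1 / 2) ^ Suc j" by (simp add: power_one_over field_simps)
    finally have bound: "pr (pairs \<Lambda>) (\<lambda>S. \<theta> j * real (card \<Lambda>) \<le> real (card {x \<in> \<Lambda>. K j \<le> real (card (cl (S \<inter> ?F) x))}) \<and>
        real (card {x \<in> \<Lambda>. ?\<theta>\<^sup>2 * real (?r ^ CARD('d)) / 4 \<le> real (card (cl (S \<inter> ?F') x))}) < (\<theta> j - ?\<theta>) * real (card \<Lambda>))
      \<le> \<theta>0 / 2 * (1 / 2) ^ Suc j" .
    \<comment> \<open>Halving makes the density given up equal to the density that is kept.\<close>
    have half: "\<theta> j - ?\<theta> = ?\<theta>" by (simp add: \<theta>_def)
    have "pr (pairs \<Lambda>) (\<lambda>S. Good j S \<and> \<not> Good (Suc j) S) \<le>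
       pr (pairs \<Lambda>) (\<lambda>S. \<theta> j * real (card \<Lambda>) \<le> real (card {x \<in> \<Lambda>. K j \<le> real (card (cl (S \<inter> ?F) x))}) \<and>
        real (card {x \<in> \<Lambda>. ?\<theta>\<^sup>2 * real (?r ^ CARD('d)) / 4 \<le> real (card (cl (S \<inter> ?F') x))}) < (\<theta> j - ?\<theta>) * real (card \<Lambda>))"
    proof (rule pr_mono)
      fix S assume S: "S \<subseteq> pairs \<Lambda>" and G: "Good j S \<and> \<not> Good (Suc j) S"
      have "S \<inter> ?F = S \<inter> FF j" "S \<inter> ?F' = S \<inter> FF (Suc j)" using S by auto
      then show "\<theta> j * real (card \<Lambda>) \<le> real (card {x \<in> \<Lambda>. K j \<le> real (card (cl (S \<inter> ?F) x))}) \<and>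
        real (card {x \<in> \<Lambda>. ?\<theta>\<^sup>2 * real (?r ^ CARD('d)) / 4 \<le> real (card (cl (S \<inter> ?F') x))}) < (\<theta> j - ?\<theta>) * real (card \<Lambda>)"
        using G unfolding Good_def half K_Suc by (simp only: not_le)
    qed (simp add: \<Lambda>_def)
    then show ?thesis using bound by linarith
  qed
  have "\<theta>0 / 2 + \<theta>0 / 2 * (1 / 2) ^ j \<le> pr (pairs \<Lambda>) (Good j)" if "j \<le> J" for j
    using that
  proof (induct j)
    case 0
    then show ?case using start by simp
  next
    case (Suc j)
    have "pr (pairs \<Lambda>) (Good j) \<le> pr (pairs \<Lambda>) (\<lambda>S. (Good j S \<and> \<not> Good (Suc j) S) \<or> Good (Suc j) S)"
      by (rule pr_mono) (auto simp: \<Lambda>_def)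
    also have "\<dots> \<le> pr (pairs \<Lambda>) (\<lambda>S. Good j S \<and> \<not> Good (Suc j) S) + pr (pairs \<Lambda>) (Good (Suc j))"
      by (rule pr_disj) (simp add: \<Lambda>_def)
    also have "pr (pairs \<Lambda>) (\<lambda>S. Good j S \<and> \<not> Good (Suc j) S) \<le> \<theta>0 / 2 * (1 / 2) ^ Suc j"
      using Suc by (intro step) simp
    finally show ?case using Suc by simp
  qed
  then have "\<theta>0 / 2 + \<theta>0 / 2 * (1 / 2) ^ J \<le> pr (pairs \<Lambda>) (Good J)" by blast
  moreover have "0 \<le> \<theta>0 / 2 * (1 / 2) ^ J" using \<theta>0 by simp
  ultimately show ?thesis by linarith
qed


text \<open>The order of the choices: \<open>A\<close>, and with it \<open>G\<close>, comes from the
  first merging stage; they fix \<open>r1\<close>, then come the first scale \<open>r0\<close>, the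
  size \<open>K 0\<close>, the cube side \<open>M1\<close>, and only then the number
  \<open>J\<close> of stages. The resulting positive probability is boosted by
  \<open>n ^ CARD('d)\<close> tiles; \<open>n\<close> is fixed early because it enters
  \<open>Q3\<close>.\<close>

lemma large_finite_clusters:
  fixes \<theta> \<rho> \<eta> :: real
  assumes \<beta>: "\<beta> > 0"
    and perc: "\<And>m :: real. \<exists>V. finite V \<and> 0 \<in> V \<and> \<theta> \<le> pr (pairs V) (\<lambda>S. m \<le> real (card (cl S 0)))"
    and \<theta>: "\<theta> > 0" and \<rho>: "\<rho> > 0" and \<eta>: "\<eta> > 0"
  shows "\<exists>N\<ge>1. 1 - \<eta> < pr (pairs (cube 0 N)) (has_big (cube 0 N) (cube (0 :: int ^ 'd) N) (\<rho> * real N powr (s / 2)))"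
proof -
  let ?D = "real CARD('d)"
  define \<theta>0 where "\<theta>0 = \<theta> / 4"
  have \<theta>1: "\<theta> \<le> 1"
  proof -
    obtain V where "finite V" "\<theta> \<le> pr (pairs V) (\<lambda>S. 0 \<le> real (card (cl S 0)))" using perc[of 0] by blast
    moreover have "pr (pairs V) (\<lambda>S. 0 \<le> real (card (cl S 0))) \<le> 1" using \<open>finite V\<close> by (intro pr_le_1) simp
    ultimately show ?thesis by linarith
  qed
  have \<theta>0: "0 < \<theta>0" "\<theta>0 \<le> 1" using \<theta> \<theta>1 by (auto simp: \<theta>0_def)
  define \<theta>j where "\<theta>j j = \<theta>0 / 2 ^ j" for j :: nat
  have \<theta>j_sq: "(\<theta>j j)\<^sup>2 = \<theta>0\<^sup>2 / 4 ^ j" for j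
  proof -
    have "(2 ^ j)\<^sup>2 = (4 :: real) ^ j" by (simp add: power2_eq_square power_mult_distrib[symmetric])
    then show ?thesis by (simp add: \<theta>j_def power_divide)
  qed
  have \<theta>j_pos: "\<theta>j j > 0" for j using \<theta>0 by (simp add: \<theta>j_def)
  define B where "B = max 2 (nat \<lceil>2 ^ (CARD('d) + 5) / \<theta>0\<^sup>2\<rceil>)"
  have B: "2 ^ (CARD('d) + 5) / \<theta>0\<^sup>2 \<le> real B" "B \<ge> 2" unfolding B_def by linarith+
  define c1 where "c1 = \<beta> / (16 * q) * ?D powr (- s)"
  have c1: "c1 > 0" using \<beta> q_ge_1 by (simp add: c1_def)
  define \<alpha> where "\<alpha> = s - ?D"
  define \<delta> where "\<delta> = 2 * ?D - s"
  have \<alpha>: "\<alpha> > 0" and \<delta>: "\<delta> > 0" using dim_less less_dim by (auto simp: \<alpha>_def \<delta>_def)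
  have l2: "ln 2 > (0 :: real)" by simp
  have "\<exists>k. (1 - \<theta>0 / 2) ^ k < \<eta>" using \<theta>0 \<eta> by (intro real_arch_pow_inv) auto
  then obtain k where k: "(1 - \<theta>0 / 2) ^ k < \<eta>" by auto
  define n where "n = k + 1"
  have n: "(1 - \<theta>0 / 2) ^ (n ^ CARD('d)) < \<eta>"
  proof -
    have "n \<le> n ^ CARD('d)" by (rule self_le_power) (auto simp: n_def)
    then have "(1 - \<theta>0 / 2) ^ (n ^ CARD('d)) \<le> (1 - \<theta>0 / 2) ^ k"
      using \<theta>0 by (intro power_decreasing) (auto simp: n_def)
    then show ?thesis using k by linarith
  qed
  \<comment> \<open>Makes the condition \<open>small\<close> of \<open>iterate_stages\<close> an
    equality for j = 0.\<close>
  define A where "A = 8 * ln 2 * real B powr \<alpha> / (c1 * \<theta>0\<^sup>2)"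
  have A: "A > 0" using B c1 \<theta>0 by (simp add: A_def)
  obtain c2 where c2: "c2 > 0" and c2': "\<forall>r\<ge>R. \<forall>x W. finite W \<longrightarrow> (\<forall>y\<in>W. real r \<le> l1_norm (x - y)) \<longrightarrow>
      (\<Sum>y\<in>W. P (x - y)) \<le> c2 * real r powr (?D - s)"
    using tail_sum by (elim exE conjE)
  define G where "G = A * (\<beta> * c2)"
  have G: "G \<ge> 0" using A \<beta> c2 by (simp add: G_def)
  obtain r1 :: nat where r1: "\<forall>r\<ge>r1. \<forall>K>0.
     (\<forall>u W. finite W \<longrightarrow> (\<forall>v\<in>W. real r \<le> l1_norm (u - v)) \<longrightarrow> K * (\<beta> * (\<Sum>v\<in>W. P (u - v))) \<le> G) \<longrightarrow>
     (\<exists>M1. \<forall>M\<ge>M1. \<theta> / 4 \<le> pr (pairs (cube (0 :: int ^ 'd) M)) (\<lambda>S. \<theta> / 4 * real (card (cube (0 :: int ^ 'd) M)) \<le>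
        real (card {x \<in> cube 0 M. K \<le> real (card (cl (S \<inter> short r) x))})))"
    using stage0[OF perc \<theta> G] by (elim exE)
  \<comment> \<open>\<open>Q1\<close> serves \<open>small\<close> for j > 0, \<open>Q2\<close>
    serves \<open>err\<close>, and \<open>Q3\<close> the comparison of the final size
    \<open>K J\<close> with the criterion. \<open>Y\<close> dominates the geometric factors 8^j,
    16^j and 16^j B^(\<alpha> j) that occur there.\<close>
  define Q1 where "Q1 = 32 * ln 2 * real B powr \<alpha> / (c1 * \<theta>0 ^ 4)"
  define Q2 where "Q2 = 4 / (c1 * \<theta>0 ^ 3)"
  define Q3 where "Q3 = (4 * \<rho> * real n powr (s / 2) / \<theta>0\<^sup>2)\<^sup>2"
  define Y where "Y = 16 * real B powr \<alpha>"
  have Q: "Q1 \<ge> 0" "Q2 \<ge> 0" "Q3 \<ge> 0" using c1 \<theta>0 by (auto simp: Q1_def Q2_def Q3_def)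
  have "1 \<le> real B powr \<alpha>" using B \<alpha> by (intro ge_one_powr_ge_zero) auto
  then have Y: "Y \<ge> 16" by (simp add: Y_def)
  obtain r2 :: nat where r2: "\<And>r j. r \<ge> r2 \<Longrightarrow> (Q1 + Q2 + Q3) * Y ^ j \<le> real (r * B ^ (j * (j + 1) div 2)) powr \<delta>"
    using superexponential_growth[of "Q1 + Q2 + Q3" Y \<delta> B] Q Y \<delta> B by auto
  define r0 where "r0 = max (max r1 r2) R"
  define r where "r j = r0 * B ^ (j * (j + 1) div 2)" for j
  have r0: "r0 \<ge> R" "r0 \<ge> r1" "r0 \<ge> r2" "r0 \<ge> 1" using R_pos by (auto simp: r0_def)
  have r_pos: "r j > 0" for j using r0 B by (simp add: r_def)
  have u: "Q1 * Y ^ j \<le> real (r j) powr \<delta>" "Q2 * Y ^ j \<le> real (r j) powr \<delta>" "Q3 * Y ^ j \<le> real (r j) powr \<delta>" for j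
  proof -
    have *: "(Q1 + Q2 + Q3) * Y ^ j \<le> real (r j) powr \<delta>" using r2[OF r0(3)] by (simp add: r_def)
    have "Q1 * Y ^ j \<le> (Q1 + Q2 + Q3) * Y ^ j" "Q2 * Y ^ j \<le> (Q1 + Q2 + Q3) * Y ^ j" "Q3 * Y ^ j \<le> (Q1 + Q2 + Q3) * Y ^ j"
      using Q Y by (intro mult_right_mono; simp)+
    then show "Q1 * Y ^ j \<le> real (r j) powr \<delta>" "Q2 * Y ^ j \<le> real (r j) powr \<delta>" "Q3 * Y ^ j \<le> real (r j) powr \<delta>"
      using * by linarith+
  qed
  have r_Suc: "r (Suc j) = r j * B ^ Suc j" for j
  proof -
    have "Suc j * (Suc j + 1) div 2 = j * (j + 1) div 2 + Suc j" by simp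
    then show ?thesis unfolding r_def by (simp only: power_add mult.assoc)
  qed
  define K where "K j = (if j = 0 then A * real r0 powr \<alpha> else (\<theta>j j)\<^sup>2 * real (r j ^ CARD('d)) / 4)" for j
  have K0: "K 0 > 0" using A r0 by (simp add: K_def)
  have tail: "K 0 * (\<beta> * (\<Sum>v\<in>W. P (x - v))) \<le> G" if "finite W" "\<forall>v\<in>W. real r0 \<le> l1_norm (x - v)" for x W
  proof -
    have "K 0 * (\<beta> * (\<Sum>v\<in>W. P (x - v))) \<le> K 0 * (\<beta> * (c2 * real r0 powr (?D - s)))"
    proof (intro mult_left_mono)
      show "(\<Sum>v\<in>W. P (x - v)) \<le> c2 * real r0 powr (?D - s)"
        by (rule c2'[rule_format]) (use r0 that in auto)
    qed (use K0 \<beta> in auto)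
    also have "\<dots> = A * (\<beta> * c2) * (real r0 powr \<alpha> * real r0 powr (?D - s))" by (simp add: K_def)
    also have "real r0 powr \<alpha> * real r0 powr (?D - s) = 1" using r0 by (simp add: powr_add[symmetric] \<alpha>_def)
    finally show ?thesis by (simp add: G_def)
  qed
  have "\<forall>u W. finite W \<longrightarrow> (\<forall>v\<in>W. real r0 \<le> l1_norm (u - v)) \<longrightarrow> K 0 * (\<beta> * (\<Sum>v\<in>W. P (u - v))) \<le> G"
    by (intro allI impI tail)
  from r1[THEN spec, THEN mp, OF r0(2), THEN spec, THEN mp, OF K0, THEN mp, OF this]
  obtain M1 where M1: "\<forall>M\<ge>M1. \<theta> / 4 \<le> pr (pairs (cube (0 :: int ^ 'd) M)) (\<lambda>S. \<theta> / 4 * real (card (cube (0 :: int ^ 'd) M)) \<le>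
        real (card {x \<in> cube 0 M. K 0 \<le> real (card (cl (S \<inter> short r0) x))}))"
    by (elim exE)
  \<comment> \<open>Positive, so that \<open>K J\<close> is a merged size and not the initial one,
    and large enough for the cube of side \<open>r J\<close> to be beyond \<open>M1\<close>.\<close>
  define J where "J = M1 + 1"
  have rJ: "r J \<ge> M1"
  proof -
    have "J * 2 \<le> J * (J + 1)" by (intro mult_left_mono) (auto simp: J_def)
    then have "J * 2 div 2 \<le> J * (J + 1) div 2" by (rule div_le_mono)
    then have "J \<le> J * (J + 1) div 2" by simp
    then have "(2::nat) ^ J \<le> 2 ^ (J * (J + 1) div 2)" by (rule power_increasing) simp
    also have "\<dots> \<le> B ^ (J * (J + 1) div 2)" using B by (intro power_mono) auto
    also have "\<dots> \<le> r J" using r0 by (simp add: r_def)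
    finally have "2 ^ J \<le> r J" .
    then show ?thesis using less_exp[of J] by (simp add: J_def)
  qed
  let ?\<Lambda> = "cube (0 :: int ^ 'd) (r J)"
  let ?FF = "\<lambda>j::nat. short r0 \<union> (if j = 0 then {} else tiled (r j))"
  let ?Good = "\<lambda>j S. \<theta>j j * real (card ?\<Lambda>) \<le> real (card {x \<in> ?\<Lambda>. K j \<le> real (card (cl (S \<inter> ?FF j) x))})"
  have "\<theta>0 / 2 \<le> pr (pairs ?\<Lambda>) (?Good J)"
    unfolding \<theta>j_def r_def
  proof (rule iterate_stages)
    show "K (Suc j) = (\<theta>0 / 2 ^ Suc j)\<^sup>2 * real ((r0 * B ^ (Suc j * (Suc j + 1) div 2)) ^ CARD('d)) / 4" for j
      by (simp only: K_def \<theta>j_def r_def) simp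
  next
    fix j
    have "ln 2 / K j \<le> c1 * (\<theta>j (Suc j))\<^sup>2 * real (r (Suc j)) powr (?D - s) / 2"
    proof (cases j)
      case 0
      have rs: "real (r (Suc 0)) powr (?D - s) = real r0 powr (- \<alpha>) * real B powr (- \<alpha>)"
        by (simp add: r_def powr_mult \<alpha>_def)
      have "ln 2 / K 0 = ln 2 / A * real r0 powr (- \<alpha>)" by (simp add: K_def powr_minus_divide)
      also have "ln 2 / A = c1 * \<theta>0\<^sup>2 / 8 * real B powr (- \<alpha>)"
        using B c1 \<theta>0 by (simp add: A_def powr_minus_divide field_simps)
      finally show ?thesis unfolding 0 rs \<theta>j_sq by simp
    next
      case (Suc i)
      have j0: "j \<noteq> 0" using Suc by simp
      let ?b = "(real B powr \<alpha>) ^ Suc j"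
      have rs: "real (r (Suc j)) powr (?D - s) = real (r j) powr (- \<alpha>) / ?b"
      proof -
        have "real (r (Suc j)) powr (- \<alpha>) = real (r j) powr (- \<alpha>) * (real B ^ Suc j) powr (- \<alpha>)"
          by (simp only: r_Suc of_nat_mult of_nat_power powr_mult)
        also have "(real B ^ Suc j) powr (- \<alpha>) = 1 / ?b"
        proof -
          have "(real B ^ Suc j) powr \<alpha> = ?b"
            using B by (subst (1 2) powr_realpow[symmetric]) (auto simp: powr_powr mult.commute)
          then show ?thesis by (simp only: powr_minus_divide)
        qed
        finally show ?thesis by (simp add: \<alpha>_def)
      qed
      have rp: "real (r j) powr (- \<alpha>) * real (r j) powr ?D = real (r j) powr \<delta>"
        by (simp add: powr_add[symmetric] \<alpha>_def \<delta>_def)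
      have Dp: "real (r j ^ CARD('d)) = real (r j) powr ?D" using r_pos[of j] by (simp add: powr_realpow)
      have "ln 2 = c1 * \<theta>0 ^ 4 / (4 ^ Suc j * 4 ^ j * 8 * ?b) * (Q1 * Y ^ j)"
      proof -
        have s16: "(16::real) ^ j = 4 ^ j * 4 ^ j" unfolding power_mult_distrib[symmetric] by simp
        have "Q1 * Y ^ j = 8 * ln 2 * (4 ^ Suc j * 4 ^ j * ?b) / (c1 * \<theta>0 ^ 4)"
          unfolding Q1_def Y_def by (simp add: power_mult_distrib s16)
        then show ?thesis using c1 \<theta>0 B by simp
      qed
      also have "\<dots> \<le> c1 * \<theta>0 ^ 4 / (4 ^ Suc j * 4 ^ j * 8 * ?b) * real (r j) powr \<delta>"
        using u(1)[of j] c1 by (intro mult_left_mono) auto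
      also have "\<dots> = (c1 * (\<theta>0\<^sup>2 / 4 ^ Suc j) * (real (r j) powr (- \<alpha>) / ?b) / 2) * (\<theta>0\<^sup>2 / 4 ^ j * real (r j) powr ?D / 4)"
        unfolding rp[symmetric] by (simp add: power2_eq_square power4_eq_xxxx mult_ac)
      finally have "ln 2 \<le> (c1 * (\<theta>j (Suc j))\<^sup>2 * real (r (Suc j)) powr (?D - s) / 2) * K j"
        unfolding \<theta>j_sq rs K_def Dp using j0 by simp
      moreover have "K j > 0" using j0 \<theta>j_pos[of j] r_pos[of j] by (simp add: K_def)
      ultimately show ?thesis by (simp only: pos_divide_le_eq)
    qed
    then show "ln 2 / K j \<le> \<beta> / (16 * q) * ?D powr - s * (\<theta>0 / 2 ^ Suc j)\<^sup>2 *
        real (r0 * B ^ (Suc j * (Suc j + 1) div 2)) powr (?D - s) / 2"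
      unfolding c1_def \<theta>j_def r_def .
  next
    fix j
    have "4 * 2 ^ Suc j / \<theta>0 = c1 * \<theta>0\<^sup>2 / 4 ^ Suc j * (Q2 * 8 ^ Suc j)"
    proof -
      have "(8::real) ^ Suc j = 4 ^ Suc j * 2 ^ Suc j" unfolding power_mult_distrib[symmetric] by simp
      then show ?thesis using c1 \<theta>0 by (simp add: Q2_def power2_eq_square power3_eq_cube)
    qed
    also have "\<dots> \<le> c1 * \<theta>0\<^sup>2 / 4 ^ Suc j * (Q2 * Y ^ Suc j)"
      using c1 Q Y by (intro mult_left_mono power_mono) auto
    also have "\<dots> \<le> c1 * \<theta>0\<^sup>2 / 4 ^ Suc j * real (r (Suc j)) powr \<delta>"
      using c1 u(2)[of "Suc j"] by (intro mult_left_mono) auto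
    finally have "4 * 2 ^ Suc j / \<theta>0 \<le> c1 * (\<theta>j (Suc j))\<^sup>2 * real (r (Suc j)) powr (2 * ?D - s)"
      unfolding \<theta>j_sq \<delta>_def by simp
    then show "4 * 2 ^ Suc j / \<theta>0 \<le> \<beta> / (16 * q) * ?D powr - s * (\<theta>0 / 2 ^ Suc j)\<^sup>2 *
        real (r0 * B ^ (Suc j * (Suc j + 1) div 2)) powr (2 * ?D - s)"
      unfolding c1_def \<theta>j_def r_def .
  next
    show "\<theta>0 \<le> pr (pairs (cube (0 :: int ^ 'd) (r0 * B ^ (J * (J + 1) div 2))))
       (\<lambda>S. \<theta>0 / 2 ^ 0 * real (card (cube (0 :: int ^ 'd) (r0 * B ^ (J * (J + 1) div 2)))) \<le>
         real (card {x \<in> cube 0 (r0 * B ^ (J * (J + 1) div 2)). K 0 \<le> real (card (cl (S \<inter>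
           (short r0 \<union> (if (0::nat) = 0 then {} else tiled (r0 * B ^ (0 * (0 + 1) div 2))))) x))}))"
      using M1[THEN spec, THEN mp, OF rJ] unfolding \<theta>0_def r_def by simp
  qed (use \<theta>0 B r0 \<beta> K0 in auto)
  also have "\<dots> \<le> pr (pairs ?\<Lambda>) (has_big ?\<Lambda> ?\<Lambda> (K J))"
  proof (rule pr_mono)
    fix S assume S: "S \<subseteq> pairs ?\<Lambda>" and g: "?Good J S"
    have "0 < \<theta>j J * real (card ?\<Lambda>)" using \<theta>j_pos[of J] r_pos[of J] by simp
    then have "0 < card {x \<in> ?\<Lambda>. K J \<le> real (card (cl (S \<inter> ?FF J) x))}" using g by linarith
    then have "{x \<in> ?\<Lambda>. K J \<le> real (card (cl (S \<inter> ?FF J) x))} \<noteq> {}" using card_gt_0_iff by blast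
    then obtain x where x: "x \<in> ?\<Lambda>" "K J \<le> real (card (cl (S \<inter> ?FF J) x))" by blast
    have "card (cl (S \<inter> ?FF J) x) \<le> card (cl (S \<inter> pairs ?\<Lambda>) x)"
      using S by (intro card_mono finite_cl cl_mono) auto
    then have "K J \<le> real (card (cl (S \<inter> pairs ?\<Lambda>) x))" using x(2) by linarith
    then show "has_big ?\<Lambda> ?\<Lambda> (K J) S" unfolding has_big_def using x(1) by blast
  qed simp
  finally have p: "\<theta>0 / 2 \<le> pr (pairs ?\<Lambda>) (has_big ?\<Lambda> ?\<Lambda> (K J))" .
  let ?N = "n * r J"
  have "1 - (1 - \<theta>0 / 2) ^ (n ^ CARD('d)) \<le> pr (pairs (cube 0 ?N)) (has_big (cube 0 ?N) (cube (0 :: int ^ 'd) ?N) (K J))"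
    by (rule pr_boost) (use r_pos[of J] p in auto)
  also have "\<dots> \<le> pr (pairs (cube 0 ?N)) (has_big (cube 0 ?N) (cube (0 :: int ^ 'd) ?N) (\<rho> * real ?N powr (s / 2)))"
  proof (rule pr_mono)
    have J0: "J \<noteq> 0" by (simp add: J_def)
    \<comment> \<open>The threshold N^(s/2) lies below (r J)^d by the power \<delta>/2 of
      \<open>r J\<close>, and by the choice of \<open>Q3\<close> this surplus pays for 4^J and all
      constants.\<close>
    have "(4 * \<rho> * real n powr (s / 2) / \<theta>0\<^sup>2 * 4 ^ J)\<^sup>2 = Q3 * 16 ^ J"
    proof -
      have "((4::real) ^ J)\<^sup>2 = 16 ^ J" unfolding power2_eq_square power_mult_distrib[symmetric] by simp
      then show ?thesis unfolding Q3_def power_mult_distrib[of _ "4 ^ J"] by (simp only:)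
    qed
    also have "\<dots> \<le> Q3 * Y ^ J" using Y Q by (intro mult_left_mono power_mono) auto
    also have "\<dots> \<le> real (r J) powr \<delta>" by (rule u)
    also have "\<dots> = (real (r J) powr (\<delta> / 2))\<^sup>2" by (simp add: power2_eq_square powr_add[symmetric])
    finally have *: "4 * \<rho> * real n powr (s / 2) / \<theta>0\<^sup>2 * 4 ^ J \<le> real (r J) powr (\<delta> / 2)"
      by (rule power2_le_imp_le) simp
    have "\<rho> * real ?N powr (s / 2) = \<theta>0\<^sup>2 / 4 ^ J / 4 * (4 * \<rho> * real n powr (s / 2) / \<theta>0\<^sup>2 * 4 ^ J) * real (r J) powr (s / 2)"
      using \<theta>0 by (simp add: powr_mult)
    also have "\<dots> \<le> \<theta>0\<^sup>2 / 4 ^ J / 4 * real (r J) powr (\<delta> / 2) * real (r J) powr (s / 2)"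
      using * by (intro mult_right_mono mult_left_mono) auto
    also have "\<dots> = \<theta>0\<^sup>2 / 4 ^ J / 4 * real (r J) powr ?D"
    proof -
      have "\<delta> / 2 + s / 2 = ?D" by (simp add: \<delta>_def field_simps)
      then have "real (r J) powr (\<delta> / 2) * real (r J) powr (s / 2) = real (r J) powr ?D"
        by (simp only: powr_add[symmetric])
      then show ?thesis by (simp only: mult.assoc)
    qed
    also have "\<dots> = K J" using J0 r_pos[of J] by (simp add: K_def \<theta>j_sq powr_realpow)
    finally have le: "\<rho> * real ?N powr (s / 2) \<le> K J" .
    show "has_big (cube 0 ?N) (cube (0 :: int ^ 'd) ?N) (\<rho> * real ?N powr (s / 2)) S"
      if "has_big (cube 0 ?N) (cube (0 :: int ^ 'd) ?N) (K J) S" for S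
      by (rule has_big_mono[OF _ _ _ _ le that]) auto
  qed simp
  finally have "1 - \<eta> < pr (pairs (cube 0 ?N)) (has_big (cube 0 ?N) (cube (0 :: int ^ 'd) ?N) (\<rho> * real ?N powr (s / 2)))"
    using n by linarith
  moreover have "?N \<ge> 1" using r_pos[of J] by (simp add: n_def)
  ultimately show ?thesis by blast
qed

end

section \<open>The infinite volume limit\<close>

definition open_edges :: "'e set \<Rightarrow> ('e \<Rightarrow> bool) \<Rightarrow> 'e set" where
  "open_edges J \<omega> = {e \<in> J. \<omega> e}"

lemma open_edges_cylinder:
  fixes I :: "'e set"
  assumes "T \<subseteq> J" "J \<subseteq> I"
  shows "{\<omega> \<in> space (\<Pi>\<^sub>M e\<in>I. count_space UNIV). open_edges J \<omega> = T} =
    prod_emb I (\<lambda>_. count_space UNIV) J (\<Pi>\<^sub>E e\<in>J. {e \<in> T})"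
  using assms by (auto simp: open_edges_def prod_emb_def space_PiM restrict_def PiE_iff extensional_def)

lemma measurable_open_edges:
  assumes "finite J" "J \<subseteq> I"
  shows "open_edges J \<in> measurable (\<Pi>\<^sub>M e\<in>I. count_space UNIV) (count_space (Pow J))"
  using assms
proof (subst measurable_count_space_eq2, safe)
  show "x \<in> J" if "x \<in> open_edges J \<omega>" for x \<omega> using that by (simp add: open_edges_def)
  fix T assume "T \<subseteq> J"
  have "open_edges J -` {T} \<inter> space (\<Pi>\<^sub>M e\<in>I. count_space UNIV) = {\<omega> \<in> space (\<Pi>\<^sub>M e\<in>I. count_space UNIV). open_edges J \<omega> = T}"
    by auto
  also have "\<dots> \<in> sets (\<Pi>\<^sub>M e\<in>I. count_space UNIV)"
    unfolding open_edges_cylinder[OF \<open>T \<subseteq> J\<close> assms(2)] using assms by (intro sets_PiM_I) auto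
  finally show "open_edges J -` {T} \<inter> space (\<Pi>\<^sub>M e\<in>I. count_space UNIV) \<in> sets (\<Pi>\<^sub>M e\<in>I. count_space UNIV)" .
qed

text \<open>The finite-dimensional laws become probability mass functions on sets of open edges.
  They are transported to \<open>bool discrete\<close>, a Polish type, where the projective limit
  theorem applies, and the limit is mapped back to plain \<open>bool\<close>.\<close>

lemma kolmogorov_extension_bool:
  fixes g :: "'e set \<Rightarrow> 'e set \<Rightarrow> real" and I :: "'e set"
  assumes nonneg: "\<And>J T. finite J \<Longrightarrow> J \<subseteq> I \<Longrightarrow> T \<subseteq> J \<Longrightarrow> 0 \<le> g J T"
    and total: "\<And>J. finite J \<Longrightarrow> J \<subseteq> I \<Longrightarrow> (\<Sum>T\<in>Pow J. g J T) = 1"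
    and consistent: "\<And>J H T. finite H \<Longrightarrow> H \<subseteq> I \<Longrightarrow> J \<subseteq> H \<Longrightarrow> T \<subseteq> J \<Longrightarrow>
        g J T = (\<Sum>U\<in>{U \<in> Pow H. U \<inter> J = T}. g H U)"
  shows "\<exists>M. prob_space M \<and> sets M = sets (\<Pi>\<^sub>M e\<in>I. count_space UNIV) \<and>
     (\<forall>J T. finite J \<longrightarrow> J \<subseteq> I \<longrightarrow> T \<subseteq> J \<longrightarrow> measure M {\<omega> \<in> space M. open_edges J \<omega> = T} = g J T)"
proof -
  define f where "f J T = (if T \<subseteq> J then g J T else 0)" for J T
  define p where "p J = embed_pmf (f J)" for J
  have pmf_p: "pmf (p J) T = f J T" if "finite J" "J \<subseteq> I" for J T
    unfolding p_def
  proof (rule pmf_embed_pmf)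
    show "0 \<le> f J x" for x using nonneg that by (simp add: f_def)
    have "(\<integral>\<^sup>+x. ennreal (f J x) \<partial>count_space UNIV) = (\<Sum>x\<in>Pow J. ennreal (f J x))"
      using that by (intro nn_integral_count_space') (auto simp: f_def)
    also have "\<dots> = ennreal (\<Sum>x\<in>Pow J. f J x)"
      using that nonneg by (intro sum_ennreal) (auto simp: f_def)
    also have "(\<Sum>x\<in>Pow J. f J x) = 1" using total[OF that] by (simp add: f_def)
    finally show "(\<integral>\<^sup>+x. ennreal (f J x) \<partial>count_space UNIV) = 1" by simp
  qed
  have map_p: "map_pmf (\<lambda>T. T \<inter> J) (p H) = p J" if H: "finite H" "H \<subseteq> I" "J \<subseteq> H" for J H
  proof (rule pmf_eqI)
    fix T
    have J: "finite J" "J \<subseteq> I" using H finite_subset by auto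
    have s: "set_pmf (p H) \<subseteq> Pow H" using pmf_p[OF H(1,2)] by (auto simp: set_pmf_eq f_def split: if_splits)
    have "pmf (map_pmf (\<lambda>T. T \<inter> J) (p H)) T = measure (measure_pmf (p H)) ((\<lambda>T. T \<inter> J) -` {T})"
      by (simp add: pmf_map)
    also have "\<dots> = measure (measure_pmf (p H)) {U \<in> Pow H. U \<inter> J = T}"
      using s by (intro measure_pmf.finite_measure_eq_AE) (auto simp: AE_measure_pmf_iff)
    also have "\<dots> = (\<Sum>U\<in>{U \<in> Pow H. U \<inter> J = T}. pmf (p H) U)"
      using H by (intro measure_measure_pmf_finite) auto
    also have "\<dots> = (\<Sum>U\<in>{U \<in> Pow H. U \<inter> J = T}. g H U)"
      using H by (intro sum.cong) (auto simp: pmf_p f_def)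
    also have "\<dots> = f J T"
    proof (cases "T \<subseteq> J")
      case True
      then show ?thesis using consistent[OF H True] by (simp add: f_def)
    next
      case False
      then have e: "{U \<in> Pow H. U \<inter> J = T} = {}" by auto
      show ?thesis unfolding e using False by (simp add: f_def)
    qed
    finally show "pmf (map_pmf (\<lambda>T. T \<inter> J) (p H)) T = pmf (p J) T" using J by (simp add: pmf_p)
  qed
  let ?B = "\<lambda>_::'e. borel :: bool discrete measure"
  define h where "h J T = (\<lambda>e\<in>J. discrete (e \<in> T))" for J T :: "'e set"
  have h_meas: "h J \<in> measurable (measure_pmf (p H)) (PiM J ?B)" for J H
    by (auto simp: h_def space_PiM)
  define Q where "Q J = distr (measure_pmf (p J)) (PiM J ?B) (h J)" for J
  have Q_prob: "prob_space (Q J)" for J unfolding Q_def by (intro measure_pmf.prob_space_distr h_meas)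
  have Q_restrict: "Q J = distr (Q H) (PiM J ?B) (\<lambda>f. restrict f J)"
    if JH: "J \<subseteq> H" "finite H" "H \<subseteq> I" for J H
  proof -
    have "distr (Q H) (PiM J ?B) (\<lambda>f. restrict f J) = distr (measure_pmf (p H)) (PiM J ?B) ((\<lambda>f. restrict f J) \<circ> h H)"
      unfolding Q_def using JH by (intro distr_distr h_meas measurable_restrict_subset)
    also have "(\<lambda>f. restrict f J) \<circ> h H = h J \<circ> (\<lambda>T. T \<inter> J)"
      using JH by (auto simp: h_def fun_eq_iff restrict_def)
    also have "distr (measure_pmf (p H)) (PiM J ?B) (h J \<circ> (\<lambda>T. T \<inter> J)) =
        distr (distr (measure_pmf (p H)) (count_space UNIV) (\<lambda>T. T \<inter> J)) (PiM J ?B) (h J)"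
      by (subst distr_distr) (auto simp: h_def space_PiM)
    also have "\<dots> = Q J" unfolding Q_def map_pmf_rep_eq[symmetric] map_p[OF JH(2,3,1)] ..
    finally show ?thesis by (rule sym)
  qed
  have "projective_family I Q (\<lambda>_. borel)"
    by (rule projective_family.intro) (rule Q_restrict, assumption+, rule Q_prob)
  then interpret polish_projective I Q by (rule polish_projective.intro)
  let ?k = "\<lambda>\<omega>. \<lambda>e\<in>I. of_discrete (\<omega> e)"
  let ?N = "\<Pi>\<^sub>M e\<in>I. count_space (UNIV :: bool set)"
  have k: "?k \<in> measurable lim ?N"
  proof (rule measurable_PiM_single')
    fix e assume e: "e \<in> I"
    have "of_discrete \<in> measurable (borel :: bool discrete measure) (count_space UNIV)"
      by (auto simp: measurable_def open_discrete intro!: borel_open)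
    moreover have "(\<lambda>\<omega>. \<omega> e) \<in> measurable lim (borel :: bool discrete measure)"
      using e by (simp add: measurable_cong_sets[OF sets_lim refl])
    ultimately have "(\<lambda>\<omega>. of_discrete (\<omega> e)) \<in> measurable lim (count_space UNIV)"
      by (rule measurable_compose[rotated])
    then show "(\<lambda>\<omega>. (\<lambda>e\<in>I. of_discrete (\<omega> e)) e) \<in> measurable lim (count_space UNIV)" using e by simp
  qed (auto simp: space_PiM)
  define M where "M = distr lim ?N ?k"
  have "measure M {\<omega> \<in> space M. open_edges J \<omega> = T} = g J T" if J: "finite J" "J \<subseteq> I" "T \<subseteq> J" for J T
  proof -
    let ?X = "\<Pi>\<^sub>E e\<in>J. {discrete (e \<in> T)}"
    have X: "?X \<in> sets (PiM J ?B)" using J by (intro sets_PiM_I_finite) (auto simp: open_discrete intro!: borel_open)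
    have "open_edges J -` {T} \<inter> space ?N \<in> sets ?N"
      using measurable_sets[OF measurable_open_edges[OF J(1,2)], of "{T}"] J by simp
    moreover have "{\<omega> \<in> space M. open_edges J \<omega> = T} = open_edges J -` {T} \<inter> space ?N" by (auto simp: M_def)
    ultimately have "measure M {\<omega> \<in> space M. open_edges J \<omega> = T} = measure lim (?k -` (open_edges J -` {T} \<inter> space ?N) \<inter> space lim)"
      unfolding M_def using k by (simp add: measure_distr)
    also have "?k -` (open_edges J -` {T} \<inter> space ?N) \<inter> space lim = emb I J ?X"
    proof (intro set_eqI)
      fix \<omega>
      have "open_edges J (?k \<omega>) = T \<longleftrightarrow> (\<forall>e\<in>J. \<omega> e = discrete (e \<in> T))"
      proof -
        have "open_edges J (?k \<omega>) = {e \<in> J. of_discrete (\<omega> e)}" using J(2) by (auto simp: open_edges_def)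
        also have "\<dots> = T \<longleftrightarrow> (\<forall>e\<in>J. of_discrete (\<omega> e) = (e \<in> T))" using J(3) by auto
        also have "\<dots> \<longleftrightarrow> (\<forall>e\<in>J. \<omega> e = discrete (e \<in> T))"
        proof -
          have "of_discrete y = b \<longleftrightarrow> y = discrete b" for y :: "bool discrete" and b
            using discrete_inverse[of b] of_discrete_inverse[of y] by auto
          then show ?thesis by simp
        qed
        finally show ?thesis .
      qed
      moreover have "restrict \<omega> J \<in> ?X \<longleftrightarrow> (\<forall>e\<in>J. \<omega> e = discrete (e \<in> T))"
        by (simp add: PiE_iff)
      moreover have "?k \<omega> \<in> space ?N" by (simp add: space_PiM)
      ultimately show "\<omega> \<in> ?k -` (open_edges J -` {T} \<inter> space ?N) \<inter> space lim \<longleftrightarrow> \<omega> \<in> emb I J ?X"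
        by (simp add: prod_emb_def space_PiM)
    qed
    also have "measure lim (emb I J ?X) = measure (Q J) ?X" using J X by (intro measure_lim_emb)
    also have "\<dots> = measure (measure_pmf (p J)) (h J -` ?X)"
      unfolding Q_def using X h_meas by (subst measure_distr) auto
    also have "\<dots> = measure (measure_pmf (p J)) {T}"
    proof (rule measure_pmf.finite_measure_eq_AE)
      have s: "set_pmf (p J) \<subseteq> Pow J" using pmf_p[OF J(1,2)] by (auto simp: set_pmf_eq f_def split: if_splits)
      have "h J U \<in> ?X \<longleftrightarrow> U = T" if "U \<subseteq> J" for U
        using that J by (auto simp: h_def PiE_iff discrete_inject)
      then show "AE U in measure_pmf (p J). (U \<in> h J -` ?X) = (U \<in> {T})"
        using s by (auto simp: AE_measure_pmf_iff)
    qed auto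
    also have "\<dots> = g J T" using J by (simp add: measure_pmf_single pmf_p f_def)
    finally show ?thesis .
  qed
  moreover have "prob_space M" unfolding M_def by (intro P.prob_space_distr k)
  moreover have "sets M = sets ?N" by (simp add: M_def)
  ultimately show ?thesis by blast
qed

section \<open>Continuous and measurable functions of configurations, monotone nets\<close>

lemma topspace_config [simp]: "topspace config_topology = (\<Pi>\<^sub>E e\<in>pairs UNIV. UNIV)"
  by (simp add: config_topology_def)

lemma space_config [simp]: "space config_space = (\<Pi>\<^sub>E e\<in>pairs UNIV. UNIV)"
  by (simp add: config_space_def space_PiM)

text \<open>The preimage is a union of cylinders over \<open>J\<close>. Hence a weak limit
  determines the probabilities of all local events.\<close>

lemma continuous_map_open_edges:
  assumes "finite J" "J \<subseteq> pairs UNIV"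
  shows "continuous_map config_topology euclideanreal (\<lambda>\<omega>. F (open_edges J \<omega>))"
  unfolding continuous_map_def
proof (intro conjI allI impI)
  fix U :: "real set" assume "openin euclideanreal U"
  let ?C = "\<lambda>T. \<Pi>\<^sub>E e\<in>pairs UNIV. if e \<in> J then {e \<in> T} else UNIV"
  have "openin config_topology (?C T)" for T
    unfolding config_topology_def using assms(1)
    by (intro product_topology_basis) (auto intro: finite_subset[of _ J])
  then have "openin config_topology (\<Union>T\<in>{T. T \<subseteq> J \<and> F T \<in> U}. ?C T)" by (intro openin_Union) auto
  moreover have "{\<omega> \<in> topspace config_topology. F (open_edges J \<omega>) \<in> U} = (\<Union>T\<in>{T. T \<subseteq> J \<and> F T \<in> U}. ?C T)"
  proof (intro set_eqI iffI)
    fix \<omega> assume w: "\<omega> \<in> {\<omega> \<in> topspace config_topology. F (open_edges J \<omega>) \<in> U}"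
    then have "\<omega> \<in> ?C (open_edges J \<omega>)" by (auto simp: open_edges_def PiE_iff)
    moreover have "open_edges J \<omega> \<in> {T. T \<subseteq> J \<and> F T \<in> U}" using w by (auto simp: open_edges_def)
    ultimately show "\<omega> \<in> (\<Union>T\<in>{T. T \<subseteq> J \<and> F T \<in> U}. ?C T)" by blast
  next
    fix \<omega> assume "\<omega> \<in> (\<Union>T\<in>{T. T \<subseteq> J \<and> F T \<in> U}. ?C T)"
    then obtain T where T: "T \<subseteq> J" "F T \<in> U" "\<omega> \<in> ?C T" by auto
    have "\<omega> e = (e \<in> T)" if "e \<in> J" for e
      using T(3) that assms(2) by (auto simp: PiE_iff dest!: bspec[of _ _ e])
    then have "open_edges J \<omega> = T" using T(1) by (auto simp: open_edges_def)
    then show "\<omega> \<in> {\<omega> \<in> topspace config_topology. F (open_edges J \<omega>) \<in> U}" using T by (auto simp: PiE_iff)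
  qed
  ultimately show "openin config_topology {\<omega> \<in> topspace config_topology. F (open_edges J \<omega>) \<in> U}" by simp
qed auto

text \<open>Compactness of the product of two-point spaces: finitely many basic neighbourhoods, on
  each of which \<open>f\<close> stays within \<epsilon>/2 of its value at the centre, cover the
  space. \<open>J\<close> collects the finitely many edges that they restrict.\<close>

lemma continuous_map_local_approx:
  fixes f :: "('v set \<Rightarrow> bool) \<Rightarrow> real"
  assumes f: "continuous_map config_topology euclideanreal f" and \<epsilon>: "\<epsilon> > 0"
  shows "\<exists>J. finite J \<and> J \<subseteq> pairs UNIV \<and>
    (\<forall>\<omega>\<in>topspace config_topology. \<forall>\<omega>'\<in>topspace config_topology. open_edges J \<omega> = open_edges J \<omega>' \<longrightarrow> \<bar>f \<omega> - f \<omega>'\<bar> < \<epsilon>)"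
proof -
  let ?I = "pairs (UNIV :: 'v set)"
  let ?X = "config_topology :: ('v set \<Rightarrow> bool) topology"
  define nbhd where "nbhd \<omega> V \<longleftrightarrow> finite {e \<in> ?I. V e \<noteq> UNIV} \<and> openin ?X (\<Pi>\<^sub>E e\<in>?I. V e) \<and> \<omega> \<in> (\<Pi>\<^sub>E e\<in>?I. V e) \<and>
      (\<forall>\<omega>'\<in>(\<Pi>\<^sub>E e\<in>?I. V e). \<bar>f \<omega>' - f \<omega>\<bar> < \<epsilon> / 2)" for \<omega> V
  have "\<exists>V. nbhd \<omega> V" if w: "\<omega> \<in> topspace ?X" for \<omega>
  proof -
    have "openin ?X {\<omega>' \<in> topspace ?X. f \<omega>' \<in> ball (f \<omega>) (\<epsilon> / 2)}"
      using f by (rule openin_continuous_map_preimage) simp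
    moreover have "\<omega> \<in> {\<omega>' \<in> topspace ?X. f \<omega>' \<in> ball (f \<omega>) (\<epsilon> / 2)}" using w \<epsilon> by simp
    ultimately have "\<exists>V. \<omega> \<in> (\<Pi>\<^sub>E e\<in>?I. V e) \<and> (\<forall>e. openin (discrete_topology UNIV) (V e)) \<and>
        finite {e. V e \<noteq> topspace (discrete_topology UNIV)} \<and>
        (\<Pi>\<^sub>E e\<in>?I. V e) \<subseteq> {\<omega>' \<in> topspace ?X. f \<omega>' \<in> ball (f \<omega>) (\<epsilon> / 2)}"
      unfolding config_topology_def by (rule product_topology_open_contains_basis)
    then obtain V where V0: "finite {e. V e \<noteq> (UNIV :: bool set)}" and V: "\<omega> \<in> (\<Pi>\<^sub>E e\<in>?I. V e)"
      "(\<Pi>\<^sub>E e\<in>?I. V e) \<subseteq> {\<omega>' \<in> topspace ?X. f \<omega>' \<in> ball (f \<omega>) (\<epsilon> / 2)}"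
      by auto
    have "openin ?X (\<Pi>\<^sub>E e\<in>?I. V e)"
      unfolding config_topology_def using V0 by (intro product_topology_basis) auto
    moreover have "finite {e \<in> ?I. V e \<noteq> UNIV}" using V0 by (rule finite_subset[rotated]) auto
    moreover have "\<bar>f \<omega>' - f \<omega>\<bar> < \<epsilon> / 2" if "\<omega>' \<in> (\<Pi>\<^sub>E e\<in>?I. V e)" for \<omega>'
      using V(2) that by (auto simp: dist_real_def abs_minus_commute)
    ultimately show ?thesis using V unfolding nbhd_def by blast
  qed
  then obtain V where "\<And>\<omega>. \<omega> \<in> topspace ?X \<Longrightarrow> nbhd \<omega> (V \<omega>)" by metis
  then have V: "\<And>\<omega>. \<omega> \<in> topspace ?X \<Longrightarrow> finite {e \<in> ?I. V \<omega> e \<noteq> UNIV} \<and> openin ?X (\<Pi>\<^sub>E e\<in>?I. V \<omega> e) \<and>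
      \<omega> \<in> (\<Pi>\<^sub>E e\<in>?I. V \<omega> e) \<and> (\<forall>\<omega>'\<in>(\<Pi>\<^sub>E e\<in>?I. V \<omega> e). \<bar>f \<omega>' - f \<omega>\<bar> < \<epsilon> / 2)"
    unfolding nbhd_def .
  have "compact_space ?X"
    unfolding config_topology_def by (simp add: compact_space_product_topology compact_space_discrete_topology)
  then have "compactin ?X (topspace ?X)" by (simp add: compact_space_def)
  then have "\<exists>\<F>. finite \<F> \<and> \<F> \<subseteq> (\<lambda>\<omega>. \<Pi>\<^sub>E e\<in>?I. V \<omega> e) ` topspace ?X \<and> topspace ?X \<subseteq> \<Union>\<F>"
  proof (rule compactinD)
    show "openin ?X U" if U: "U \<in> (\<lambda>\<omega>. \<Pi>\<^sub>E e\<in>?I. V \<omega> e) ` topspace ?X" for U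
    proof -
      obtain \<omega> where "U = (\<Pi>\<^sub>E e\<in>?I. V \<omega> e)" "\<omega> \<in> topspace ?X" using U by (rule imageE)
      then show ?thesis using V[of \<omega>] by (simp only:)
    qed
    show "topspace ?X \<subseteq> \<Union> ((\<lambda>\<omega>. \<Pi>\<^sub>E e\<in>?I. V \<omega> e) ` topspace ?X)"
    proof
      fix \<omega> assume w: "\<omega> \<in> topspace ?X"
      have "\<omega> \<in> (\<Pi>\<^sub>E e\<in>?I. V \<omega> e)" using V[OF w] by (elim conjE)
      then show "\<omega> \<in> \<Union> ((\<lambda>\<omega>. \<Pi>\<^sub>E e\<in>?I. V \<omega> e) ` topspace ?X)"
        using w by (intro UnionI[OF imageI])
    qed
  qed
  then obtain \<F> where \<F>: "finite \<F>" "\<F> \<subseteq> (\<lambda>\<omega>. \<Pi>\<^sub>E e\<in>?I. V \<omega> e) ` topspace ?X" "topspace ?X \<subseteq> \<Union>\<F>"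
    by (elim exE conjE)
  obtain W where W': "W \<subseteq> topspace ?X" "finite W" "\<F> = (\<lambda>\<omega>. \<Pi>\<^sub>E e\<in>?I. V \<omega> e) ` W"
    using finite_subset_image[OF \<F>(1,2)] by (elim exE conjE)
  have W: "finite W" "W \<subseteq> topspace ?X" "topspace ?X \<subseteq> (\<Union>\<omega>\<in>W. \<Pi>\<^sub>E e\<in>?I. V \<omega> e)"
    using W' \<F>(3) by (simp_all only:)
  define J where "J = (\<Union>\<omega>\<in>W. {e \<in> ?I. V \<omega> e \<noteq> UNIV})"
  have "finite J" unfolding J_def
  proof (rule finite_UN_I[OF W(1)])
    fix \<omega> assume "\<omega> \<in> W"
    then show "finite {e \<in> ?I. V \<omega> e \<noteq> UNIV}" by (rule V[OF subsetD[OF W(2)], THEN conjunct1])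
  qed
  moreover have "J \<subseteq> ?I" by (auto simp: J_def)
  moreover have "\<bar>f \<omega> - f \<omega>'\<bar> < \<epsilon>"
    if w: "\<omega> \<in> topspace ?X" "\<omega>' \<in> topspace ?X" "open_edges J \<omega> = open_edges J \<omega>'" for \<omega> \<omega>'
  proof -
    obtain z where z: "z \<in> W" "\<omega> \<in> (\<Pi>\<^sub>E e\<in>?I. V z e)" using subsetD[OF W(3) w(1)] by (rule UN_E)
    have eq: "\<omega> e = \<omega>' e" if "e \<in> J" for e using w(3) that by (auto simp: open_edges_def)
    have "\<omega>' \<in> (\<Pi>\<^sub>E e\<in>?I. V z e)"
    proof (rule PiE_I)
      fix e assume e: "e \<in> ?I"
      show "\<omega>' e \<in> V z e"
      proof (cases "e \<in> J")
        case True
        then show ?thesis using eq[OF True] z(2) e by (auto simp: PiE_iff)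
      next
        case False
        then show ?thesis using e z(1) by (auto simp: J_def)
      qed
    qed (use w(2) in \<open>auto simp: PiE_iff extensional_def\<close>)
    moreover have "\<forall>\<omega>'\<in>(\<Pi>\<^sub>E e\<in>?I. V z e). \<bar>f \<omega>' - f z\<bar> < \<epsilon> / 2"
      by (rule V[OF subsetD[OF W(2) z(1)], THEN conjunct2, THEN conjunct2, THEN conjunct2])
    ultimately have "\<bar>f \<omega>' - f z\<bar> < \<epsilon> / 2" "\<bar>f \<omega> - f z\<bar> < \<epsilon> / 2"
      using z(2) by (auto dest: bspec)
    then show ?thesis by linarith
  qed
  ultimately show ?thesis by blast
qed

lemma monotone_net_convergent:
  fixes f :: "'v set \<Rightarrow> real"
  assumes mono: "\<And>A B. finite B \<Longrightarrow> A \<subseteq> B \<Longrightarrow> f A \<le> f B" and bound: "\<And>A. finite A \<Longrightarrow> f A \<le> b"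
  shows "\<exists>l. (f \<longlongrightarrow> l) (finite_subsets_at_top UNIV)"
proof -
  define l where "l = (SUP A\<in>{A. finite A}. f A)"
  have bdd: "bdd_above (f ` {A. finite A})" using bound by (intro bdd_aboveI[of _ b]) auto
  have "(f \<longlongrightarrow> l) (finite_subsets_at_top UNIV)"
  proof (rule order_tendstoI)
    fix a assume "a < l"
    then obtain A where A: "finite A" "a < f A"
      using less_cSUP_iff[of "{A. finite A}" f a] bdd unfolding l_def by blast
    then have "\<forall>B. finite B \<and> A \<subseteq> B \<and> B \<subseteq> UNIV \<longrightarrow> a < f B" using mono by (meson order_less_le_trans)
    then show "\<forall>\<^sub>F B in finite_subsets_at_top UNIV. a < f B"
      unfolding eventually_finite_subsets_at_top using A(1) by blast
  next
    fix a assume a: "l < a"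
    have "f B \<le> l" if "finite B" for B
      unfolding l_def using bdd that by (intro cSUP_upper) auto
    then show "\<forall>\<^sub>F B in finite_subsets_at_top UNIV. f B < a"
      using a by (intro eventually_finite_subsets_at_top_weakI) (meson order_le_less_trans)
  qed
  then show ?thesis ..
qed

text \<open>Edges outside \<open>S\<close> are closed, in agreement with
  \<open>extend_closed\<close>, and the function is undefined off the pairs so as to be a point of
  the product space.\<close>

definition config_of :: "'v set set \<Rightarrow> ('v set \<Rightarrow> bool)" where
  "config_of S = (\<lambda>e\<in>pairs UNIV. e \<in> S)"

lemma config_of_space: "config_of S \<in> (\<Pi>\<^sub>E e\<in>pairs UNIV. UNIV)"
  by (simp add: config_of_def)

lemma open_edges_config_of: "J \<subseteq> pairs UNIV \<Longrightarrow> open_edges J (config_of S) = S \<inter> J"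
  by (auto simp: open_edges_def config_of_def)

lemma config_measurable_open_edges:
  fixes F :: "'v set set \<Rightarrow> 'a"
  assumes "finite J" "J \<subseteq> pairs UNIV" "\<And>T. T \<subseteq> J \<Longrightarrow> F T \<in> space N"
  shows "(\<lambda>\<omega>. F (open_edges J \<omega>)) \<in> measurable config_space N"
proof (rule measurable_compose[of "open_edges J" config_space "count_space (Pow J)" F N])
  show "open_edges J \<in> measurable config_space (count_space (Pow J))"
    unfolding config_space_def using assms by (intro measurable_open_edges)
  show "F \<in> measurable (count_space (Pow J)) N" using assms(3) by auto
qed

text \<open>By local approximation a continuous function is a pointwise limit of functions of
  finitely many edges. This connects the topology of the weak limit with the product
  sigma-algebra.\<close>

lemma continuous_map_config_measurable:
  fixes f :: "('v set \<Rightarrow> bool) \<Rightarrow> real"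
  assumes f: "continuous_map config_topology euclideanreal f"
  shows "f \<in> borel_measurable config_space"
proof -
  have "\<exists>J. finite J \<and> J \<subseteq> pairs UNIV \<and>
    (\<forall>\<omega>\<in>topspace config_topology. \<forall>\<omega>'\<in>topspace config_topology. open_edges J \<omega> = open_edges J \<omega>' \<longrightarrow>
      \<bar>f \<omega> - f \<omega>'\<bar> < 1 / Suc n)" for n :: nat
    using f by (rule continuous_map_local_approx) simp
  then obtain J :: "nat \<Rightarrow> 'v set set" where J: "\<And>n. finite (J n)" "\<And>n. J n \<subseteq> pairs UNIV"
    "\<And>n \<omega> \<omega>'. \<omega> \<in> topspace config_topology \<Longrightarrow> \<omega>' \<in> topspace config_topology \<Longrightarrow>
      open_edges (J n) \<omega> = open_edges (J n) \<omega>' \<Longrightarrow> \<bar>f \<omega> - f \<omega>'\<bar> < 1 / Suc n"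
    by metis
  show ?thesis
  proof (rule borel_measurable_LIMSEQ_real)
    show "(\<lambda>\<omega>. f (config_of (open_edges (J n) \<omega>))) \<in> borel_measurable config_space" for n
      using J(1,2) by (rule config_measurable_open_edges) simp
    fix \<omega> :: "'v set \<Rightarrow> bool" assume w: "\<omega> \<in> space config_space"
    show "(\<lambda>n. f (config_of (open_edges (J n) \<omega>))) \<longlonglongrightarrow> f \<omega>"
    proof (rule LIMSEQ_I)
      fix r :: real assume "r > 0"
      then obtain N :: nat where N: "1 / Suc N < r" using reals_Archimedean by (auto simp: inverse_eq_divide)
      have "norm (f (config_of (open_edges (J n) \<omega>)) - f \<omega>) < r" if "n \<ge> N" for n
      proof -
        have "open_edges (J n) (config_of (open_edges (J n) \<omega>)) = open_edges (J n) \<omega>"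
          using J(2)[of n] by (subst open_edges_config_of) (auto simp: open_edges_def)
        then have "\<bar>f (config_of (open_edges (J n) \<omega>)) - f \<omega>\<bar> < 1 / Suc n"
          using w config_of_space by (intro J(3)) (auto simp: space_config)
        also have "1 / real (Suc n) \<le> 1 / real (Suc N)" using that by (intro divide_left_mono) auto
        finally show ?thesis using N by simp
      qed
      then show "\<exists>no. \<forall>n\<ge>no. norm (f (config_of (open_edges (J n) \<omega>)) - f \<omega>) < r" by blast
    qed
  qed
qed

lemma abs_diff_three:
  fixes a b c d r :: real
  assumes "\<bar>a - b\<bar> \<le> r / 3" "\<bar>d - b\<bar> < r / 3" "\<bar>c - d\<bar> \<le> r / 3"
  shows "\<bar>c - a\<bar> < r"
  using assms by linarith

context rc
begin

definition cylinder_limit :: "'v set set \<Rightarrow> 'v set set \<Rightarrow> real" where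
  "cylinder_limit J T = Lim (finite_subsets_at_top UNIV) (\<lambda>\<Lambda>. pr (pairs \<Lambda>) (\<lambda>S. S \<inter> J = T))"

text \<open>Without closed edges the event is increasing and its probability is monotone in the
  volume. Closed edges are added one at a time: requiring \<open>e\<close> closed is the difference
  between no condition on \<open>e\<close> and \<open>e\<close> open.\<close>

lemma pr_cylinder_convergent:
  assumes "finite U"
  shows "\<exists>l. ((\<lambda>\<Lambda>. pr (pairs \<Lambda>) (\<lambda>S. T \<subseteq> S \<and> S \<inter> U = {})) \<longlongrightarrow> l) (finite_subsets_at_top UNIV)"
  using assms
proof (induct U arbitrary: T rule: finite_induct)
  case empty
  show ?case
  proof (rule monotone_net_convergent)
    show "pr (pairs A) (\<lambda>S. T \<subseteq> S \<and> S \<inter> {} = {}) \<le> pr (pairs B) (\<lambda>S. T \<subseteq> S \<and> S \<inter> {} = {})"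
      if "finite B" "A \<subseteq> B" for A B
      using that by (intro pr_increasing pairs_mono) auto
    show "pr (pairs A) (\<lambda>S. T \<subseteq> S \<and> S \<inter> {} = {}) \<le> 1" if "finite A" for A
      using that by (intro pr_le_1) simp
  qed
next
  case (insert e U)
  obtain l where l: "((\<lambda>\<Lambda>. pr (pairs \<Lambda>) (\<lambda>S. T \<subseteq> S \<and> S \<inter> U = {})) \<longlongrightarrow> l) (finite_subsets_at_top UNIV)"
    using insert by blast
  obtain l' where l': "((\<lambda>\<Lambda>. pr (pairs \<Lambda>) (\<lambda>S. insert e T \<subseteq> S \<and> S \<inter> U = {})) \<longlongrightarrow> l') (finite_subsets_at_top UNIV)"
    using insert by blast
  have "pr (pairs \<Lambda>) (\<lambda>S. T \<subseteq> S \<and> S \<inter> insert e U = {}) =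
      pr (pairs \<Lambda>) (\<lambda>S. T \<subseteq> S \<and> S \<inter> U = {}) - pr (pairs \<Lambda>) (\<lambda>S. insert e T \<subseteq> S \<and> S \<inter> U = {})" for \<Lambda>
  proof -
    have "pr (pairs \<Lambda>) (\<lambda>S. (T \<subseteq> S \<and> S \<inter> U = {}) \<and> e \<in> S) = pr (pairs \<Lambda>) (\<lambda>S. insert e T \<subseteq> S \<and> S \<inter> U = {})"
      "pr (pairs \<Lambda>) (\<lambda>S. (T \<subseteq> S \<and> S \<inter> U = {}) \<and> e \<notin> S) = pr (pairs \<Lambda>) (\<lambda>S. T \<subseteq> S \<and> S \<inter> insert e U = {})"
      by (rule pr_cong; auto)+
    then show ?thesis using pr_and_not[of "pairs \<Lambda>" "\<lambda>S. T \<subseteq> S \<and> S \<inter> U = {}" "\<lambda>S. e \<in> S"] by simp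
  qed
  then show ?case using tendsto_diff[OF l l'] by auto
qed

lemma tendsto_cylinder_limit:
  assumes "finite J" "T \<subseteq> J"
  shows "((\<lambda>\<Lambda>. pr (pairs \<Lambda>) (\<lambda>S. S \<inter> J = T)) \<longlongrightarrow> cylinder_limit J T) (finite_subsets_at_top UNIV)"
proof -
  obtain l where "((\<lambda>\<Lambda>. pr (pairs \<Lambda>) (\<lambda>S. T \<subseteq> S \<and> S \<inter> (J - T) = {})) \<longlongrightarrow> l) (finite_subsets_at_top UNIV)"
    using pr_cylinder_convergent[of "J - T" T] assms by blast
  moreover have "(\<lambda>S. T \<subseteq> S \<and> S \<inter> (J - T) = {}) = (\<lambda>S. S \<inter> J = T)" using assms(2) by auto
  ultimately have l: "((\<lambda>\<Lambda>. pr (pairs \<Lambda>) (\<lambda>S. S \<inter> J = T)) \<longlongrightarrow> l) (finite_subsets_at_top UNIV)" by simp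
  then show ?thesis unfolding cylinder_limit_def using tendsto_Lim[OF _ l] by simp
qed

lemma ex_local:
  assumes "finite J"
  shows "ex E (\<lambda>S. F (S \<inter> J)) = (\<Sum>T\<in>Pow J. F T * pr E (\<lambda>S. S \<inter> J = T))"
proof -
  have "ex E (\<lambda>S. F (S \<inter> J)) = ex E (\<lambda>S. \<Sum>T\<in>Pow J. F T * of_bool (S \<inter> J = T))"
  proof (rule ex_cong)
    fix S
    have "(\<Sum>T\<in>Pow J. F T * of_bool (S \<inter> J = T)) = (\<Sum>T\<in>{S \<inter> J}. F T * of_bool (S \<inter> J = T))"
      using assms by (intro sum.mono_neutral_right) auto
    then show "F (S \<inter> J) = (\<Sum>T\<in>Pow J. F T * of_bool (S \<inter> J = T))" by simp
  qed
  then show ?thesis by (simp add: ex_sum ex_cmult pr_def)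
qed

lemma ex_local_tendsto:
  assumes "finite J"
  shows "((\<lambda>\<Lambda>. ex (pairs \<Lambda>) (\<lambda>S. F (S \<inter> J))) \<longlongrightarrow> (\<Sum>T\<in>Pow J. F T * cylinder_limit J T)) (finite_subsets_at_top UNIV)"
  unfolding ex_local[OF assms]
  by (intro tendsto_sum tendsto_mult tendsto_const tendsto_cylinder_limit) (use assms in auto)

text \<open>Positivity, total mass and consistency of the limiting cylinder probabilities pass to
  the limit from finite volume, where they are trivial.\<close>

lemma limit_measure_exists:
  "\<exists>M. prob_space M \<and> sets M = sets config_space \<and>
     (\<forall>J T. finite J \<longrightarrow> J \<subseteq> pairs UNIV \<longrightarrow> T \<subseteq> J \<longrightarrow>
        measure M {\<omega> \<in> space M. open_edges J \<omega> = T} = cylinder_limit J T)"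
  unfolding config_space_def
proof (rule kolmogorov_extension_bool)
  fix J T :: "'v set set" assume J: "finite J" "T \<subseteq> J"
  have "\<forall>\<^sub>F \<Lambda> in finite_subsets_at_top UNIV. 0 \<le> pr (pairs \<Lambda>) (\<lambda>S. S \<inter> J = T)"
    by (intro eventually_finite_subsets_at_top_weakI pr_nonneg) simp
  then show "0 \<le> cylinder_limit J T"
    using tendsto_lowerbound[OF tendsto_cylinder_limit[OF J]] by simp
next
  fix J :: "'v set set" assume J: "finite J"
  have "\<forall>\<^sub>F \<Lambda> in finite_subsets_at_top UNIV. ex (pairs \<Lambda>) (\<lambda>S. 1) = 1"
    by (intro eventually_finite_subsets_at_top_weakI ex_const) simp
  then have "((\<lambda>\<Lambda>. ex (pairs \<Lambda>) (\<lambda>S. 1)) \<longlongrightarrow> 1) (finite_subsets_at_top UNIV)"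
    by (rule tendsto_eventually)
  with ex_local_tendsto[OF J, of "\<lambda>_. 1"] show "(\<Sum>T\<in>Pow J. cylinder_limit J T) = 1"
    by (intro tendsto_unique[OF finite_subsets_at_top_neq_bot]) auto
next
  fix J H T :: "'v set set" assume H: "finite H" "J \<subseteq> H" "T \<subseteq> J"
  have "finite J" using H finite_subset by auto
  have "((\<lambda>\<Lambda>. ex (pairs \<Lambda>) (\<lambda>S. of_bool (S \<inter> H \<inter> J = T))) \<longlongrightarrow>
      (\<Sum>U\<in>Pow H. of_bool (U \<inter> J = T) * cylinder_limit H U)) (finite_subsets_at_top UNIV)"
    by (rule ex_local_tendsto[OF H(1)])
  moreover have "ex (pairs \<Lambda>) (\<lambda>S. of_bool (S \<inter> H \<inter> J = T)) = pr (pairs \<Lambda>) (\<lambda>S. S \<inter> J = T)" for \<Lambda>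
    using H(2) unfolding pr_def by (intro ex_cong) (simp add: Int_assoc Int_absorb1)
  ultimately have "cylinder_limit J T = (\<Sum>U\<in>Pow H. of_bool (U \<inter> J = T) * cylinder_limit H U)"
    using tendsto_unique[OF finite_subsets_at_top_neq_bot tendsto_cylinder_limit[OF \<open>finite J\<close> H(3)]] by simp
  also have "\<dots> = (\<Sum>U\<in>{U \<in> Pow H. U \<inter> J = T}. cylinder_limit H U)"
    using H(1) by (intro sum.mono_neutral_cong_right) auto
  finally show "cylinder_limit J T = (\<Sum>U\<in>{U \<in> Pow H. U \<inter> J = T}. cylinder_limit H U)" .
qed

lemma integral_open_edges:
  fixes F :: "'v set set \<Rightarrow> real"
  assumes M: "prob_space M" "sets M = sets config_space"
    and J: "finite J" "J \<subseteq> pairs UNIV"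
  shows "(\<integral>\<omega>. F (open_edges J \<omega>) \<partial>M) = (\<Sum>T\<in>Pow J. F T * measure M {\<omega> \<in> space M. open_edges J \<omega> = T})"
proof -
  interpret prob_space M by fact
  have ev: "{\<omega> \<in> space M. open_edges J \<omega> = T} \<in> sets M" for T
  proof -
    have "(\<lambda>\<omega>. open_edges J \<omega> = T) \<in> measurable config_space (count_space UNIV)"
      using config_measurable_open_edges[OF J, of "\<lambda>U. U = T" "count_space UNIV"] by simp
    then have "{\<omega> \<in> space config_space. open_edges J \<omega> = T} \<in> sets config_space"
      by (simp add: pred_def)
    then show ?thesis using M(2) sets_eq_imp_space_eq[OF M(2)] by simp
  qed
  have "(\<integral>\<omega>. F (open_edges J \<omega>) \<partial>M) = (\<integral>\<omega>. (\<Sum>T\<in>Pow J. F T * indicator {\<omega> \<in> space M. open_edges J \<omega> = T} \<omega>) \<partial>M)"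
  proof (rule Bochner_Integration.integral_cong[OF refl])
    fix \<omega> assume w: "\<omega> \<in> space M"
    have "(\<Sum>T\<in>Pow J. F T * indicator {\<omega> \<in> space M. open_edges J \<omega> = T} \<omega>) =
        (\<Sum>T\<in>{open_edges J \<omega>}. F T * indicator {\<omega> \<in> space M. open_edges J \<omega> = T} \<omega>)"
    proof (rule sum.mono_neutral_right)
      show "{open_edges J \<omega>} \<subseteq> Pow J" by (auto simp: open_edges_def)
    qed (use J in \<open>auto simp: indicator_def\<close>)
    then show "F (open_edges J \<omega>) = (\<Sum>T\<in>Pow J. F T * indicator {\<omega> \<in> space M. open_edges J \<omega> = T} \<omega>)"
      using w by simp
  qed
  also have "\<dots> = (\<Sum>T\<in>Pow J. \<integral>\<omega>. F T * indicator {\<omega> \<in> space M. open_edges J \<omega> = T} \<omega> \<partial>M)"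
    using ev by (intro Bochner_Integration.integral_sum integrable_mult_right integrable_real_indicator)
      (auto simp: emeasure_eq_measure)
  also have "\<dots> = (\<Sum>T\<in>Pow J. F T * measure M {\<omega> \<in> space M. open_edges J \<omega> = T})"
    using ev by (intro sum.cong) auto
  finally show ?thesis .
qed

text \<open>A three-term estimate: \<open>f\<close> is within r/3 of a local function under
  \<open>M\<close> and in every finite volume, and for local functions convergence is
  \<open>ex_local_tendsto\<close>.\<close>

lemma limit_measure_weak:
  fixes f :: "('v set \<Rightarrow> bool) \<Rightarrow> real"
  assumes M: "prob_space M" "sets M = sets config_space"
    and cyl: "\<And>J T. finite J \<Longrightarrow> J \<subseteq> pairs UNIV \<Longrightarrow> T \<subseteq> J \<Longrightarrow>
        measure M {\<omega> \<in> space M. open_edges J \<omega> = T} = cylinder_limit J T"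
    and f: "continuous_map config_topology euclideanreal f" "bounded (f ` topspace config_topology)"
  shows "((\<lambda>\<Lambda>. ex (pairs \<Lambda>) (\<lambda>S. f (config_of S))) \<longlongrightarrow> (\<integral>\<omega>. f \<omega> \<partial>M)) (finite_subsets_at_top UNIV)"
proof (rule tendstoI)
  fix r :: real assume r: "r > 0"
  interpret prob_space M by fact
  have sp: "space M = topspace config_topology" using sets_eq_imp_space_eq[OF M(2)] by simp
  obtain J where J: "finite J" "J \<subseteq> pairs UNIV"
    and approx: "\<And>\<omega> \<omega>'. \<omega> \<in> topspace config_topology \<Longrightarrow> \<omega>' \<in> topspace config_topology \<Longrightarrow>
      open_edges J \<omega> = open_edges J \<omega>' \<Longrightarrow> \<bar>f \<omega> - f \<omega>'\<bar> < r / 3"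
    using continuous_map_local_approx[OF f(1), of "r / 3"] r by auto
  let ?F = "\<lambda>T. f (config_of T)"
  have c: "config_of S \<in> topspace config_topology" for S :: "'v set set" using config_of_space by simp
  have fm: "f \<in> borel_measurable M"
    using continuous_map_config_measurable[OF f(1)] measurable_cong_sets[OF M(2) refl] by blast
  obtain b where b: "\<And>\<omega>. \<omega> \<in> topspace config_topology \<Longrightarrow> norm (f \<omega>) \<le> b"
    using f(2) unfolding bounded_iff by blast
  have int1: "integrable M f"
    using fm b sp by (intro integrable_const_bound[where B = b]) auto
  have Fm: "(\<lambda>\<omega>. ?F (open_edges J \<omega>)) \<in> borel_measurable M"
    using config_measurable_open_edges[OF J, of ?F borel] measurable_cong_sets[OF M(2) refl] by auto
  have int2: "integrable M (\<lambda>\<omega>. ?F (open_edges J \<omega>))"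
    using Fm b c by (intro integrable_const_bound[where B = b]) auto
  have approx_M: "\<bar>(\<integral>\<omega>. f \<omega> \<partial>M) - (\<integral>\<omega>. ?F (open_edges J \<omega>) \<partial>M)\<bar> \<le> r / 3"
  proof -
    have "(\<integral>\<omega>. f \<omega> \<partial>M) - (\<integral>\<omega>. ?F (open_edges J \<omega>) \<partial>M) = (\<integral>\<omega>. f \<omega> - ?F (open_edges J \<omega>) \<partial>M)"
      using int1 int2 by simp
    also have "\<bar>\<dots>\<bar> \<le> (\<integral>\<omega>. \<bar>f \<omega> - ?F (open_edges J \<omega>)\<bar> \<partial>M)" by (rule integral_abs_bound)
    also have "\<dots> \<le> (\<integral>\<omega>. r / 3 \<partial>M)"
    proof (rule integral_mono)
      fix \<omega> assume w: "\<omega> \<in> space M"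
      have "open_edges J \<omega> = open_edges J (config_of (open_edges J \<omega>))"
        using J(2) by (subst open_edges_config_of) (auto simp: open_edges_def)
      then show "\<bar>f \<omega> - ?F (open_edges J \<omega>)\<bar> \<le> r / 3" using w sp c approx by (intro less_imp_le) auto
    qed (use int1 int2 in auto)
    also have "\<dots> = r / 3" by (simp add: prob_space)
    finally show ?thesis .
  qed
  have lim: "((\<lambda>\<Lambda>. ex (pairs \<Lambda>) (\<lambda>S. ?F (S \<inter> J))) \<longlongrightarrow> (\<integral>\<omega>. ?F (open_edges J \<omega>) \<partial>M)) (finite_subsets_at_top UNIV)"
  proof -
    have "(\<integral>\<omega>. ?F (open_edges J \<omega>) \<partial>M) = (\<Sum>T\<in>Pow J. ?F T * cylinder_limit J T)"
      unfolding integral_open_edges[OF M J, of ?F] using J by (intro sum.cong) (auto simp: cyl)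
    then show ?thesis using ex_local_tendsto[OF J(1), of ?F] by simp
  qed
  have approx_finite: "\<bar>ex (pairs \<Lambda>) (\<lambda>S. f (config_of S)) - ex (pairs \<Lambda>) (\<lambda>S. ?F (S \<inter> J))\<bar> \<le> r / 3" if "finite \<Lambda>" for \<Lambda>
  proof -
    have a: "\<bar>f (config_of S) - ?F (S \<inter> J)\<bar> \<le> r / 3" for S
    proof -
      have "open_edges J (config_of S) = open_edges J (config_of (S \<inter> J))"
        using J(2) by (simp add: open_edges_config_of)
      then show ?thesis using c approx by (intro less_imp_le) auto
    qed
    have "ex (pairs \<Lambda>) (\<lambda>S. f (config_of S)) \<le> ex (pairs \<Lambda>) (\<lambda>S. r / 3 + ?F (S \<inter> J))"
    proof (rule ex_mono)
      show "f (config_of S) \<le> r / 3 + ?F (S \<inter> J)" for S using abs_le_D1[OF a[of S]] by linarith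
    qed (use that in simp)
    moreover have "ex (pairs \<Lambda>) (\<lambda>S. ?F (S \<inter> J)) \<le> ex (pairs \<Lambda>) (\<lambda>S. r / 3 + f (config_of S))"
    proof (rule ex_mono)
      show "?F (S \<inter> J) \<le> r / 3 + f (config_of S)" for S using abs_le_D2[OF a[of S]] by linarith
    qed (use that in simp)
    moreover have "ex (pairs \<Lambda>) (\<lambda>S. r / 3 + h S) = r / 3 + ex (pairs \<Lambda>) h" for h
      using that by (simp add: ex_add ex_const)
    ultimately show ?thesis by (intro abs_leI) simp_all
  qed
  have close: "dist (ex (pairs \<Lambda>) (\<lambda>S. f (config_of S))) (\<integral>\<omega>. f \<omega> \<partial>M) < r"
    if "finite \<Lambda>" "dist (ex (pairs \<Lambda>) (\<lambda>S. ?F (S \<inter> J))) (\<integral>\<omega>. ?F (open_edges J \<omega>) \<partial>M) < r / 3" for \<Lambda>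
    unfolding dist_real_def
    by (rule abs_diff_three[OF approx_M that(2)[unfolded dist_real_def] approx_finite[OF that(1)]])
  have "\<forall>\<^sub>F \<Lambda> in finite_subsets_at_top UNIV. finite \<Lambda> \<and>
      dist (ex (pairs \<Lambda>) (\<lambda>S. ?F (S \<inter> J))) (\<integral>\<omega>. ?F (open_edges J \<omega>) \<partial>M) < r / 3"
  proof (rule eventually_conj)
    show "\<forall>\<^sub>F \<Lambda> in finite_subsets_at_top UNIV. finite \<Lambda>"
      by (rule eventually_finite_subsets_at_top_weakI)
    show "\<forall>\<^sub>F \<Lambda> in finite_subsets_at_top UNIV.
        dist (ex (pairs \<Lambda>) (\<lambda>S. ?F (S \<inter> J))) (\<integral>\<omega>. ?F (open_edges J \<omega>) \<partial>M) < r / 3"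
      using tendstoD[OF lim, of "r / 3"] r by simp
  qed
  then show "\<forall>\<^sub>F \<Lambda> in finite_subsets_at_top UNIV. dist (ex (pairs \<Lambda>) (\<lambda>S. f (config_of S))) (\<integral>\<omega>. f \<omega> \<partial>M) < r"
    by (rule eventually_mono) (use close in blast)
qed

end

section \<open>Agreement of edge sets and weights with the given configurations and measures\<close>

lemma joined_open_bonds:
  assumes "\<And>u v. u \<noteq> v \<Longrightarrow> (u \<in> V \<and> v \<in> V \<and> \<omega> {u, v}) = ({u, v} \<in> S)"
  shows "(open_bonds V \<omega>)\<^sup>* = joined S"
proof -
  have "open_bonds V \<omega> = {(u, v). u \<noteq> v \<and> {u, v} \<in> S}"
    using assms by (auto simp: open_bonds_def)
  then show ?thesis by (simp add: joined_def)
qed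

lemma clusters_eq:
  assumes "S \<subseteq> pairs V" "\<And>e. e \<in> pairs V \<Longrightarrow> \<omega> e = (e \<in> S)"
  shows "clusters V \<omega> = cl S ` V"
proof -
  have *: "(open_bonds V \<omega>)\<^sup>* = joined S"
  proof (rule joined_open_bonds)
    fix u v :: 'a assume uv: "u \<noteq> v"
    show "(u \<in> V \<and> v \<in> V \<and> \<omega> {u, v}) = ({u, v} \<in> S)"
    proof (cases "u \<in> V \<and> v \<in> V")
      case True
      then show ?thesis using assms(2)[of "{u, v}"] uv by (simp add: pairsI)
    next
      case False
      then have "{u, v} \<notin> pairs V" by (auto simp: pairs_def doubleton_eq_iff)
      then show ?thesis using False assms(1) by auto
    qed
  qed
  have "Restr (joined S) V `` {x} = cl S x" if "x \<in> V" for x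
    using that cl_subset_pairs[OF assms(1) that] by (auto simp: cl_def)
  then have "V // Restr (joined S) V = cl S ` V"
    unfolding quotient_def by auto
  then show ?thesis unfolding clusters_def * .
qed

lemma has_infinite_cluster_iff:
  "has_infinite_cluster \<omega> \<longleftrightarrow> (\<exists>x. infinite (cl (open_edges (pairs UNIV) \<omega>) x))"
proof -
  have "clusters UNIV \<omega> = range (cl (open_edges (pairs UNIV) \<omega>))"
    by (rule clusters_eq) (auto simp: open_edges_def)
  then show ?thesis by (simp add: has_infinite_cluster_def)
qed

context long_range_beta
begin

lemma bond_prob_eq: "e \<in> pairs UNIV \<Longrightarrow> bond_prob P \<beta> e = 1 - exp (- (\<beta> * coupling P e))"
proof -
  assume "e \<in> pairs UNIV"
  then obtain u v where uv: "e = {u, v}" "u \<noteq> v" using doubleton_pairs by blast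
  have "bond_prob P \<beta> e = 1 - exp (- \<beta> * P (u - v))"
    unfolding bond_prob_def uv(1)
  proof (rule the_equality)
    fix p assume "\<exists>a b. {u, v} = {a, b} \<and> p = 1 - exp (- \<beta> * P (a - b))"
    then show "p = 1 - exp (- \<beta> * P (u - v))"
      using P_sym[of "u - v"] by (auto simp: doubleton_eq_iff)
  qed auto
  then show ?thesis using coupling_eq[OF uv(2)] uv(1) by simp
qed

text \<open>With 1 - p = exp(-t) the odds p/(1 - p) are exp(t) - 1. The prefactor does not depend on
  \<open>S\<close> and cancels in the normalisation.\<close>

lemma rc_weight_eq:
  assumes "finite \<Lambda>" "S \<subseteq> pairs \<Lambda>"
  shows "rc_weight P q \<beta> \<Lambda> (\<lambda>e\<in>pairs \<Lambda>. e \<in> S) =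
    q ^ card \<Lambda> * (\<Prod>e\<in>pairs \<Lambda>. exp (- (\<beta> * coupling P e))) * w S"
proof -
  let ?E = "pairs \<Lambda>"
  let ?t = "\<lambda>e. \<beta> * coupling P e"
  have fE: "finite ?E" using assms by simp
  have "clusters \<Lambda> (\<lambda>e\<in>?E. e \<in> S) = cl S ` \<Lambda>" using assms(2) by (intro clusters_eq) auto
  then have c: "card (clusters \<Lambda> (\<lambda>e\<in>?E. e \<in> S)) = nc \<Lambda> S" by (simp add: nc_def)
  have "(\<Prod>e\<in>?E. if (\<lambda>e\<in>?E. e \<in> S) e then bond_prob P \<beta> e else 1 - bond_prob P \<beta> e) =
      (\<Prod>e\<in>?E. exp (- ?t e) * (if e \<in> S then exp (?t e) - 1 else 1))"
  proof (rule prod.cong[OF refl])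
    fix e assume e: "e \<in> ?E"
    then have "bond_prob P \<beta> e = 1 - exp (- ?t e)" by (intro bond_prob_eq subsetD[OF pairs_UNIV])
    then show "(if (\<lambda>e\<in>?E. e \<in> S) e then bond_prob P \<beta> e else 1 - bond_prob P \<beta> e) =
        exp (- ?t e) * (if e \<in> S then exp (?t e) - 1 else 1)"
      using e by (simp add: right_diff_distrib exp_minus)
  qed
  also have "\<dots> = (\<Prod>e\<in>?E. exp (- ?t e)) * (\<Prod>e\<in>?E. if e \<in> S then exp (?t e) - 1 else 1)"
    by (rule prod.distrib)
  also have "(\<Prod>e\<in>?E. if e \<in> S then exp (?t e) - 1 else 1) = (\<Prod>e\<in>S. exp (?t e) - 1)"
    using fE assms(2) by (intro prod.mono_neutral_cong_right) auto
  finally have p: "(\<Prod>e\<in>?E. if (\<lambda>e\<in>?E. e \<in> S) e then bond_prob P \<beta> e else 1 - bond_prob P \<beta> e) =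
      (\<Prod>e\<in>?E. exp (- ?t e)) * (\<Prod>e\<in>S. exp (?t e) - 1)" .
  have "\<Union>S \<subseteq> \<Lambda>" using assms(2) by (fastforce simp: pairs_def)
  then have "w S = (\<Prod>e\<in>S. exp (?t e) - 1) * (q ^ nc \<Lambda> S / q ^ card \<Lambda>)"
    using assms(1) by (intro w_alt)
  then show ?thesis unfolding rc_weight_def c p by simp
qed

lemma bij_configs: "bij_betw (\<lambda>S. \<lambda>e\<in>pairs \<Lambda>. e \<in> S) (Pow (pairs \<Lambda>)) (configs \<Lambda>)"
proof (rule bij_betwI[where g = "\<lambda>\<omega>. {e \<in> pairs \<Lambda>. \<omega> e}"])
  show "(\<lambda>S. \<lambda>e\<in>pairs \<Lambda>. e \<in> S) \<in> Pow (pairs \<Lambda>) \<rightarrow> configs \<Lambda>" by (auto simp: configs_def)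
  show "(\<lambda>e\<in>pairs \<Lambda>. e \<in> {e \<in> pairs \<Lambda>. \<omega> e}) = \<omega>" if "\<omega> \<in> configs \<Lambda>" for \<omega>
    using that by (auto simp: configs_def restrict_def PiE_iff extensional_def)
qed auto

lemma integral_free_rc:
  fixes f :: "((int ^ 'd) set \<Rightarrow> bool) \<Rightarrow> real"
  assumes \<Lambda>: "finite \<Lambda>" and f: "f \<in> borel_measurable config_space"
  shows "(\<integral>\<omega>. f \<omega> \<partial>distr (free_rc P q \<beta> \<Lambda>) config_space (extend_closed \<Lambda>)) = ex (pairs \<Lambda>) (\<lambda>S. f (config_of S))"
proof -
  let ?E = "pairs \<Lambda>"
  let ?\<chi> = "\<lambda>S. \<lambda>e\<in>?E. e \<in> S"
  let ?W = "rc_weight P q \<beta> \<Lambda>"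
  define c where "c = q ^ card \<Lambda> * (\<Prod>e\<in>?E. exp (- (\<beta> * coupling P e)))"
  have c: "c > 0" unfolding c_def by (intro mult_pos_pos prod_pos) auto
  have W: "?W (?\<chi> S) = c * w S" if "S \<in> Pow ?E" for S
    using rc_weight_eq[OF \<Lambda>] that by (simp add: c_def)
  have fin: "finite (configs \<Lambda>)" using \<Lambda> by (auto simp: configs_def intro!: finite_PiE)
  have sumW: "(\<Sum>\<omega>\<in>configs \<Lambda>. ?W \<omega>) = c * Z ?E"
  proof -
    have "(\<Sum>\<omega>\<in>configs \<Lambda>. ?W \<omega>) = (\<Sum>S\<in>Pow ?E. ?W (?\<chi> S))"
      by (rule sum.reindex_bij_betw[OF bij_configs, symmetric])
    also have "\<dots> = (\<Sum>S\<in>Pow ?E. c * w S)" by (rule sum.cong[OF refl W])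
    finally show ?thesis by (simp add: Z_def sum_distrib_left)
  qed
  have Z: "Z ?E > 0" using \<Lambda> by (intro Z_pos) simp
  have nn: "0 \<le> ?W \<omega> / (c * Z ?E)" if "\<omega> \<in> configs \<Lambda>" for \<omega>
  proof -
    have "\<omega> \<in> ?\<chi> ` Pow ?E" using that by (simp only: bij_betw_imp_surj_on[OF bij_configs])
    then obtain S where "S \<in> Pow ?E" "\<omega> = ?\<chi> S" by (rule imageE)
    then show ?thesis using W c Z by simp
  qed
  have "(\<integral>\<omega>. f \<omega> \<partial>distr (free_rc P q \<beta> \<Lambda>) config_space (extend_closed \<Lambda>)) =
      (\<integral>\<omega>. f (extend_closed \<Lambda> \<omega>) \<partial>free_rc P q \<beta> \<Lambda>)"
    using f by (intro integral_distr) (auto simp: free_rc_def extend_closed_def space_config)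
  also have "\<dots> = (\<Sum>\<omega>\<in>configs \<Lambda>. (?W \<omega> / (c * Z ?E)) *\<^sub>R f (extend_closed \<Lambda> \<omega>))"
    unfolding free_rc_def sumW using fin nn by (intro lebesgue_integral_point_measure_finite)
  also have "\<dots> = (\<Sum>S\<in>Pow ?E. (?W (?\<chi> S) / (c * Z ?E)) *\<^sub>R f (extend_closed \<Lambda> (?\<chi> S)))"
    by (rule sum.reindex_bij_betw[OF bij_configs, symmetric])
  also have "\<dots> = (\<Sum>S\<in>Pow ?E. w S * f (config_of S) / Z ?E)"
  proof (rule sum.cong[OF refl])
    fix S assume S: "S \<in> Pow ?E"
    have "extend_closed \<Lambda> (?\<chi> S) = config_of S"
      using S by (auto simp: extend_closed_def config_of_def restrict_def)
    then show "(?W (?\<chi> S) / (c * Z ?E)) *\<^sub>R f (extend_closed \<Lambda> (?\<chi> S)) = w S * f (config_of S) / Z ?E"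
      using W[OF S] c by simp
  qed
  also have "\<dots> = ex ?E (\<lambda>S. f (config_of S))" by (simp add: ex_def sum_divide_distrib)
  finally show ?thesis .
qed

text \<open>Existence and uniqueness of the weak limit, so that the description defining
  \<open>free_rc_infinite\<close> denotes it. For uniqueness, local functions are bounded and
  continuous, so two limits agree on the cylinders, which generate the sigma-algebra.\<close>

lemma free_rc_infinite:
  shows "prob_space (free_rc_infinite P q \<beta>)" "sets (free_rc_infinite P q \<beta>) = sets config_space"
    and "\<And>J T. finite J \<Longrightarrow> J \<subseteq> pairs UNIV \<Longrightarrow> T \<subseteq> J \<Longrightarrow>
        measure (free_rc_infinite P q \<beta>) {\<omega> \<in> space (free_rc_infinite P q \<beta>). open_edges J \<omega> = T} = cylinder_limit J T"
proof -
  let ?net = "finite_subsets_at_top (UNIV :: (int ^ 'd) set)"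
  let ?\<mu> = "\<lambda>\<Lambda>. distr (free_rc P q \<beta> \<Lambda>) config_space (extend_closed \<Lambda>)"
  obtain M :: "((int ^ 'd) set \<Rightarrow> bool) measure" where M: "prob_space M" "sets M = sets config_space"
    and cyl: "\<And>J T. finite J \<Longrightarrow> J \<subseteq> pairs UNIV \<Longrightarrow> T \<subseteq> J \<Longrightarrow>
        measure M {\<omega> \<in> space M. open_edges J \<omega> = T} = cylinder_limit J T"
    using limit_measure_exists by blast
  have \<mu>: "\<forall>\<^sub>F \<Lambda> in ?net. (\<integral>\<omega>. f \<omega> \<partial>?\<mu> \<Lambda>) = ex (pairs \<Lambda>) (\<lambda>S. f (config_of S))"
    if "continuous_map config_topology euclideanreal f" for f
    using that by (intro eventually_finite_subsets_at_top_weakI integral_free_rc continuous_map_config_measurable)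
  have lim: "is_infinite_volume_limit P q \<beta> M"
    unfolding is_infinite_volume_limit_def weak_limit_def
  proof (intro conjI allI impI M)
    fix f :: "((int ^ 'd) set \<Rightarrow> bool) \<Rightarrow> real"
    assume f: "continuous_map config_topology euclideanreal f \<and> bounded (f ` topspace config_topology)"
    have "((\<lambda>\<Lambda>. ex (pairs \<Lambda>) (\<lambda>S. f (config_of S))) \<longlongrightarrow> (\<integral>\<omega>. f \<omega> \<partial>M)) ?net"
      using f by (intro limit_measure_weak M cyl) auto
    then show "((\<lambda>\<Lambda>. \<integral>\<omega>. f \<omega> \<partial>?\<mu> \<Lambda>) \<longlongrightarrow> (\<integral>\<omega>. f \<omega> \<partial>M)) ?net"
      using filterlim_cong[OF refl refl \<mu>[of f]] f by blast
  qed
  have uniq: "N = M" if N: "is_infinite_volume_limit P q \<beta> N" for N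
  proof -
    have N': "prob_space N" "sets N = sets config_space"
      using N by (auto simp: is_infinite_volume_limit_def)
    have loc: "(\<integral>\<omega>. F (open_edges J \<omega>) \<partial>N) = (\<integral>\<omega>. F (open_edges J \<omega>) \<partial>M)"
      if J: "finite J" "J \<subseteq> pairs UNIV" for F :: "(int ^ 'd) set set \<Rightarrow> real" and J
    proof -
      let ?f = "\<lambda>\<omega>. F (open_edges J \<omega>)"
      have cont: "continuous_map config_topology euclideanreal ?f" using J by (rule continuous_map_open_edges)
      have "?f ` topspace config_topology \<subseteq> F ` Pow J" by (auto simp: open_edges_def)
      then have "bounded (?f ` topspace config_topology)"
        using J by (meson finite_Pow_iff finite_imageI finite_imp_bounded finite_subset)
      then have "((\<lambda>\<Lambda>. \<integral>\<omega>. ?f \<omega> \<partial>?\<mu> \<Lambda>) \<longlongrightarrow> (\<integral>\<omega>. ?f \<omega> \<partial>N)) ?net"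
        "((\<lambda>\<Lambda>. \<integral>\<omega>. ?f \<omega> \<partial>?\<mu> \<Lambda>) \<longlongrightarrow> (\<integral>\<omega>. ?f \<omega> \<partial>M)) ?net"
        using N lim cont unfolding is_infinite_volume_limit_def weak_limit_def by blast+
      then show ?thesis by (rule tendsto_unique[OF finite_subsets_at_top_neq_bot])
    qed
    interpret M: prob_space M by fact
    interpret N: prob_space N by fact
    have sp: "space N = space M" using M N' by (metis sets_eq_imp_space_eq)
    show "N = M"
    proof (rule measure_eqI_PiM_infinite[where I = "pairs UNIV" and M = "\<lambda>_. count_space UNIV"])
      show "sets N = sets (\<Pi>\<^sub>M e\<in>pairs UNIV. count_space UNIV)" "sets M = sets (\<Pi>\<^sub>M e\<in>pairs UNIV. count_space UNIV)"
        using M N' by (simp_all add: config_space_def)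
      fix A :: "(int ^ 'd) set \<Rightarrow> bool set" and J :: "(int ^ 'd) set set" assume J: "finite J" "J \<subseteq> pairs UNIV"
      let ?C = "prod_emb (pairs UNIV) (\<lambda>_. count_space UNIV) J (Pi\<^sub>E J A)"
      let ?F = "\<lambda>T. of_bool (\<forall>e\<in>J. (e \<in> T) \<in> A e) :: real"
      have C: "?C \<in> sets config_space" unfolding config_space_def using J by (intro sets_PiM_I) auto
      have ind: "indicator ?C \<omega> = ?F (open_edges J \<omega>)" if "\<omega> \<in> space config_space" for \<omega>
        using that by (auto simp: indicator_def prod_emb_def open_edges_def PiE_iff space_config)
      have "measure N ?C = (\<integral>\<omega>. indicator ?C \<omega> \<partial>N)" using C N' by simp
      also have "\<dots> = (\<integral>\<omega>. ?F (open_edges J \<omega>) \<partial>N)"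
        using ind sets_eq_imp_space_eq[OF N'(2)] by (intro Bochner_Integration.integral_cong) auto
      also have "\<dots> = (\<integral>\<omega>. ?F (open_edges J \<omega>) \<partial>M)" using J by (rule loc)
      also have "\<dots> = (\<integral>\<omega>. indicator ?C \<omega> \<partial>M)"
        using ind sets_eq_imp_space_eq[OF M(2)] by (intro Bochner_Integration.integral_cong) auto
      also have "\<dots> = measure M ?C" using C M by simp
      finally show "emeasure N ?C = emeasure M ?C" by (simp add: N.emeasure_eq_measure M.emeasure_eq_measure)
    qed (unfold_locales)
  qed
  have "free_rc_infinite P q \<beta> = M"
    unfolding free_rc_infinite_def using lim uniq by (rule the_equality)
  then show "prob_space (free_rc_infinite P q \<beta>)" "sets (free_rc_infinite P q \<beta>) = sets config_space"
    "\<And>J T. finite J \<Longrightarrow> J \<subseteq> pairs UNIV \<Longrightarrow> T \<subseteq> J \<Longrightarrow>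
        measure (free_rc_infinite P q \<beta>) {\<omega> \<in> space (free_rc_infinite P q \<beta>). open_edges J \<omega> = T} = cylinder_limit J T"
    using M cyl by auto
qed

lemma local_events:
  fixes A :: "(int ^ 'd) set set \<Rightarrow> bool"
  assumes J: "finite J" "J \<subseteq> pairs UNIV"
  shows "{\<omega> \<in> space (free_rc_infinite P q \<beta>). A (open_edges J \<omega>)} \<in> sets (free_rc_infinite P q \<beta>)"
    and "((\<lambda>\<Lambda>. pr (pairs \<Lambda>) (\<lambda>S. A (S \<inter> J))) \<longlongrightarrow>
      measure (free_rc_infinite P q \<beta>) {\<omega> \<in> space (free_rc_infinite P q \<beta>). A (open_edges J \<omega>)}) (finite_subsets_at_top UNIV)"
proof -
  let ?M = "free_rc_infinite P q \<beta>"
  let ?F = "\<lambda>T. of_bool (A T) :: real"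
  note M = free_rc_infinite
  have "(\<lambda>\<omega>. A (open_edges J \<omega>)) \<in> measurable config_space (count_space UNIV)"
    using config_measurable_open_edges[OF J, of A "count_space UNIV"] by simp
  then have "{\<omega> \<in> space config_space. A (open_edges J \<omega>)} \<in> sets config_space"
    by (simp add: pred_def)
  then show ev: "{\<omega> \<in> space ?M. A (open_edges J \<omega>)} \<in> sets ?M"
    using M(2) sets_eq_imp_space_eq[OF M(2)] by simp
  have "measure ?M {\<omega> \<in> space ?M. A (open_edges J \<omega>)} = (\<integral>\<omega>. indicator {\<omega> \<in> space ?M. A (open_edges J \<omega>)} \<omega> \<partial>?M)"
    using ev by simp
  also have "\<dots> = (\<integral>\<omega>. ?F (open_edges J \<omega>) \<partial>?M)"
    by (intro Bochner_Integration.integral_cong) (auto simp: indicator_def)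
  also have "\<dots> = (\<Sum>T\<in>Pow J. ?F T * cylinder_limit J T)"
    unfolding integral_open_edges[OF M(1,2) J, of ?F] using J by (intro sum.cong) (auto simp: M(3))
  finally show "((\<lambda>\<Lambda>. pr (pairs \<Lambda>) (\<lambda>S. A (S \<inter> J))) \<longlongrightarrow>
      measure ?M {\<omega> \<in> space ?M. A (open_edges J \<omega>)}) (finite_subsets_at_top UNIV)"
    using ex_local_tendsto[OF J(1), of ?F] by (simp add: pr_def)
qed

text \<open>Probabilities of increasing events grow with the volume, so a finite-volume probability
  is a lower bound for the limit.\<close>

lemma increasing_local_event:
  assumes \<Lambda>: "finite \<Lambda>" and A: "\<And>S S'. S \<subseteq> S' \<Longrightarrow> S' \<subseteq> pairs \<Lambda> \<Longrightarrow> A S \<Longrightarrow> A S'"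
  shows "pr (pairs \<Lambda>) A \<le> measure (free_rc_infinite P q \<beta>) {\<omega> \<in> space (free_rc_infinite P q \<beta>). A (open_edges (pairs \<Lambda>) \<omega>)}"
proof -
  have "\<forall>\<^sub>F \<Lambda>' in finite_subsets_at_top UNIV. pr (pairs \<Lambda>) A \<le> pr (pairs \<Lambda>') (\<lambda>S. A (S \<inter> pairs \<Lambda>))"
    unfolding eventually_finite_subsets_at_top
  proof (intro exI conjI allI impI)
    fix \<Lambda>' assume \<Lambda>': "finite \<Lambda>' \<and> \<Lambda> \<subseteq> \<Lambda>' \<and> \<Lambda>' \<subseteq> UNIV"
    have "pr (pairs \<Lambda>) A = pr (pairs \<Lambda>) (\<lambda>S. A (S \<inter> pairs \<Lambda>))"
      by (rule pr_cong) (simp add: Int_absorb2)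
    also have "\<dots> \<le> pr (pairs \<Lambda>') (\<lambda>S. A (S \<inter> pairs \<Lambda>))"
    proof (rule pr_increasing)
      show "pairs \<Lambda> \<subseteq> pairs \<Lambda>'" using \<Lambda>' by (intro pairs_mono) auto
      fix S S' assume S: "S \<subseteq> S'" "A (S \<inter> pairs \<Lambda>)"
      have "S \<inter> pairs \<Lambda> \<subseteq> S' \<inter> pairs \<Lambda>" using S(1) by (rule Int_mono) simp
      then show "A (S' \<inter> pairs \<Lambda>)" by (rule A[OF _ _ S(2)]) simp
    qed (use \<Lambda>' in auto)
    finally show "pr (pairs \<Lambda>) A \<le> pr (pairs \<Lambda>') (\<lambda>S. A (S \<inter> pairs \<Lambda>))" .
  qed (use \<Lambda> in auto)
  moreover have "((\<lambda>\<Lambda>'. pr (pairs \<Lambda>') (\<lambda>S. A (S \<inter> pairs \<Lambda>))) \<longlongrightarrow>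
      measure (free_rc_infinite P q \<beta>) {\<omega> \<in> space (free_rc_infinite P q \<beta>). A (open_edges (pairs \<Lambda>) \<omega>)}) (finite_subsets_at_top UNIV)"
    using \<Lambda> by (intro local_events) auto
  ultimately show ?thesis by (intro tendsto_lowerbound[OF _ _ finite_subsets_at_top_neq_bot])
qed

end

section \<open>The critical point\<close>

text \<open>The union of the clusters in the growing volumes is closed under open edges, since both
  ends of an edge lie in a common volume.\<close>

lemma cl_exhaustion:
  assumes S: "S \<subseteq> pairs UNIV" and V: "incseq V" "(\<Union>k::nat. V k) = UNIV"
  shows "cl S x \<subseteq> (\<Union>k. cl (S \<inter> pairs (V k)) x)"
proof (rule cl_closed)
  show "x \<in> (\<Union>k. cl (S \<inter> pairs (V k)) x)" by auto
  fix u v assume uv: "{u, v} \<in> S" "u \<in> (\<Union>k. cl (S \<inter> pairs (V k)) x)"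
  then obtain k where k: "u \<in> cl (S \<inter> pairs (V k)) x" by auto
  obtain i j where ij: "u \<in> V i" "v \<in> V j" using V(2) by blast
  define n where "n = max k (max i j)"
  have sub: "V k \<subseteq> V n" "V i \<subseteq> V n" "V j \<subseteq> V n" 
    using incseqD[OF V(1), of k n] incseqD[OF V(1), of i n] incseqD[OF V(1), of j n] by (auto simp: n_def)
  have "u \<noteq> v" using uv(1) S by (auto simp: pairs_def doubleton_eq_iff)
  then have "{u, v} \<in> S \<inter> pairs (V n)" using uv(1) ij sub by (intro IntI pairsI) auto
  then have "v \<in> cl (S \<inter> pairs (V n)) u" by (rule cl_edge)
  moreover have "u \<in> cl (S \<inter> pairs (V n)) x"
    using k pairs_mono[OF sub(1)] cl_mono[of "S \<inter> pairs (V k)" "S \<inter> pairs (V n)"] by blast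
  ultimately have "v \<in> cl (S \<inter> pairs (V n)) x" using cl_eq by metis
  then show "v \<in> (\<Union>k. cl (S \<inter> pairs (V k)) x)" by blast
qed

lemma infinite_cl_exhaustion:
  assumes S: "S \<subseteq> pairs UNIV" and V: "incseq V" "(\<Union>k::nat. V k) = UNIV" "\<And>k. finite (V k)"
    and inf: "infinite (cl S x)"
  shows "\<exists>k. n \<le> card (cl (S \<inter> pairs (V k)) x)"
proof -
  obtain F where F: "F \<subseteq> cl S x" "finite F" "card F = n"
    using infinite_arbitrarily_large[OF inf] by blast
  have mono: "incseq (\<lambda>k. cl (S \<inter> pairs (V k)) x)"
  proof (rule incseq_SucI)
    show "cl (S \<inter> pairs (V k)) x \<subseteq> cl (S \<inter> pairs (V (Suc k))) x" for k
      using pairs_mono[OF incseq_SucD[OF V(1)]] by (intro cl_mono) blast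
  qed
  have "F \<subseteq> (\<Union>k. cl (S \<inter> pairs (V k)) x)" using F(1) cl_exhaustion[OF S V(1,2)] by blast
  with F(2) have "\<exists>k. F \<subseteq> cl (S \<inter> pairs (V k)) x"
  proof (induct F rule: finite_induct)
    case (insert y F)
    then obtain k j where "F \<subseteq> cl (S \<inter> pairs (V k)) x" "y \<in> cl (S \<inter> pairs (V j)) x" by auto
    moreover have "cl (S \<inter> pairs (V k)) x \<subseteq> cl (S \<inter> pairs (V (max k j))) x"
      "cl (S \<inter> pairs (V j)) x \<subseteq> cl (S \<inter> pairs (V (max k j))) x"
      using incseqD[OF mono, of k "max k j"] incseqD[OF mono, of j "max k j"] by auto
    ultimately show ?case by blast
  qed simp
  then obtain k where k: "F \<subseteq> cl (S \<inter> pairs (V k)) x" by auto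
  have "n \<le> card (cl (S \<inter> pairs (V k)) x)"
    using card_mono[OF finite_cl[OF V(3)] k] F(3) by simp
  then show ?thesis ..
qed

lemma open_edges_Int: "J \<subseteq> I \<Longrightarrow> open_edges I \<omega> \<inter> J = open_edges J \<omega>"
  by (auto simp: open_edges_def)

context long_range_beta
begin

text \<open>By translation the assumed bound holds at every vertex. Along an exhaustion by cubes it
  bounds the probability of a cluster of size at least m, so each of the countably many vertices
  almost surely has a finite cluster. The contrapositive turns failure of almost sure absence into
  one \<theta> valid for all sizes.\<close>

lemma no_percolation:
  assumes small: "\<And>\<theta>. \<theta> > 0 \<Longrightarrow> \<exists>m :: real. \<forall>V. finite V \<longrightarrow> 0 \<in> V \<longrightarrow> pr (pairs V) (\<lambda>S. m \<le> real (card (cl S 0))) < \<theta>"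
  shows "AE \<omega> in free_rc_infinite P q \<beta>. \<not> has_infinite_cluster \<omega>"
proof -
  let ?M = "free_rc_infinite P q \<beta>"
  interpret prob_space ?M by (rule free_rc_infinite)
  define V :: "nat \<Rightarrow> (int ^ 'd) set" where "V k = cube (\<chi> i. - int k) (2 * k + 1)" for k
  have V: "incseq V" "\<And>k. finite (V k)"
  proof -
    show "incseq V"
    proof (rule incseq_SucI, rule subsetI)
      fix k x assume "x \<in> V k"
      then have h: "- int k \<le> x $ i \<and> x $ i < - int k + int (2 * k + 1)" for i
        by (simp add: V_def cube_def)
      have "- int (Suc k) \<le> x $ i \<and> x $ i < - int (Suc k) + int (2 * Suc k + 1)" for i
        using h[of i] by auto
      then show "x \<in> V (Suc k)" by (simp only: V_def cube_def mem_Collect_eq vec_lambda_beta) blast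
    qed
  qed (simp add: V_def)
  have V_UNIV: "(\<Union>k. V k) = UNIV"
  proof (intro set_eqI iffI UNIV_I)
    fix x :: "int ^ 'd"
    define k where "k = nat (\<Sum>i\<in>UNIV. \<bar>x $ i\<bar>)"
    have "\<bar>x $ i\<bar> \<le> int k" for i
    proof -
      have "\<bar>x $ i\<bar> \<le> (\<Sum>i\<in>UNIV. \<bar>x $ i\<bar>)" by (rule member_le_sum) auto
      then show ?thesis unfolding k_def by linarith
    qed
    then have "x \<in> V k" by (auto simp: V_def cube_def abs_le_iff) (smt (verit))+
    then show "x \<in> (\<Union>k. V k)" by blast
  qed
  have "AE \<omega> in ?M. finite (cl (open_edges (pairs UNIV) \<omega>) x)" for x
  proof -
    let ?B = "\<lambda>m k. {\<omega> \<in> space ?M. (\<lambda>S. m \<le> real (card (cl S x))) (open_edges (pairs (V k)) \<omega>)}"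
    have ev: "?B m k \<in> events" for m :: real and k
      using V(2) by (intro local_events) auto
    have bound: "measure ?M (\<Union>k. ?B m k) \<le> \<theta>"
      if m: "\<forall>V. finite V \<longrightarrow> 0 \<in> V \<longrightarrow> pr (pairs V) (\<lambda>S. m \<le> real (card (cl S 0))) < \<theta>" for m \<theta> :: real
    proof -
      have b: "measure ?M (?B m k) \<le> \<theta>" for k
      proof -
        have "\<forall>\<^sub>F \<Lambda> in finite_subsets_at_top UNIV. pr (pairs \<Lambda>) (\<lambda>S. m \<le> real (card (cl (S \<inter> pairs (V k)) x))) \<le> \<theta>"
          unfolding eventually_finite_subsets_at_top
        proof (intro exI conjI allI impI)
          show "finite {x}" "{x} \<subseteq> UNIV" by auto
          fix \<Lambda> assume \<Lambda>: "finite \<Lambda> \<and> {x} \<subseteq> \<Lambda> \<and> \<Lambda> \<subseteq> UNIV"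
          have "pr (pairs \<Lambda>) (\<lambda>S. m \<le> real (card (cl (S \<inter> pairs (V k)) x))) \<le> pr (pairs \<Lambda>) (\<lambda>S. m \<le> real (card (cl S x)))"
          proof (rule pr_mono)
            fix S assume S: "S \<subseteq> pairs \<Lambda>" "m \<le> real (card (cl (S \<inter> pairs (V k)) x))"
            have "finite (cl S x)" using finite_cl[of \<Lambda> S x] \<Lambda> S(1) by (simp add: Int_absorb2)
            then have "card (cl (S \<inter> pairs (V k)) x) \<le> card (cl S x)" by (intro card_mono cl_mono) auto
            then show "m \<le> real (card (cl S x))" using S(2) by linarith
          qed (use \<Lambda> in simp)
          also have "\<dots> = pr (pairs ((+) (- x) ` \<Lambda>)) (\<lambda>S. m \<le> real (card (cl S 0)))"
          proof -
            have eq: "pairs \<Lambda> = pairs ((+) x ` ((+) (- x) ` \<Lambda>))" by (simp add: image_image)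
            have "cl ((`) ((+) x) ` S) (x + 0) = (+) x ` cl S 0" for S by (rule cl_image) simp
            then have "card (cl ((`) ((+) x) ` S) x) = card (cl S 0)" for S by (simp add: card_image)
            then show ?thesis unfolding eq using \<Lambda> by (subst pr_shift) auto
          qed
          also have "\<dots> < \<theta>" using \<Lambda> by (intro m[rule_format]) (auto intro: image_eqI[of _ _ x])
          finally show "pr (pairs \<Lambda>) (\<lambda>S. m \<le> real (card (cl (S \<inter> pairs (V k)) x))) \<le> \<theta>" by simp
        qed
        then show ?thesis
          using local_events(2)[of "pairs (V k)" "\<lambda>S. m \<le> real (card (cl S x))"] V(2)
          by (intro tendsto_upperbound[OF _ _ finite_subsets_at_top_neq_bot]) auto
      qed
      have "incseq (?B m)"
      proof (rule incseq_SucI, safe)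
        fix k \<omega> assume w: "m \<le> real (card (cl (open_edges (pairs (V k)) \<omega>) x))"
        have "finite (cl (open_edges (pairs (V (Suc k))) \<omega>) x)"
          using finite_cl[OF V(2)[of "Suc k"], of "open_edges (pairs UNIV) \<omega>" x] by (simp add: open_edges_Int)
        moreover have "open_edges (pairs (V k)) \<omega> \<subseteq> open_edges (pairs (V (Suc k))) \<omega>"
          using pairs_mono[OF incseq_SucD[OF V(1)]] by (auto simp: open_edges_def)
        ultimately have "card (cl (open_edges (pairs (V k)) \<omega>) x) \<le> card (cl (open_edges (pairs (V (Suc k))) \<omega>) x)"
          by (intro card_mono cl_mono)
        then show "m \<le> real (card (cl (open_edges (pairs (V (Suc k))) \<omega>) x))" using w by linarith
      qed
      then have "(\<lambda>k. measure ?M (?B m k)) \<longlonglongrightarrow> measure ?M (\<Union>k. ?B m k)"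
        using ev by (intro finite_Lim_measure_incseq) auto
      then show ?thesis using b by (intro LIMSEQ_le_const2) auto
    qed
    have "\<exists>m. measure ?M (\<Union>k. ?B m k) \<le> 1 / Suc n" for n :: nat
    proof -
      have "(0::real) < 1 / Suc n" by simp
      from small[OF this] obtain m :: real where
        "\<forall>V. finite V \<longrightarrow> 0 \<in> V \<longrightarrow> pr (pairs V) (\<lambda>S. m \<le> real (card (cl S 0))) < 1 / Suc n" by (elim exE)
      then show ?thesis by (intro exI[of _ m] bound)
    qed
    then have "\<forall>n. \<exists>m. measure ?M (\<Union>k. ?B m k) \<le> 1 / Suc n" by (rule allI)
    from choice[OF this] obtain m where m: "\<And>n. measure ?M (\<Union>k. ?B (m n) k) \<le> 1 / Suc n" by blast
    let ?N = "\<Inter>n. \<Union>k. ?B (m n) k"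
    have evU: "(\<Union>k. ?B m k) \<in> events" for m using ev by (intro sets.countable_UN) auto
    have "?N \<in> events" using evU by (intro sets.countable_INT) auto
    moreover have "measure ?M ?N = 0"
    proof (rule ccontr)
      assume "measure ?M ?N \<noteq> 0"
      then have "0 < measure ?M ?N" by (simp add: zero_less_measure_iff)
      then obtain n :: nat where n: "1 / Suc n < measure ?M ?N"
        using reals_Archimedean by (auto simp: inverse_eq_divide)
      have "measure ?M ?N \<le> measure ?M (\<Union>k. ?B (m n) k)" using evU by (intro finite_measure_mono) auto
      then show False using n m[of n] by linarith
    qed
    ultimately have "AE \<omega> in ?M. \<omega> \<notin> ?N"
      by (intro AE_not_in) (simp add: null_sets_def emeasure_eq_measure)
    then show ?thesis
    proof (rule AE_mp, intro AE_I2 impI)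
      fix \<omega> assume w: "\<omega> \<in> space ?M" "\<omega> \<notin> ?N"
      show "finite (cl (open_edges (pairs UNIV) \<omega>) x)"
      proof (rule ccontr)
        assume inf: "infinite (cl (open_edges (pairs UNIV) \<omega>) x)"
        have "\<exists>k. \<omega> \<in> ?B (m n) k" for n
        proof -
          have "open_edges (pairs UNIV) \<omega> \<subseteq> pairs UNIV" by (auto simp: open_edges_def)
          from infinite_cl_exhaustion[OF this V(1) V_UNIV V(2) inf]
          obtain k where "nat \<lceil>m n\<rceil> \<le> card (cl (open_edges (pairs UNIV) \<omega> \<inter> pairs (V k)) x)"
            by blast
          then have "m n \<le> real (card (cl (open_edges (pairs (V k)) \<omega>) x))"
            by (simp add: open_edges_Int)
          then show ?thesis using w by auto
        qed
        then show False using w by auto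
      qed
    qed
  qed
  then have "AE \<omega> in ?M. \<forall>x. finite (cl (open_edges (pairs UNIV) \<omega>) x)" by (simp add: AE_all_countable)
  then show ?thesis by (simp add: has_infinite_cluster_iff)
qed

text \<open>With probability at least 1 - 2^(-k), for infinitely many n a cluster of size
  \<open>m n\<close> meets the box of side \<open>L k\<close>. If all clusters of the finitely many
  vertices of this box were finite, their sizes would be bounded, against \<open>m\<close> tending
  to infinity.\<close>

lemma percolation:
  fixes L :: "nat \<Rightarrow> nat" and m :: "nat \<Rightarrow> real"
  assumes m: "filterlim m at_top sequentially"
    and L: "\<And>n k. k \<le> n \<Longrightarrow> cube (0 :: int ^ 'd) (L k) \<subseteq> cube 0 (L n)"
    and big: "\<And>n k. k \<le> n \<Longrightarrow> pr (pairs (cube 0 (L n))) (has_big (cube 0 (L k)) (cube (0 :: int ^ 'd) (L n)) (m n)) \<ge> 1 - (1 / 2) ^ k"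
  shows "AE \<omega> in free_rc_infinite P q \<beta>. has_infinite_cluster \<omega>"
proof -
  let ?M = "free_rc_infinite P q \<beta>"
  interpret prob_space ?M by (rule free_rc_infinite)
  let ?J = "\<lambda>n. pairs (cube (0 :: int ^ 'd) (L n))"
  define E where "E k n = {\<omega> \<in> space ?M. has_big (cube 0 (L k)) (cube (0 :: int ^ 'd) (L n)) (m n) (open_edges (?J n) \<omega>)}" for k n
  have ev: "E k n \<in> events" for k n unfolding E_def by (intro local_events) auto
  have prob_E: "1 - (1 / 2) ^ k \<le> prob (E k n)" if "k \<le> n" for k n
  proof -
    have "pr (?J n) (has_big (cube 0 (L k)) (cube 0 (L n)) (m n)) \<le> prob (E k n)"
      unfolding E_def
    proof (rule increasing_local_event)
      show "has_big (cube 0 (L k)) (cube 0 (L n)) (m n) S'"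
        if "S \<subseteq> S'" "has_big (cube 0 (L k)) (cube 0 (L n)) (m n) S" for S S' :: "(int ^ 'd) set set"
        by (rule has_big_mono[OF _ _ _ that(1) _ that(2)]) auto
    qed simp
    then show ?thesis using big[OF that] by linarith
  qed
  define U where "U k N = (\<Union>n\<in>{n. n \<ge> N \<and> n \<ge> k}. E k n)" for k N
  have evU: "U k N \<in> events" for k N unfolding U_def using ev by (intro sets.countable_UN') auto
  have prob_U: "1 - (1 / 2) ^ k \<le> prob (U k N)" for k N
  proof -
    have "prob (E k (max N k)) \<le> prob (U k N)"
      using evU by (intro finite_measure_mono) (unfold U_def, rule UN_upper, simp)
    then show ?thesis using prob_E[of k "max N k"] by simp
  qed
  define G where "G k = (\<Inter>N. U k N)" for k
  have evG: "G k \<in> events" for k unfolding G_def using evU by (intro sets.countable_INT) auto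
  have prob_G: "1 - (1 / 2) ^ k \<le> prob (G k)" for k
  proof -
    have "decseq (U k)" unfolding decseq_def U_def by (intro allI impI UN_mono) auto
    then have "(\<lambda>N. prob (U k N)) \<longlonglongrightarrow> prob (G k)"
      unfolding G_def using evU by (intro finite_Lim_measure_decseq) auto
    then show ?thesis using prob_U by (intro LIMSEQ_le_const) auto
  qed
  have evUG: "(\<Union>k. G k) \<in> events" using evG by (intro sets.countable_UN) auto
  have "prob (\<Union>k. G k) = 1"
  proof (rule antisym)
    have "(\<lambda>k. 1 - (1 / 2) ^ k :: real) \<longlonglongrightarrow> 1 - 0" by (intro tendsto_intros LIMSEQ_realpow_zero) auto
    moreover have "1 - (1 / 2) ^ k \<le> prob (\<Union>k. G k)" for k
      using prob_G[of k] finite_measure_mono[OF _ evUG, of "G k"] by (meson UN_upper UNIV_I order_trans)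
    ultimately show "1 \<le> prob (\<Union>k. G k)" by (intro LIMSEQ_le_const2) auto
  qed simp
  then have "AE \<omega> in ?M. \<omega> \<in> (\<Union>k. G k)" using AE_in_set_eq_1[OF evUG] by blast
  then show ?thesis
  proof (rule AE_mp, intro AE_I2 impI)
    fix \<omega> assume "\<omega> \<in> space ?M" "\<omega> \<in> (\<Union>k. G k)"
    then obtain k where k: "\<omega> \<in> G k" by auto
    let ?S = "open_edges (pairs UNIV) \<omega>"
    let ?B = "cube (0 :: int ^ 'd) (L k)"
    show "has_infinite_cluster \<omega>"
    proof (rule ccontr)
      assume "\<not> has_infinite_cluster \<omega>"
      then have fin: "finite (cl ?S x)" for x by (simp add: has_infinite_cluster_iff)
      define c where "c = (\<Sum>x\<in>?B. card (cl ?S x))"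
      obtain N where N: "\<And>n. n \<ge> N \<Longrightarrow> real c + 1 \<le> m n"
        using m unfolding filterlim_at_top eventually_sequentially by blast
      have "\<omega> \<in> U k N" using k by (simp add: G_def)
      then obtain n where n: "n \<ge> N" "\<omega> \<in> E k n" by (auto simp: U_def)
      then obtain x where x: "x \<in> ?B" "m n \<le> real (card (cl (open_edges (?J n) \<omega> \<inter> ?J n) x))"
        by (auto simp: E_def has_big_def)
      have "card (cl (open_edges (?J n) \<omega> \<inter> ?J n) x) \<le> card (cl ?S x)"
        using fin subsetD[OF pairs_UNIV]
        by (intro card_mono cl_mono) (auto simp: open_edges_def)
      also have "\<dots> \<le> c" unfolding c_def using x(1) by (intro member_le_sum) auto
      finally show False using x(2) N[OF n(1)] by linarith
    qed
  qed
qed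

end

context long_range
begin

text \<open>In finite volume the probability is a quotient of finite sums of functions continuous in
  \<beta>. Staying above \<beta>0/2 keeps the constants of \<open>renormalization\<close>
  valid.\<close>

lemma \<phi>_continuous:
  assumes "\<beta>0 > 0" "finite V" "a < \<phi> \<beta>0 V A"
  shows "\<exists>\<beta>. \<beta>0 / 2 \<le> \<beta> \<and> \<beta> < \<beta>0 \<and> a < \<phi> \<beta> V A"
proof -
  define w' where "w' \<beta> S = (\<Prod>e\<in>S. exp (\<beta> * coupling P e) - 1) * (q ^ nc (\<Union>S) S / q ^ card (\<Union>S))" for \<beta> S
  define f where "f \<beta> = (\<Sum>S\<in>Pow (pairs V). w' \<beta> S * of_bool (A S)) / (\<Sum>S\<in>Pow (pairs V). w' \<beta> S)" for \<beta>
  have eq: "\<phi> \<beta> V A = f \<beta>" and pos: "(\<Sum>S\<in>Pow (pairs V). w' \<beta> S) > 0" if "\<beta> \<ge> 0" for \<beta>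
  proof -
    interpret long_range_beta P q s R \<beta> by unfold_locales (rule that)
    have "w S = w' \<beta> S" for S by (simp add: w_def w'_def)
    then show "pr (pairs V) A = f \<beta>" by (simp add: pr_def ex_def Z_def f_def)
    show "(\<Sum>S\<in>Pow (pairs V). w' \<beta> S) > 0"
      using Z_pos[of "pairs V"] assms(2) by (simp add: Z_def w_def w'_def)
  qed
  have "isCont f \<beta>0"
    unfolding f_def w'_def using pos[of \<beta>0] assms(1) unfolding w'_def
    by (intro continuous_intros) auto
  then have "(f \<longlongrightarrow> f \<beta>0) (at_left \<beta>0)"
    unfolding isCont_def by (rule tendsto_mono[rotated]) (simp add: at_le)
  moreover have "a < f \<beta>0" using assms eq[of \<beta>0] by simp
  ultimately have "\<forall>\<^sub>F \<beta> in at_left \<beta>0. a < f \<beta>" by (rule order_tendstoD)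
  moreover have "\<forall>\<^sub>F \<beta> in at_left \<beta>0. \<beta> \<in> {\<beta>0 / 2<..<\<beta>0}"
    using assms(1) by (intro eventually_at_leftI[of "\<beta>0 / 2"]) auto
  ultimately have "\<forall>\<^sub>F \<beta> in at_left \<beta>0. a < f \<beta> \<and> \<beta> \<in> {\<beta>0 / 2<..<\<beta>0}" by (rule eventually_conj)
  then obtain \<beta> where "a < f \<beta>" "\<beta>0 / 2 < \<beta>" "\<beta> < \<beta>0"
    using eventually_happens'[OF trivial_limit_at_left_real] by fastforce
  then show ?thesis using eq[of \<beta>] assms(1) by (intro exI[of _ \<beta>]) auto
qed

lemma AE_infinite_cluster:
  assumes \<beta>: "\<beta> \<ge> 0"
    and ex: "\<exists>(L :: nat \<Rightarrow> nat) (m :: nat \<Rightarrow> real). filterlim m at_top sequentially \<and>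
        (\<forall>n k. k \<le> n \<longrightarrow> cube (0 :: int ^ 'd) (L k) \<subseteq> cube 0 (L n) \<and>
           \<phi> \<beta> (cube 0 (L n)) (has_big (cube 0 (L k)) (cube 0 (L n)) (m n)) \<ge> 1 - (1 / 2) ^ k)"
  shows "AE \<omega> in free_rc_infinite P q \<beta>. has_infinite_cluster \<omega>"
proof -
  interpret long_range_beta P q s R \<beta> by unfold_locales (rule \<beta>)
  from ex obtain L :: "nat \<Rightarrow> nat" and m :: "nat \<Rightarrow> real" where "filterlim m at_top sequentially"
    "\<forall>n k. k \<le> n \<longrightarrow> cube (0 :: int ^ 'd) (L k) \<subseteq> cube 0 (L n) \<and>
           \<phi> \<beta> (cube 0 (L n)) (has_big (cube 0 (L k)) (cube 0 (L n)) (m n)) \<ge> 1 - (1 / 2) ^ k"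
    by (elim exE conjE)
  then show ?thesis by (intro percolation[of m L]) auto
qed

text \<open>Makes the set behind \<open>critical_beta\<close> nonempty, so that its infimum is
  meaningful. A star suffices: for large \<beta> all edges from 0 to the vertices of one cube beyond
  distance \<open>R\<close> are open with probability close to 1, and they form a cluster above the
  threshold.\<close>

lemma percolation_at_large_\<beta>: "\<exists>\<beta>>0. AE \<omega> in free_rc_infinite P q \<beta>. has_infinite_cluster \<omega>"
proof -
  have one: "(1::real) > 0" by simp
  from renormalization[OF one] obtain \<rho> \<eta> where \<rho>: "\<rho> > 0" and \<eta>: "\<eta> > 0" and ren: "\<forall>\<beta>\<ge>1. \<forall>N\<ge>1.
     \<phi> \<beta> (cube 0 N) (has_big (cube 0 N) (cube 0 N) (\<rho> * real N powr (s / 2))) \<ge> 1 - \<eta> \<longrightarrow>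
     (\<exists>(L :: nat \<Rightarrow> nat) (m :: nat \<Rightarrow> real). filterlim m at_top sequentially \<and>
        (\<forall>n k. k \<le> n \<longrightarrow> cube (0 :: int ^ 'd) (L k) \<subseteq> cube 0 (L n) \<and>
           \<phi> \<beta> (cube 0 (L n)) (has_big (cube 0 (L k)) (cube 0 (L n)) (m n)) \<ge> 1 - (1 / 2) ^ k))"
    by (elim exE conjE)
  let ?D = "real CARD('d)"
  define \<kappa> where "\<kappa> = real ((2 * R) ^ CARD('d))"
  define d where "d = ?D - s / 2"
  have d: "d > 0" using less_dim by (simp add: d_def)
  \<comment> \<open>Side for which N^d exceeds the threshold plus the at most (2R)^d vertices that
    may be too close to the origin.\<close>
  define N where "N = nat \<lceil>(\<rho> + \<kappa>) powr (1 / d)\<rceil> + 1"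
  have N1: "N \<ge> 1" by (simp add: N_def)
  have "\<rho> * real N powr (s / 2) + \<kappa> \<le> real (N ^ CARD('d))"
  proof -
    have \<kappa>: "\<kappa> \<ge> 0" by (simp add: \<kappa>_def)
    have "(\<rho> + \<kappa>) powr (1 / d) \<le> real N" unfolding N_def by linarith
    then have "((\<rho> + \<kappa>) powr (1 / d)) powr d \<le> real N powr d" using d by (intro powr_mono2) auto
    then have *: "\<rho> + \<kappa> \<le> real N powr d" using d \<rho> \<kappa> by (simp add: powr_powr)
    have "1 \<le> real N powr (s / 2)" using N1 s_pos by (intro ge_one_powr_ge_zero) auto
    then have "\<kappa> * 1 \<le> \<kappa> * real N powr (s / 2)" using \<kappa> by (intro mult_left_mono)
    then have "\<rho> * real N powr (s / 2) + \<kappa> \<le> (\<rho> + \<kappa>) * real N powr (s / 2)" by (simp add: distrib_right)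
    also have "\<dots> \<le> real N powr d * real N powr (s / 2)" using * by (intro mult_right_mono) auto
    also have "\<dots> = real (N ^ CARD('d))" using N1 by (simp add: powr_add[symmetric] d_def powr_realpow)
    finally show ?thesis .
  qed
  define p where "p = (?D * real N) powr (- s) / 2"
  have p: "p > 0" using N1 by (simp add: p_def)
  \<comment> \<open>Each edge of the star is closed with probability at most exp(-N^d/\<eta>), hence
    at most \<eta>/N^d, and there are at most N^d of them. The summand 1 keeps \<beta> above the
    bound 1 for which the constants were chosen.\<close>
  define \<beta> where "\<beta> = 1 + q / p * (real (N ^ CARD('d)) / \<eta>)"
  have \<beta>: "\<beta> \<ge> 1" using q_ge_1 p \<eta> by (simp add: \<beta>_def)
  interpret long_range_beta P q s R \<beta> by unfold_locales (use \<beta> in simp)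
  let ?\<Lambda> = "cube (0 :: int ^ 'd) N"
  let ?Y = "{y \<in> ?\<Lambda>. real R \<le> l1_norm y}"
  have closed: "pr (pairs ?\<Lambda>) (\<lambda>S. {0, y} \<notin> S) \<le> exp (- (\<beta> * p / q))" if y: "y \<in> ?Y" for y
  proof -
    have 0: "0 \<in> ?\<Lambda>" using N1 by (intro zero_in_cube) simp
    have ne: "y \<noteq> 0" using y R_pos by (auto simp: l1_norm_def)
    then have e: "{y, 0} \<in> pairs ?\<Lambda>" using y 0 by (intro pairsI) auto
    have "l1_norm (y - 0) \<le> ?D * real N" using y 0 by (intro l1_norm_cube[where a = 0]) auto
    then have "(?D * real N) powr (- s) \<le> l1_norm y powr (- s)"
      using y R_pos s_pos by (intro powr_mono2') auto
    then have "p \<le> P y" using P_lower[of y] y by (simp add: p_def)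
    then have c: "\<beta> * p \<le> (\<Sum>e\<in>{{y, 0}}. \<beta> * coupling P e)"
      using \<beta> coupling_eq[OF ne] by simp
    have "pr (pairs ?\<Lambda>) (\<lambda>S. (\<lambda>_. True) (S \<inter> {}) \<and> S \<inter> (\<lambda>_. {{y, 0}}) (S \<inter> {}) = {}) \<le>
        exp (- (\<beta> * p) / q) * pr (pairs ?\<Lambda>) (\<lambda>S. (\<lambda>_. True) (S \<inter> {}))"
      by (rule pr_closed_le[where F = "{}" and A = "\<lambda>_. True" and Q = "\<lambda>_. {{y, 0}}" and c = "\<beta> * p"])
        (use e c in simp_all)
    also have "\<dots> = exp (- (\<beta> * p / q))" by (simp add: pr_True)
    finally show ?thesis by (simp add: insert_commute)
  qed
  have "pr (pairs ?\<Lambda>) (\<lambda>S. \<not> has_big ?\<Lambda> ?\<Lambda> (\<rho> * real N powr (s / 2)) S) \<le> pr (pairs ?\<Lambda>) (\<lambda>S. \<exists>y\<in>?Y. {0, y} \<notin> S)"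
  proof (rule pr_mono)
    fix S assume big: "\<not> has_big ?\<Lambda> ?\<Lambda> (\<rho> * real N powr (s / 2)) S"
    show "\<exists>y\<in>?Y. {0, y} \<notin> S"
    proof (rule ccontr)
      assume S: "\<not> (\<exists>y\<in>?Y. {0, y} \<notin> S)"
      have 0: "0 \<in> ?\<Lambda>" using N1 by (intro zero_in_cube) simp
      have "?Y \<subseteq> cl (S \<inter> pairs ?\<Lambda>) 0"
      proof
        fix y assume y: "y \<in> ?Y"
        then have "0 \<noteq> y" using R_pos by (auto simp: l1_norm_def)
        then have "{0, y} \<in> S \<inter> pairs ?\<Lambda>" using S y 0 by (intro IntI pairsI) auto
        then show "y \<in> cl (S \<inter> pairs ?\<Lambda>) 0" by (rule cl_edge)
      qed
      then have 1: "card ?Y \<le> card (cl (S \<inter> pairs ?\<Lambda>) 0)" by (intro card_mono finite_cl) auto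
      have "card ?\<Lambda> \<le> card (?Y \<union> {y. l1_norm (y - 0) < real R})"
        using card_l1_ball(1)[of 0 R] by (intro card_mono) auto
      also have "\<dots> \<le> card ?Y + card {y :: int ^ 'd. l1_norm (y - 0) < real R}" by (rule card_Un_le)
      also have "\<dots> \<le> card ?Y + (2 * R) ^ CARD('d)" by (intro add_left_mono card_l1_ball)
      finally have "real (N ^ CARD('d)) \<le> real (card ?Y + (2 * R) ^ CARD('d))" unfolding card_cube of_nat_le_iff .
      then have "\<rho> * real N powr (s / 2) \<le> real (card (cl (S \<inter> pairs ?\<Lambda>) 0))"
        using \<open>\<rho> * real N powr (s / 2) + \<kappa> \<le> real (N ^ CARD('d))\<close> 1 unfolding \<kappa>_def by linarith
      then show False using big 0 by (auto simp: has_big_def)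
    qed
  qed simp
  also have "\<dots> \<le> (\<Sum>y\<in>?Y. pr (pairs ?\<Lambda>) (\<lambda>S. {0, y} \<notin> S))" by (rule pr_bex) auto
  also have "\<dots> \<le> (\<Sum>y\<in>?Y. exp (- (\<beta> * p / q)))" by (intro sum_mono closed)
  also have "\<dots> = real (card ?Y) * exp (- (\<beta> * p / q))" by simp
  also have "\<dots> \<le> real (card ?\<Lambda>) * exp (- (\<beta> * p / q))"
    by (intro mult_right_mono of_nat_mono card_mono) auto
  also have "\<dots> \<le> real (N ^ CARD('d)) * (\<eta> / real (N ^ CARD('d)))"
  proof -
    have "real (N ^ CARD('d)) / \<eta> \<le> \<beta> * p / q" using p q_ge_1 \<eta> by (simp add: \<beta>_def field_simps)
    then have "exp (- (\<beta> * p / q)) \<le> exp (- (real (N ^ CARD('d)) / \<eta>))" by simp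
    also have "\<dots> \<le> 1 / (real (N ^ CARD('d)) / \<eta>)"
      using N1 \<eta> by (intro exp_minus_le_inverse) simp
    also have "\<dots> = \<eta> / real (N ^ CARD('d))" by simp
    finally show ?thesis unfolding card_cube by (rule mult_left_mono) simp
  qed
  also have "\<dots> = \<eta>" using N1 by simp
  finally have "1 - \<eta> \<le> pr (pairs ?\<Lambda>) (has_big ?\<Lambda> ?\<Lambda> (\<rho> * real N powr (s / 2)))" by (simp add: pr_not)
  then have "AE \<omega> in free_rc_infinite P q \<beta>. has_infinite_cluster \<omega>"
    using ren \<beta> N1 by (intro AE_infinite_cluster) auto
  then show ?thesis using \<beta> by (intro exI[of _ \<beta>]) auto
qed

text \<open>Settles the a priori possible case that the infimum is 0: there every nonempty edge set
  has weight 0.\<close>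

lemma no_percolation_at_0: "AE \<omega> in free_rc_infinite P q 0. \<not> has_infinite_cluster \<omega>"
proof -
  interpret long_range_beta P q s R 0 by unfold_locales simp
  show ?thesis
  proof (rule no_percolation)
    fix \<theta> :: real assume "\<theta> > 0"
    moreover have "pr (pairs V) (\<lambda>S. 2 \<le> real (card (cl S 0))) = 0" if "finite V" for V :: "(int ^ 'd) set"
    proof -
      have "w S * of_bool (2 \<le> real (card (cl S (0 :: int ^ 'd)))) = 0" if S: "S \<in> Pow (pairs V)" for S
      proof (cases "S = {}")
        case True
        have "cl {} (0 :: int ^ 'd) \<subseteq> {0}" by (rule cl_closed) auto
        then have "card (cl {} (0 :: int ^ 'd)) \<le> card {0 :: int ^ 'd}" by (intro card_mono) auto
        then show ?thesis using True by simp
      next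
        case False
        then obtain e where "e \<in> S" by blast
        moreover have "finite S" using S \<open>finite V\<close> finite_subset[of S "pairs V"] by simp
        ultimately have "(\<Prod>e\<in>S. exp (0 * coupling P e) - 1) = 0" by (intro prod_zero) auto
        then have "w S = 0" unfolding w_def by simp
        then show ?thesis by simp
      qed
      then have "(\<Sum>S\<in>Pow (pairs V). w S * of_bool (2 \<le> real (card (cl S (0 :: int ^ 'd))))) = 0"
        by (intro sum.neutral ballI)
      then show ?thesis unfolding pr_def ex_def by (simp only: div_0)
    qed
    ultimately show "\<exists>m :: real. \<forall>V. finite V \<longrightarrow> 0 \<in> V \<longrightarrow> pr (pairs V) (\<lambda>S. m \<le> real (card (cl S (0 :: int ^ 'd)))) < \<theta>"
      by (intro exI[of _ 2]) auto
  qed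
qed

lemma no_percolation_at_criticality:
  "AE \<omega> in free_rc_infinite P q (critical_beta P q). \<not> has_infinite_cluster \<omega>"
proof (rule ccontr)
  assume neg: "\<not> ?thesis"
  let ?B = "{\<beta>. \<beta> > 0 \<and> (AE \<omega> in free_rc_infinite P q \<beta>. has_infinite_cluster \<omega>)}"
  define \<beta>c where "\<beta>c = critical_beta P q"
  have Inf: "\<beta>c = Inf ?B" by (simp add: \<beta>c_def critical_beta_def)
  have ne: "?B \<noteq> {}" using percolation_at_large_\<beta> by blast
  have bdd: "bdd_below ?B" by (rule bdd_belowI[of _ 0]) auto
  have "\<beta>c \<ge> 0" unfolding Inf using ne by (intro cInf_greatest) auto
  moreover have "\<beta>c \<noteq> 0"
  proof
    assume "\<beta>c = 0"
    then have "critical_beta P q = 0" by (simp add: \<beta>c_def)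
    from neg[unfolded this] show False using no_percolation_at_0 by (rule notE)
  qed
  ultimately have pos: "\<beta>c > 0" by simp
  interpret long_range_beta P q s R \<beta>c by unfold_locales (use pos in simp)
  \<comment> \<open>The assumption is only that absence is not almost sure, which is exactly what
    the contrapositive of \<open>no_percolation\<close> takes.\<close>
  have "\<not> (\<forall>\<theta>>0. \<exists>m :: real. \<forall>V. finite V \<longrightarrow> 0 \<in> V \<longrightarrow> pr (pairs V) (\<lambda>S. m \<le> real (card (cl S (0 :: int ^ 'd)))) < \<theta>)"
    using neg no_percolation unfolding \<beta>c_def[symmetric] by blast
  then obtain \<theta> where \<theta>: "\<theta> > 0"
    and perc: "\<And>m :: real. \<exists>V. finite V \<and> 0 \<in> V \<and> \<theta> \<le> pr (pairs V) (\<lambda>S. m \<le> real (card (cl S (0 :: int ^ 'd))))"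
    by (auto simp: not_less)
  have half: "\<beta>c / 2 > 0" using pos by simp
  from renormalization[OF half] obtain \<rho> \<eta> where \<rho>: "\<rho> > 0" and \<eta>: "\<eta> > 0" and ren: "\<forall>\<beta>\<ge>\<beta>c / 2. \<forall>N\<ge>1.
     \<phi> \<beta> (cube 0 N) (has_big (cube 0 N) (cube 0 N) (\<rho> * real N powr (s / 2))) \<ge> 1 - \<eta> \<longrightarrow>
     (\<exists>(L :: nat \<Rightarrow> nat) (m :: nat \<Rightarrow> real). filterlim m at_top sequentially \<and>
        (\<forall>n k. k \<le> n \<longrightarrow> cube (0 :: int ^ 'd) (L k) \<subseteq> cube 0 (L n) \<and>
           \<phi> \<beta> (cube 0 (L n)) (has_big (cube 0 (L k)) (cube 0 (L n)) (m n)) \<ge> 1 - (1 / 2) ^ k))"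
    by (elim exE conjE)
  obtain N where N: "N \<ge> 1" "1 - \<eta> < \<phi> \<beta>c (cube 0 N) (has_big (cube 0 N) (cube (0 :: int ^ 'd) N) (\<rho> * real N powr (s / 2)))"
    using large_finite_clusters[OF pos perc \<theta> \<rho> \<eta>] by blast
  obtain \<beta> where \<beta>: "\<beta>c / 2 \<le> \<beta>" "\<beta> < \<beta>c" "1 - \<eta> < \<phi> \<beta> (cube 0 N) (has_big (cube 0 N) (cube (0 :: int ^ 'd) N) (\<rho> * real N powr (s / 2)))"
    using \<phi>_continuous[OF pos finite_cube N(2)] by blast
  have "AE \<omega> in free_rc_infinite P q \<beta>. has_infinite_cluster \<omega>"
    by (rule AE_infinite_cluster) (use ren \<beta> N(1) pos in auto)
  then have "\<beta> \<in> ?B" using \<beta>(1) pos by auto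
  then have "\<beta>c \<le> \<beta>" unfolding Inf using bdd by (rule cInf_lower)
  then show False using \<beta>(2) by simp
qed

end

theorem theorem1p6:
  fixes P :: "int ^ 'd::finite \<Rightarrow> real" and q s :: real
  assumes "real CARD('d) < s" and "s < 2 * real CARD('d)"
    and "q \<ge> 1"
    and "\<forall>k. P k \<ge> 0"
    and "\<forall>k. P k = P (- k)"
    and "((\<lambda>k. P k / l1_norm k powr (- s)) \<longlongrightarrow> 1) (filtercomap l1_norm at_top)"
  shows "AE \<omega> in free_rc_infinite P q (critical_beta P q). \<not> has_infinite_cluster \<omega>"
proof -
  have "\<forall>\<^sub>F k in filtercomap l1_norm at_top. dist (P k / l1_norm k powr (- s)) 1 < 1 / 2"
    using tendstoD[OF assms(6), of "1 / 2"] by simp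
  then obtain b where b: "\<And>k. l1_norm k \<ge> b \<Longrightarrow> dist (P k / l1_norm k powr (- s)) 1 < 1 / 2"
    unfolding eventually_filtercomap eventually_at_top_linorder by blast
  \<comment> \<open>The summand 1 keeps \<open>l1_norm k\<close> positive beyond \<open>R\<close>,
    so that the quotient bounds can be multiplied out, and gives \<open>R \<ge> 1\<close>.\<close>
  define R where "R = nat \<lceil>b\<rceil> + 1"
  have bounds: "l1_norm k powr (- s) / 2 \<le> P k \<and> P k \<le> 2 * l1_norm k powr (- s)" if "real R \<le> l1_norm k" for k
  proof -
    have "b \<le> l1_norm k" "0 < l1_norm k" using that unfolding R_def by linarith+
    then have p: "0 < l1_norm k powr (- s)" and d: "\<bar>P k / l1_norm k powr (- s) - 1\<bar> < 1 / 2"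
      using b[of k] by (auto simp: dist_real_def)
    have "1 / 2 < P k / l1_norm k powr (- s)" "P k / l1_norm k powr (- s) < 2" using d by linarith+
    then show ?thesis using p by (simp add: pos_less_divide_eq pos_divide_less_eq)
  qed
  interpret long_range P q s R
    by unfold_locales (use assms bounds in \<open>auto simp: R_def\<close>)
  show ?thesis by (rule no_percolation_at_criticality)
qed

end
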